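(* Let $N\ge 3$, let $\Gamma\subset\mathbb{R}^N$ be a smooth closed submanifold of dimension $k$ with $1\le k<N-2$, and let $\Omega$ be a smooth domain of $\mathbb{R}^N$ containing $\Gamma$. Let $q\in C^2(\Omega)$ with $q\ge0$ in $\Omega$ and $\max_{\sigma\in\Gamma}q(\sigma)=1$. If $p\ge\frac{N-k+2}{N-k-2}$, then there is no function $u$ such that $u\in L^p_{loc}(\Omega\setminus\Gamma)$, $u\ge0$, $u\not\equiv0$ in $\Omega\setminus\Gamma$, and $$-\Delta u-\frac{(N-k-2)^2}{4}\frac{q(x)}{\operatorname{dist}(x,\Gamma)^2}u\ge u^p\quad\text{in }\mathcal{D}'(\Omega\setminus\Gamma),$$ i.e. $\int u\big(-\Delta\varphi-\frac{(N-k-2)^2}{4}\frac{q}{\operatorname{dist}(x,\Gamma)^2}\varphi\big)dx\ge\int u^p\varphi\,dx$ for all non-negative $\varphi\in C_c^\infty(\Omega\setminus\Gamma)$. *)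

theory Defs
  imports "HOL-Analysis.Analysis"
begin

definition partial :: "'n::finite \<Rightarrow> (real^'n \<Rightarrow> 'b::real_normed_vector) \<Rightarrow> real^'n \<Rightarrow> 'b" where
  "partial i f x = frechet_derivative f (at x) (axis i 1)"

fun Ck_on :: "nat \<Rightarrow> (real^'n::finite) set \<Rightarrow> (real^'n \<Rightarrow> 'b::real_normed_vector) \<Rightarrow> bool" where
  "Ck_on 0 S f = continuous_on S f"
| "Ck_on (Suc k) S f =
     ((\<forall>x\<in>S. f differentiable (at x)) \<and> continuous_on S f \<and> (\<forall>i. Ck_on k S (partial i f)))"

definition smooth_on :: "(real^'n::finite) set \<Rightarrow> (real^'n \<Rightarrow> 'b::real_normed_vector) \<Rightarrow> bool" where
  "smooth_on S f = (\<forall>k. Ck_on k S f)"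

definition laplacian :: "(real^'n::finite \<Rightarrow> real) \<Rightarrow> real^'n \<Rightarrow> real" where
  "laplacian f x = (\<Sum>i\<in>UNIV. partial i (partial i f) x)"

definition smooth_diffeo :: "(real^'n::finite) set \<Rightarrow> (real^'n) set \<Rightarrow> (real^'n \<Rightarrow> real^'n) \<Rightarrow> bool" where
  "smooth_diffeo U V \<phi> = (open U \<and> open V \<and> \<phi> ` U = V \<and> smooth_on U \<phi> \<and>
     (\<exists>\<psi>. smooth_on V \<psi> \<and> (\<forall>y\<in>U. \<psi> (\<phi> y) = y) \<and> (\<forall>z\<in>V. \<phi> (\<psi> z) = z)))"

definition smooth_submanifold :: "(real^'n::finite) set \<Rightarrow> nat \<Rightarrow> bool" where
  "smooth_submanifold \<Gamma> k = (\<forall>\<sigma>\<in>\<Gamma>. \<exists>U V \<phi> L. \<sigma> \<in> U \<and> smooth_diffeo U V \<phi> \<and>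
      subspace L \<and> dim L = k \<and> \<phi> ` (\<Gamma> \<inter> U) = V \<inter> L)"

definition closed_smooth_submanifold :: "(real^'n::finite) set \<Rightarrow> nat \<Rightarrow> bool" where
  "closed_smooth_submanifold \<Gamma> k = (compact \<Gamma> \<and> smooth_submanifold \<Gamma> k)"

definition smooth_domain :: "(real^'n::finite) set \<Rightarrow> bool" where
  "smooth_domain \<Omega> = (open \<Omega> \<and> connected \<Omega> \<and> \<Omega> \<noteq> {} \<and>
     (\<forall>x\<in>frontier \<Omega>. \<exists>U V \<phi> i. x \<in> U \<and> smooth_diffeo U V \<phi> \<and>
        \<phi> ` (\<Omega> \<inter> U) = {z\<in>V. z $ i > 0}))"

definition test_fun :: "(real^'n::finite) set \<Rightarrow> (real^'n \<Rightarrow> real) \<Rightarrow> bool" where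
  "test_fun S \<phi> = (smooth_on UNIV \<phi> \<and> compact (closure {x. \<phi> x \<noteq> 0}) \<and> closure {x. \<phi> x \<noteq> 0} \<subseteq> S)"

definition Lp_loc :: "real \<Rightarrow> (real^'n::finite) set \<Rightarrow> (real^'n \<Rightarrow> real) \<Rightarrow> bool" where
  "Lp_loc p S u = (set_borel_measurable lebesgue S u \<and>
     (\<forall>K. compact K \<and> K \<subseteq> S \<longrightarrow> set_integrable lebesgue K (\<lambda>x. \<bar>u x\<bar> powr p)))"

end

theory Submission
  imports Defs "HOL-Computational_Algebra.Polynomial" "HOL-Real_Asymp.Real_Asymp"
begin

text \<open>Averaging with compactly supported radial kernels turns the distributional supersolution
  into functions \<open>U\<close> that are positive, increase as the radius of the kernel shrinks (they are
  superharmonic because \<open>q\<close> is nonnegative), and satisfy \<open>- \<Delta>U \<ge> V U + c U powr p\<close> pointwise up to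
  a small loss in the potential \<open>V\<close>. In particular \<open>U\<close> is bounded below, uniformly in the radius,
  on compact sets away from \<open>\<Gamma>\<close>.

  Near a point \<open>\<sigma>\<close> of \<open>\<Gamma>\<close> with \<open>q \<sigma> = 1\<close> let \<open>\<rho>\<close> be a substitute for the distance to \<open>\<Gamma>\<close>,
  \<open>t = - ln \<rho>\<close>, \<open>X = |x - \<sigma>|\<^sup>2\<close>, \<open>\<alpha> = (N - k - 2) / 2\<close> and \<open>U = exp (\<alpha> t) w\<close>. Since \<open>\<sigma>\<close> maximises
  \<open>q\<close> on \<open>\<Gamma>\<close>, we have \<open>q \<ge> 1 - C (X + \<rho>)\<close>, so the linear part of the inequality for \<open>w\<close> is
  \<open>- w'' \<ge> 0\<close> in \<open>t\<close>, up to errors of relative size \<open>X + \<rho>\<close>. Comparison with a subsolution that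
  behaves like \<open>exp (- \<kappa> t sqrt X)\<close> gives \<open>w \<ge> c1\<close> for \<open>4 \<kappa> t sqrt X \<le> 1\<close>, with \<open>c1\<close> independent
  of \<open>t\<close>. As \<open>p\<close> is at least critical, there \<open>U powr (p - 1) \<ge> c2 / \<rho>\<^sup>2\<close>: the nonlinearity raises
  the potential above the Hardy constant on \<open>t\<close>-intervals of any length, and comparison with a
  bump that is a squared sine in \<open>t\<close> yields a contradiction. Both comparisons look at a maximum
  point of the quotient of the subsolution and \<open>U\<close>.\<close>

section \<open>Functions of class C^k\<close>

text \<open>At the Hardy constant the linear problem has no slack: away from \<sigma> the potential
  may fall short by an amount of order X, which does not decay as t grows. A barrier can pay for
  this only by convexity in t. The second t-derivative of exp (- \<kappa> t sqrt X) is \<kappa>^2 X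
  times itself, so it beats an error of order X once \<kappa> is large, but it could not beat one of
  order sqrt X near X = 0. Hence the geometric estimates are pushed to second order in |x -
  \<sigma>|, although the data are curved at first order. The price is that the lower bound on w
  survives only in a tube of width of order 1 / t. This suffices: derivatives in X carry at least a
  factor exp (- t), negligible against powers of t, so the second bump fits into so thin a tube. The
  hypothesis on p enters as \<alpha> (p - 1) \<ge> 2: from U \<ge> c1 exp (\<alpha> t) it gives U
  powr (p - 1) \<ge> c2 exp (2 t). In the quotient of subsolution and U the terms of order zero
  cancel, whatever the sign of the potential, so second differences along the axes at one point
  decide both comparisons.\<close>

lemma partial_eqI:
  assumes "(f has_derivative D) (at x)"
  shows "partial i f x = D (axis i 1)"
  using frechet_derivative_at[OF assms] by (simp add: partial_def)

lemma partial_cong: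
  assumes "open S" "x \<in> S" "\<And>y. y \<in> S \<Longrightarrow> f y = g y"
  shows "partial i f x = partial i g x"
proof -
  have "(f has_derivative D) (at x) \<longleftrightarrow> (g has_derivative D) (at x)" for D
    using has_derivative_transform_within_open[OF _ assms(1,2), of f D UNIV g]
      has_derivative_transform_within_open[OF _ assms(1,2), of g D UNIV f] assms(3) by auto
  then show ?thesis by (simp add: partial_def frechet_derivative_def)
qed

text \<open>\<open>partial\<close> is a total function which rules such as the product rule identify
  only on S. The closure properties below prove regularity of the explicit formula and transfer it
  to \<open>partial\<close> by this lemma; openness of S makes derivatives local.\<close>

lemma Ck_on_cong:
  fixes f g :: "real^'n::finite \<Rightarrow> 'b::real_normed_vector"
  assumes "open S" "\<And>y. y \<in> S \<Longrightarrow> f y = g y" "Ck_on k S f"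
  shows "Ck_on k S g"
  using assms
proof (induction k arbitrary: f g)
  case 0
  then show ?case using continuous_on_cong[of S S f g] by auto
next
  case (Suc k)
  have d: "g differentiable at x" if "x \<in> S" for x
  proof -
    have "(f has_derivative frechet_derivative f (at x)) (at x)"
      using Suc.prems that by (simp add: frechet_derivative_works)
    from has_derivative_transform_within_open[OF this Suc.prems(1) that] Suc.prems(2)
    show ?thesis by (auto intro: differentiableI)
  qed
  have c: "continuous_on S g" using Suc.prems continuous_on_cong[of S S f g] by auto
  have "Ck_on k S (partial i g)" for i
    by (rule Suc.IH[of "partial i f"]) (use Suc.prems partial_cong[of S _ f g i] in auto)
  then show ?case using d c by auto
qed

lemma Ck_on_Suc_D: "Ck_on (Suc k) S f \<Longrightarrow> Ck_on k S f"
  by (induction k arbitrary: f) auto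

lemma Ck_on_mono: "Ck_on k S f \<Longrightarrow> j \<le> k \<Longrightarrow> Ck_on j S f"
proof (induction k)
  case (Suc k)
  then show ?case using Ck_on_Suc_D le_Suc_eq by blast
qed simp

lemma Ck_on_subset: "Ck_on k S f \<Longrightarrow> T \<subseteq> S \<Longrightarrow> Ck_on k T f"
  by (induction k arbitrary: f) (auto intro: continuous_on_subset)

lemma Ck_on_imp_continuous_on: "Ck_on k S f \<Longrightarrow> continuous_on S f"
  using Ck_on_mono[of k S f 0] by simp

lemma Ck_on_imp_differentiable: "Ck_on (Suc k) S f \<Longrightarrow> x \<in> S \<Longrightarrow> f differentiable at x"
  by simp

lemma Ck_on_partial: "Ck_on (Suc k) S f \<Longrightarrow> Ck_on k S (partial i f)"
  by simp

lemma Ck_on_const: "Ck_on k S (\<lambda>x::real^'n::finite. c)"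
proof (induction k arbitrary: c)
  case (Suc k)
  have "partial i (\<lambda>x::real^'n. c) = (\<lambda>x. 0)" for i by (simp add: partial_def fun_eq_iff)
  then show ?case using Suc[of 0] by (simp add: Suc)
qed simp

lemma Ck_on_bounded_linear:
  assumes "bounded_linear L"
  shows "Ck_on k S L"
proof (cases k)
  case 0
  then show ?thesis using assms by (simp add: linear_continuous_on)
next
  case (Suc j)
  have "partial i L = (\<lambda>x. L (axis i 1))" for i
    using partial_eqI[OF bounded_linear_imp_has_derivative[OF assms]] by auto
  then show ?thesis using Suc assms
    by (auto simp: Ck_on_const linear_continuous_on bounded_linear_imp_differentiable)
qed

lemma Ck_on_add:
  assumes "open S" "Ck_on k S f" "Ck_on k S g"
  shows "Ck_on k S (\<lambda>x. f x + g x)"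
  using assms(2,3)
proof (induction k arbitrary: f g)
  case (Suc k)
  have "Ck_on k S (partial i (\<lambda>x. f x + g x))" for i
  proof (rule Ck_on_cong[OF assms(1)])
    show "Ck_on k S (\<lambda>x. partial i f x + partial i g x)" using Suc by auto
  next
    fix x assume "x \<in> S"
    then have "(f has_derivative frechet_derivative f (at x)) (at x)"
      "(g has_derivative frechet_derivative g (at x)) (at x)"
      using Suc.prems by (auto simp: frechet_derivative_works)
    from partial_eqI[OF has_derivative_add[OF this], of i]
    show "partial i f x + partial i g x = partial i (\<lambda>x. f x + g x) x"
      by (simp add: partial_def)
  qed
  then show ?case using Suc.prems by (auto intro: continuous_on_add)
qed (auto intro: continuous_on_add)

lemma Ck_on_bilinear:
  fixes f :: "real^'n::finite \<Rightarrow> 'b::real_normed_vector" and g :: "real^'n \<Rightarrow> 'c::real_normed_vector"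
  assumes B: "bounded_bilinear B" and S: "open S" "Ck_on k S f" "Ck_on k S g"
  shows "Ck_on k S (\<lambda>x. B (f x) (g x))"
  using S(2,3)
proof (induction k arbitrary: f g)
  case 0
  then show ?case using bounded_bilinear.continuous_on[OF B] by auto
next
  case (Suc k)
  have D: "((\<lambda>x. B (f x) (g x)) has_derivative
      (\<lambda>h. B (f x) (frechet_derivative g (at x) h) + B (frechet_derivative f (at x) h) (g x))) (at x)"
    if "x \<in> S" for x
    using Suc.prems that by (intro bounded_bilinear.FDERIV[OF B]) (auto simp: frechet_derivative_works)
  have "Ck_on k S (partial i (\<lambda>x. B (f x) (g x)))" for i
  proof (rule Ck_on_cong[OF S(1)])
    show "Ck_on k S (\<lambda>x. B (f x) (partial i g x) + B (partial i f x) (g x))"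
    proof (intro Ck_on_add S Suc.IH)
      show "Ck_on k S f" "Ck_on k S g" using Suc.prems by (auto intro: Ck_on_Suc_D)
    qed (use Suc.prems in auto)
  qed (use partial_eqI[OF D] in \<open>simp add: partial_def\<close>)
  moreover have "continuous_on S (\<lambda>x. B (f x) (g x))"
    using bounded_bilinear.continuous_on[OF B] Suc.prems by auto
  ultimately show ?case using D by (auto intro: differentiableI)
qed

lemmas Ck_on_scaleR = Ck_on_bilinear[OF bounded_bilinear_scaleR]
lemmas Ck_on_inner = Ck_on_bilinear[OF bounded_bilinear_inner]
lemmas Ck_on_mult = Ck_on_bilinear[OF bounded_bilinear_mult]

lemma Ck_on_sum:
  assumes "open S" "finite A" "\<And>a. a \<in> A \<Longrightarrow> Ck_on k S (f a)"
  shows "Ck_on k S (\<lambda>x. \<Sum>a\<in>A. f a x)"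
  using assms(2,3) by (induction A) (auto intro: Ck_on_add assms(1) simp: Ck_on_const)

lemma Ck_on_diff:
  assumes "open S" "Ck_on k S f" "Ck_on k S g"
  shows "Ck_on k S (\<lambda>x. f x - g x)"
  using Ck_on_add[OF assms(1,2) Ck_on_scaleR[OF assms(1) Ck_on_const[of k S "-1::real"] assms(3)]]
  by simp

lemma frechet_derivative_eq_sum_partial:
  fixes f :: "real^'n::finite \<Rightarrow> 'b::real_normed_vector"
  assumes "f differentiable at x"
  shows "frechet_derivative f (at x) h = (\<Sum>j\<in>UNIV. (h $ j) *\<^sub>R partial j f x)"
proof -
  have l: "linear (frechet_derivative f (at x))" by (rule linear_frechet_derivative[OF assms])
  have "h = (\<Sum>j\<in>UNIV. (h $ j) *\<^sub>R axis j 1)"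
    by (simp add: vec_eq_iff axis_def if_distrib[of "(*) _"] cong: if_cong)
  then have "frechet_derivative f (at x) h = frechet_derivative f (at x) (\<Sum>j\<in>UNIV. (h $ j) *\<^sub>R axis j 1)"
    by simp
  then show ?thesis by (simp add: linear_sum[OF l] linear_scale[OF l] partial_def)
qed

lemma Ck_on_compose:
  fixes f :: "real^'n::finite \<Rightarrow> real^'m::finite" and g :: "real^'m \<Rightarrow> 'b::real_normed_vector"
  assumes "open S" "open T" "f ` S \<subseteq> T" "Ck_on k S f" "Ck_on k T g"
  shows "Ck_on k S (\<lambda>x. g (f x))"
  using assms(4,5)
proof (induction k arbitrary: g)
  case 0
  then show ?case using assms(3) by (auto intro: continuous_on_compose2)
next
  case (Suc k)
  have D: "((\<lambda>x. g (f x)) has_derivative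
      (\<lambda>h. frechet_derivative g (at (f x)) (frechet_derivative f (at x) h))) (at x)" if "x \<in> S" for x
  proof -
    have "(f has_derivative frechet_derivative f (at x)) (at x)"
      "(g has_derivative frechet_derivative g (at (f x))) (at (f x))"
      using Suc.prems that assms(3) by (auto simp: frechet_derivative_works)
    then show ?thesis using has_derivative_compose by blast
  qed
  have f: "Ck_on k S f" by (rule Ck_on_Suc_D[OF Suc.prems(1)])
  have "Ck_on k S (partial i (\<lambda>x. g (f x)))" for i
  proof (rule Ck_on_cong[OF assms(1)])
    show "Ck_on k S (\<lambda>x. \<Sum>j\<in>UNIV. (partial i f x $ j) *\<^sub>R partial j g (f x))"
    proof (intro Ck_on_sum Ck_on_scaleR assms(1))
      fix j
      have "Ck_on k S (\<lambda>x. partial i f x \<bullet> axis j 1)"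
        by (intro Ck_on_inner assms(1) Ck_on_const Ck_on_partial Suc.prems(1))
      then show "Ck_on k S (\<lambda>x. partial i f x $ j)" by (simp add: inner_axis)
      show "Ck_on k S (\<lambda>x. partial j g (f x))" by (intro Suc.IH[OF f] Ck_on_partial Suc.prems(2))
    qed simp
  next
    fix x assume "x \<in> S"
    then have "g differentiable at (f x)" using Suc.prems assms(3) by auto
    from frechet_derivative_eq_sum_partial[OF this, of "partial i f x"]
    show "(\<Sum>j\<in>UNIV. (partial i f x $ j) *\<^sub>R partial j g (f x)) = partial i (\<lambda>x. g (f x)) x"
      using partial_eqI[OF D[OF \<open>x \<in> S\<close>], of i] unfolding partial_def[of i f] by simp
  qed
  moreover have "continuous_on S (\<lambda>x. g (f x))"
    using Suc.prems assms(3) by (auto intro: continuous_on_compose2)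
  ultimately show ?case using D by (auto intro: differentiableI)
qed

text \<open>\<open>Ck_on\<close> speaks of functions on real^n, so the outer function of one real
  variable comes as a chain in which \<open>b (Suc n)\<close> is the derivative of
  \<open>b n\<close>; the induction on k moves along the chain. It serves \<open>bump\<close>, whose
  iterated derivatives form such a chain.\<close>

lemma Ck_on_compose_real:
  fixes f :: "real^'n::finite \<Rightarrow> real" and b :: "nat \<Rightarrow> real \<Rightarrow> real"
  assumes "open S" "Ck_on k S f" "\<And>n t. (b n has_real_derivative b (Suc n) t) (at t)"
  shows "Ck_on k S (\<lambda>x. b n (f x))"
  using assms(2)
proof (induction k arbitrary: n)
  case 0
  have "continuous_on UNIV (b n)"
    by (intro continuous_at_imp_continuous_on ballI DERIV_isCont[OF assms(3)])
  with 0 show ?case by (auto intro: continuous_on_compose2)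
next
  case (Suc k)
  have D: "((\<lambda>x. b n (f x)) has_derivative
      (\<lambda>h. b (Suc n) (f x) * frechet_derivative f (at x) h)) (at x)" if "x \<in> S" for x
  proof -
    have "(f has_derivative frechet_derivative f (at x)) (at x)"
      using Suc.prems that by (auto simp: frechet_derivative_works)
    then show ?thesis
      using has_derivative_compose[of f _ x UNIV "b n"] assms(3)[of n "f x"]
      by (auto simp: has_field_derivative_def)
  qed
  have "Ck_on k S (partial i (\<lambda>x. b n (f x)))" for i
  proof (rule Ck_on_cong[OF assms(1)])
    show "Ck_on k S (\<lambda>x. b (Suc n) (f x) * partial i f x)"
    proof (intro Ck_on_mult assms(1) Suc.IH)
      show "Ck_on k S f" using Suc.prems by (rule Ck_on_Suc_D)
    qed (use Suc.prems in auto)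
  qed (use partial_eqI[OF D] in \<open>simp add: partial_def\<close>)
  moreover have "continuous_on S (\<lambda>x. b n (f x))"
    by (rule Ck_on_imp_continuous_on[OF Suc.IH[OF Ck_on_Suc_D[OF Suc.prems]]])
  ultimately show ?case using D by (auto intro: differentiableI)
qed

lemma Ck_on_lipschitz:
  fixes f :: "real^'n::finite \<Rightarrow> 'b::real_normed_vector"
  assumes "Ck_on 1 S f" "cball a r \<subseteq> S"
  obtains C where "C \<ge> 0" "\<And>x y. x \<in> cball a r \<Longrightarrow> y \<in> cball a r \<Longrightarrow> norm (f x - f y) \<le> C * norm (x - y)"
proof -
  have "\<exists>B. \<forall>x\<in>cball a r. norm (partial i f x) \<le> B" for i
  proof -
    have "Ck_on 0 S (partial i f)" using assms(1) unfolding One_nat_def by (rule Ck_on_partial)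
    then have "continuous_on (cball a r) (partial i f)"
      using continuous_on_subset[OF _ assms(2)] by simp
    then have "bounded (partial i f ` cball a r)"
      by (intro compact_imp_bounded compact_continuous_image compact_cball)
    then show ?thesis by (auto simp: bounded_iff)
  qed
  then obtain B where B: "\<And>i x. x \<in> cball a r \<Longrightarrow> norm (partial i f x) \<le> B i" by metis
  define C where "C = (\<Sum>i\<in>UNIV. \<bar>B i\<bar>)"
  have d: "f differentiable at x" if "x \<in> cball a r" for x
    using assms that by (auto simp: One_nat_def)
  have "norm (f x - f y) \<le> C * norm (x - y)" if "x \<in> cball a r" "y \<in> cball a r" for x y
  proof (rule differentiable_bound[OF convex_cball])
    fix z assume z: "z \<in> cball a r"
    show "(f has_derivative frechet_derivative f (at z)) (at z within cball a r)"
      using d[OF z] frechet_derivative_works has_derivative_at_withinI by blast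
    show "onorm (frechet_derivative f (at z)) \<le> C"
    proof (rule onorm_le)
      fix h :: "real^'n"
      have "norm (frechet_derivative f (at z) h) \<le> (\<Sum>j\<in>UNIV. norm ((h $ j) *\<^sub>R partial j f z))"
        unfolding frechet_derivative_eq_sum_partial[OF d[OF z]] by (rule norm_sum)
      also have "\<dots> \<le> (\<Sum>j\<in>UNIV. norm h * \<bar>B j\<bar>)"
      proof (rule sum_mono)
        fix j
        have "norm (partial j f z) \<le> \<bar>B j\<bar>" using B[OF z, of j] by linarith
        then show "norm ((h $ j) *\<^sub>R partial j f z) \<le> norm h * \<bar>B j\<bar>"
          using component_le_norm_cart[of h j] by (simp add: mult_mono)
      qed
      finally show "norm (frechet_derivative f (at z) h) \<le> C * norm h"
        by (simp add: C_def sum_distrib_left mult.commute)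
    qed
  qed (use that in auto)
  moreover have "C \<ge> 0" by (simp add: C_def sum_nonneg)
  ultimately show ?thesis using that by blast
qed

lemma Ck_on_has_derivative_line:
  fixes f :: "real^'n::finite \<Rightarrow> 'b::real_normed_vector"
  assumes "f differentiable at (x + s *\<^sub>R axis i 1)"
  shows "((\<lambda>s. f (x + s *\<^sub>R axis i 1)) has_vector_derivative partial i f (x + s *\<^sub>R axis i 1)) (at s)"
proof -
  let ?e = "axis i (1::real) :: real^'n"
  have l: "linear (frechet_derivative f (at (x + s *\<^sub>R ?e)))"
    by (rule linear_frechet_derivative[OF assms])
  have "((\<lambda>s. x + s *\<^sub>R ?e) has_derivative (\<lambda>h. h *\<^sub>R ?e)) (at s)"
    by (auto intro!: derivative_eq_intros)
  from has_derivative_compose[OF this assms[unfolded frechet_derivative_works]]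
  have "((\<lambda>s. f (x + s *\<^sub>R ?e)) has_derivative (\<lambda>h. frechet_derivative f (at (x + s *\<^sub>R ?e)) (h *\<^sub>R ?e))) (at s)"
    by simp
  then show ?thesis
    by (simp add: has_vector_derivative_def partial_def linear_scale[OF l])
qed

text \<open>The partial derivatives are Lipschitz on the ball, hence so is the differential in
  operator norm; linearisation along segments turns this into the quadratic remainder. One constant
  serves all base points, because later the expansion is taken at variable points and not only at
  the centre.\<close>

lemma Ck_on_taylor2:
  fixes f :: "real^'n::finite \<Rightarrow> 'b::real_normed_vector"
  assumes "Ck_on 2 S f" "cball a r \<subseteq> S"
  obtains C where "C \<ge> 0"
    "\<And>x y. x \<in> cball a r \<Longrightarrow> y \<in> cball a r \<Longrightarrow>
      norm (f y - f x - frechet_derivative f (at x) (y - x)) \<le> C * norm (y - x)^2"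
    "\<And>x y h. x \<in> cball a r \<Longrightarrow> y \<in> cball a r \<Longrightarrow>
      norm (frechet_derivative f (at y) h - frechet_derivative f (at x) h) \<le> C * norm (y - x) * norm h"
proof -
  have C1: "Ck_on 1 S (partial i f)" for i using assms(1) by (simp add: numeral_2_eq_2)
  have "\<forall>i. \<exists>C. C \<ge> 0 \<and> (\<forall>x\<in>cball a r. \<forall>y\<in>cball a r. norm (partial i f x - partial i f y) \<le> C * norm (x - y))"
    using Ck_on_lipschitz[OF C1 assms(2)] by metis
  then obtain B where B: "\<And>i. B i \<ge> 0"
    "\<And>i x y. x \<in> cball a r \<Longrightarrow> y \<in> cball a r \<Longrightarrow> norm (partial i f x - partial i f y) \<le> B i * norm (x - y)"
    by metis
  define C where "C = (\<Sum>i\<in>UNIV. B i)"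
  have C0: "C \<ge> 0" using B by (simp add: C_def sum_nonneg)
  have d: "f differentiable at x" if "x \<in> cball a r" for x
    using assms that by (auto simp: numeral_2_eq_2)
  have lip: "norm (frechet_derivative f (at y) h - frechet_derivative f (at x) h) \<le> C * norm (y - x) * norm h"
    if "x \<in> cball a r" "y \<in> cball a r" for x y h
  proof -
    have "norm (frechet_derivative f (at y) h - frechet_derivative f (at x) h)
       = norm (\<Sum>j\<in>UNIV. (h $ j) *\<^sub>R (partial j f y - partial j f x))"
      using that by (simp add: frechet_derivative_eq_sum_partial d sum_subtractf scaleR_diff_right)
    also have "\<dots> \<le> (\<Sum>j\<in>UNIV. norm ((h $ j) *\<^sub>R (partial j f y - partial j f x)))" by (rule norm_sum)
    also have "\<dots> \<le> (\<Sum>j\<in>UNIV. norm h * (B j * norm (y - x)))"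
    proof (rule sum_mono)
      fix j
      show "norm ((h $ j) *\<^sub>R (partial j f y - partial j f x)) \<le> norm h * (B j * norm (y - x))"
        using component_le_norm_cart[of h j] B(2)[OF that(2,1), of j] by (simp add: mult_mono)
    qed
    finally show ?thesis by (simp add: C_def sum_distrib_left sum_distrib_right mult_ac)
  qed
  have tay: "norm (f y - f x - frechet_derivative f (at x) (y - x)) \<le> C * norm (y - x)^2"
    if "x \<in> cball a r" "y \<in> cball a r" for x y
  proof -
    have seg: "closed_segment x y \<subseteq> cball a r" using that by (simp add: closed_segment_subset)
    have "norm (f y - f x - frechet_derivative f (at x) (y - x)) \<le> norm (y - x) * (C * norm (y - x))"
    proof (rule differentiable_bound_linearization[of x y "closed_segment x y" f "\<lambda>z. frechet_derivative f (at z)"])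
      show "x + t *\<^sub>R (y - x) \<in> closed_segment x y" if "t \<in> {0..1}" for t :: real
        using that unfolding closed_segment_def by (auto simp: algebra_simps intro!: exI[of _ t])
      show "(f has_derivative frechet_derivative f (at z)) (at z within closed_segment x y)"
        if "z \<in> closed_segment x y" for z
        using d seg that frechet_derivative_works has_derivative_at_withinI by blast
      show "onorm (frechet_derivative f (at z) - frechet_derivative f (at x)) \<le> C * norm (y - x)"
        if "z \<in> closed_segment x y" for z
        unfolding fun_diff_def
      proof (rule onorm_le)
        fix h
        have "norm (z - x) \<le> norm (y - x)" using segment_bound1[OF that] by simp
        then show "norm (frechet_derivative f (at z) h - frechet_derivative f (at x) h) \<le> C * norm (y - x) * norm h"
          using lip[of x z h] seg that \<open>x \<in> cball a r\<close> C0
          by (smt (verit) mult_left_mono mult_right_mono norm_ge_zero subsetD)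
      qed
    qed auto
    then show ?thesis by (simp add: power2_eq_square mult_ac)
  qed
  show ?thesis using that C0 lip tay by blast
qed

section \<open>Complements of submanifolds\<close>

text \<open>The spans of L with x and of L with y have dimension below that of the space, so the
  ball contains a point c outside both. A segment from x or y to c that met L would put c into the
  corresponding span; hence x and y are joined through c.\<close>

lemma connected_ball_diff_subspace:
  fixes L :: "'a::euclidean_space set"
  assumes L: "subspace L" "dim L + 2 \<le> DIM('a)"
  shows "connected (ball z r - L)"
  unfolding connected_iff_connected_component
proof (intro ballI)
  fix x y assume x: "x \<in> ball z r - L" and y: "y \<in> ball z r - L"
  have low: "interior (span (insert a L)) = {}" for a
  proof -
    have "dim (insert a L) \<le> dim L + 1" by (simp add: dim_insert)
    then show ?thesis using L(2) by (intro empty_interior_lowdim) simp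
  qed
  have "interior (span (insert x L) \<union> span (insert y L)) = {}"
    by (simp add: interior_closed_Un_empty_interior low)
  moreover have "open (ball z r)" "ball z r \<noteq> {}" using x by blast+
  ultimately have "\<not> ball z r \<subseteq> span (insert x L) \<union> span (insert y L)"
    by (metis interior_maximal subset_empty)
  then obtain c where c: "c \<in> ball z r" "c \<notin> span (insert x L)" "c \<notin> span (insert y L)" by blast
  have seg: "closed_segment a c \<subseteq> ball z r - L" if "a \<in> ball z r - L" "c \<notin> span (insert a L)" for a
  proof
    fix w assume w: "w \<in> closed_segment a c"
    then obtain t where t: "0 \<le> t" "t \<le> 1" "w = (1 - t) *\<^sub>R a + t *\<^sub>R c" by (auto simp: in_segment)
    have "w \<in> ball z r" using w that(1) c(1) closed_segment_subset[of a "ball z r" c] by auto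
    moreover have "w \<notin> L"
    proof
      assume "w \<in> L"
      then have "w \<in> span (insert a L)" "a \<in> span (insert a L)" by (auto intro: span_base)
      moreover have "t \<noteq> 0" using that(1) t(3) \<open>w \<in> L\<close> by auto
      then have "c = (1 / t) *\<^sub>R (w - (1 - t) *\<^sub>R a)" using t by simp
      ultimately show False using that(2) by (metis span_diff span_scale)
    qed
    ultimately show "w \<in> ball z r - L" by simp
  qed
  have "connected (closed_segment x c \<union> closed_segment y c)"
    by (intro connected_Un) auto
  moreover have "closed_segment x c \<union> closed_segment y c \<subseteq> ball z r - L" using seg x y c by auto
  ultimately show "connected_component (ball z r - L) x y"
    by (meson UnCI connected_component_of_subset connected_component_def ends_in_segment(1))
qed

text \<open>A separation A, B of S - \<Gamma> extends to one of S. The set \<open>E A\<close>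
  consists of points with an open neighbourhood whose part outside \<Gamma> lies in A: local
  connectedness assigns every point of \<Gamma> to one side, and the empty interior of \<Gamma>
  keeps the two sides disjoint.\<close>

lemma connected_Diff_locally:
  fixes S \<Gamma> :: "'a::topological_space set"
  assumes S: "open S" "connected S" and \<Gamma>: "closed \<Gamma>" "interior \<Gamma> = {}"
    and loc: "\<And>\<sigma>. \<sigma> \<in> S \<inter> \<Gamma> \<Longrightarrow> \<exists>N. open N \<and> \<sigma> \<in> N \<and> N \<subseteq> S \<and> connected (N - \<Gamma>)"
  shows "connected (S - \<Gamma>)"
proof (rule connectedI)
  fix A B assume A: "open A" "open B" "A \<inter> (S - \<Gamma>) \<noteq> {}" "B \<inter> (S - \<Gamma>) \<noteq> {}"
    "A \<inter> B \<inter> (S - \<Gamma>) = {}" "S - \<Gamma> \<subseteq> A \<union> B"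
  define E where "E A = \<Union>{N. open N \<and> N \<subseteq> S \<and> N - \<Gamma> \<subseteq> A}" for A
  have o: "open (E A)" for A unfolding E_def by auto
  have inE: "x \<in> E A" if "open A" "x \<in> A \<inter> (S - \<Gamma>)" for A x
  proof -
    have "open (A \<inter> (S - \<Gamma>))" using that S \<Gamma> by (intro open_Int open_Diff)
    then show ?thesis using that unfolding E_def by auto
  qed
  have "E A \<inter> E B \<inter> S = {}"
  proof (rule ccontr)
    assume "E A \<inter> E B \<inter> S \<noteq> {}"
    then obtain x M N where MN: "x \<in> M \<inter> N" "open M" "open N" "M \<subseteq> S" "M - \<Gamma> \<subseteq> A" "N - \<Gamma> \<subseteq> B"
      unfolding E_def by auto
    then have "\<not> M \<inter> N \<subseteq> \<Gamma>" using \<Gamma>(2) interior_maximal[of "M \<inter> N" \<Gamma>] by blast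
    then show False using MN A(5) by blast
  qed
  moreover have "S \<subseteq> E A \<union> E B"
  proof
    fix x assume x: "x \<in> S"
    show "x \<in> E A \<union> E B"
    proof (cases "x \<in> \<Gamma>")
      case True
      then obtain N where N: "open N" "x \<in> N" "N \<subseteq> S" "connected (N - \<Gamma>)" using loc x by blast
      then have "N - \<Gamma> \<subseteq> A \<union> B" "A \<inter> B \<inter> (N - \<Gamma>) = {}" using A(5,6) by auto
      then have "A \<inter> (N - \<Gamma>) = {} \<or> B \<inter> (N - \<Gamma>) = {}" using N(4) A(1,2) connectedD by blast
      then have "N - \<Gamma> \<subseteq> B \<or> N - \<Gamma> \<subseteq> A" using \<open>N - \<Gamma> \<subseteq> A \<union> B\<close> by blast
      then show ?thesis using N unfolding E_def by blast
    next
      case False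
      then show ?thesis using x A inE[of A x] inE[of B x] by auto
    qed
  qed
  moreover have "E A \<inter> S \<noteq> {}" "E B \<inter> S \<noteq> {}" using A inE by blast+
  ultimately show False using connectedD[OF S(2) o o] by blast
qed

lemma smooth_diffeoE:
  assumes "smooth_diffeo U V \<phi>"
  obtains \<psi> where "open U" "open V" "smooth_on U \<phi>" "smooth_on V \<psi>" "\<phi> ` U = V" "\<psi> ` V = U"
    "\<And>y. y \<in> U \<Longrightarrow> \<psi> (\<phi> y) = y" "\<And>z. z \<in> V \<Longrightarrow> \<phi> (\<psi> z) = z"
proof -
  from assms obtain \<psi> where \<psi>: "smooth_on V \<psi>" "\<forall>y\<in>U. \<psi> (\<phi> y) = y" "\<forall>z\<in>V. \<phi> (\<psi> z) = z"
    and *: "open U" "open V" "\<phi> ` U = V" "smooth_on U \<phi>" unfolding smooth_diffeo_def by blast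
  have "\<psi> ` V = U" using *(3) \<psi>(2) by (force simp: image_iff)
  then show ?thesis using that[of \<psi>] \<psi> * by blast
qed

lemma smooth_on_imp_continuous_on: "smooth_on S f \<Longrightarrow> continuous_on S f"
  unfolding smooth_on_def by (metis Ck_on.simps(1))

text \<open>In a chart the manifold is a subspace of codimension at least two, and a small ball
  without it is connected. Connectedness of the punctured domain is what later spreads positivity of
  the averages from one place to all.\<close>

lemma connected_Diff_submanifold:
  fixes S \<Gamma> :: "(real^'n::finite) set"
  assumes S: "open S" "connected S" and \<Gamma>: "closed \<Gamma>" "smooth_submanifold \<Gamma> k" and k: "k + 2 \<le> CARD('n)"
  shows "connected (S - \<Gamma>)"
proof (rule connected_Diff_locally[OF S \<Gamma>(1)])
  have D: "DIM(real^'n) = CARD('n)" by simp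
  show "interior \<Gamma> = {}"
  proof (rule ccontr)
    assume "interior \<Gamma> \<noteq> {}"
    then obtain \<sigma> where \<sigma>: "\<sigma> \<in> interior \<Gamma>" by auto
    then obtain U V \<phi> L where c: "\<sigma> \<in> U" "smooth_diffeo U V \<phi>" "subspace L" "dim L = k" "\<phi> ` (\<Gamma> \<inter> U) = V \<inter> L"
      using \<Gamma>(2) interior_subset unfolding smooth_submanifold_def by blast
    obtain \<psi> where d: "open U" "open V" "smooth_on U \<phi>" "smooth_on V \<psi>" "\<phi> ` U = V" "\<psi> ` V = U"
      "\<And>y. y \<in> U \<Longrightarrow> \<psi> (\<phi> y) = y" "\<And>z. z \<in> V \<Longrightarrow> \<phi> (\<psi> z) = z"
      using smooth_diffeoE[OF c(2)] by metis
    have "open (V \<inter> \<psi> -` interior \<Gamma>)"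
      using continuous_open_preimage[OF smooth_on_imp_continuous_on[OF d(4)] d(2)] by simp
    moreover have "V \<inter> \<psi> -` interior \<Gamma> \<subseteq> L"
    proof
      fix z assume z: "z \<in> V \<inter> \<psi> -` interior \<Gamma>"
      then have "\<psi> z \<in> \<Gamma> \<inter> U" using interior_subset d(6) by auto
      then have "\<phi> (\<psi> z) \<in> V \<inter> L" using c(5) by blast
      then show "z \<in> L" using z d(8) by auto
    qed
    ultimately have "V \<inter> \<psi> -` interior \<Gamma> \<subseteq> interior L" by (rule interior_maximal[rotated])
    moreover have "interior L = {}" using c(4) k D by (intro empty_interior_lowdim) simp
    moreover have "\<phi> \<sigma> \<in> V \<inter> \<psi> -` interior \<Gamma>" using \<sigma> c(1) d by auto
    ultimately show False by auto
  qed
  fix \<sigma> assume \<sigma>: "\<sigma> \<in> S \<inter> \<Gamma>"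
  then obtain U V \<phi> L where c: "\<sigma> \<in> U" "smooth_diffeo U V \<phi>" "subspace L" "dim L = k" "\<phi> ` (\<Gamma> \<inter> U) = V \<inter> L"
    using \<Gamma>(2) unfolding smooth_submanifold_def by blast
  obtain \<psi> where d: "open U" "open V" "smooth_on U \<phi>" "smooth_on V \<psi>" "\<phi> ` U = V" "\<psi> ` V = U"
    "\<And>y. y \<in> U \<Longrightarrow> \<psi> (\<phi> y) = y" "\<And>z. z \<in> V \<Longrightarrow> \<phi> (\<psi> z) = z"
    using smooth_diffeoE[OF c(2)] by metis
  have "open (V \<inter> \<psi> -` S)"
    using continuous_open_preimage[OF smooth_on_imp_continuous_on[OF d(4)] d(2) S(1)] .
  moreover have "\<phi> \<sigma> \<in> V \<inter> \<psi> -` S" using \<sigma> c(1) d by auto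
  ultimately obtain r where r: "r > 0" "ball (\<phi> \<sigma>) r \<subseteq> V \<inter> \<psi> -` S" using open_contains_ball by blast
  define N where "N = U \<inter> \<phi> -` ball (\<phi> \<sigma>) r"
  have "open N" unfolding N_def
    using continuous_open_preimage[OF smooth_on_imp_continuous_on[OF d(3)] d(1)] by simp
  moreover have "\<sigma> \<in> N" using c(1) r by (simp add: N_def)
  moreover have "N \<subseteq> S"
  proof
    fix x assume "x \<in> N"
    then show "x \<in> S" using r(2) d(7)[of x] unfolding N_def by auto
  qed
  moreover have "N - \<Gamma> = \<psi> ` (ball (\<phi> \<sigma>) r - L)"
  proof (intro equalityI subsetI)
    fix x assume x: "x \<in> N - \<Gamma>"
    then have "x = \<psi> (\<phi> x)" "x \<in> U" "\<phi> x \<in> ball (\<phi> \<sigma>) r" using d(7) by (auto simp: N_def)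
    moreover have "\<phi> x \<notin> L"
    proof
      assume "\<phi> x \<in> L"
      then have "\<phi> x \<in> \<phi> ` (\<Gamma> \<inter> U)" using c(5) d(5) \<open>x \<in> U\<close> by auto
      then obtain g where "g \<in> \<Gamma> \<inter> U" "\<phi> x = \<phi> g" by auto
      then have "x = g" using d(7) \<open>x \<in> U\<close> by (metis IntD2)
      then show False using x \<open>g \<in> \<Gamma> \<inter> U\<close> by auto
    qed
    ultimately show "x \<in> \<psi> ` (ball (\<phi> \<sigma>) r - L)" by blast
  next
    fix x assume "x \<in> \<psi> ` (ball (\<phi> \<sigma>) r - L)"
    then obtain z where z: "x = \<psi> z" "z \<in> ball (\<phi> \<sigma>) r" "z \<notin> L" by auto
    then have zV: "z \<in> V" "\<phi> x = z" "x \<in> U" using r d by auto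
    have "x \<notin> \<Gamma>"
    proof
      assume "x \<in> \<Gamma>"
      then have "\<phi> x \<in> V \<inter> L" using zV(3) c(5) by blast
      then show False using zV z by simp
    qed
    then show "x \<in> N - \<Gamma>" using zV z by (simp add: N_def)
  qed
  moreover have "connected (\<psi> ` (ball (\<phi> \<sigma>) r - L))"
  proof (rule connected_continuous_image)
    show "continuous_on (ball (\<phi> \<sigma>) r - L) \<psi>"
      using r by (intro continuous_on_subset[OF smooth_on_imp_continuous_on[OF d(4)]]) auto
    show "connected (ball (\<phi> \<sigma>) r - L)"
      by (rule connected_ball_diff_subspace) (use c k D in auto)
  qed
  ultimately show "\<exists>N. open N \<and> \<sigma> \<in> N \<and> N \<subseteq> S \<and> connected (N - \<Gamma>)" by auto
qed

section \<open>A substitute for the squared distance\<close>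

text \<open>Built from an orthonormal basis of T. The trace is recorded because through it the
  codimension enters the Laplacian of the distance substitute.\<close>

lemma orthogonal_projection_exists:
  fixes T :: "(real^'n::finite) set"
  assumes "subspace T" "dim T = k"
  obtains P where "linear P" "\<And>x. P x \<in> T" "\<And>x. x \<in> T \<Longrightarrow> P x = x" "\<And>x y. P x \<bullet> y = x \<bullet> P y"
    "(\<Sum>i\<in>UNIV. axis i 1 \<bullet> P (axis i 1)) = real k"
proof -
  obtain B where B: "B \<subseteq> T" "pairwise orthogonal B" "\<And>x. x \<in> B \<Longrightarrow> norm x = 1" "independent B"
    "card B = dim T" "span B = T"
    using orthonormal_basis_subspace[OF assms(1)] by metis
  have fin: "finite B" using B(4) by (rule independent_imp_finite)
  define P where "P x = (\<Sum>b\<in>B. (x \<bullet> b) *\<^sub>R b)" for x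
  have lin: "linear P"
    unfolding P_def by (intro linearI) (simp_all add: inner_add_left scaleR_add_left sum.distrib scaleR_sum_right)
  have mem: "P x \<in> T" for x
    unfolding P_def using B(1) by (intro subspace_sum assms(1) subspace_scale) auto
  have fix_T: "P x = x" if "x \<in> T" for x
  proof -
    have "orthogonal (x - P x) b" if "b \<in> B" for b
    proof -
      have "(\<Sum>c\<in>B. (x \<bullet> c) * (c \<bullet> b)) = (\<Sum>c\<in>B. if c = b then x \<bullet> b else 0)"
        using B(2,3) that by (intro sum.cong) (auto simp: pairwise_def orthogonal_def norm_eq_1)
      then show ?thesis using that fin by (simp add: orthogonal_def P_def inner_diff_left inner_sum_left)
    qed
    moreover have "x - P x \<in> span B" using that mem B(6) assms(1) by (simp add: subspace_diff)
    ultimately have "orthogonal (x - P x) (x - P x)"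
      using orthogonal_to_span[of "x - P x" B "x - P x"] by blast
    then show ?thesis by (simp add: orthogonal_self)
  qed
  have sym: "P x \<bullet> y = x \<bullet> P y" for x y
    by (simp add: P_def inner_sum_left inner_sum_right inner_commute mult.commute)
  have "(\<Sum>i\<in>UNIV. axis i 1 \<bullet> P (axis i 1)) = (\<Sum>i\<in>UNIV. \<Sum>b\<in>B. (b $ i)\<^sup>2)"
    by (simp add: P_def inner_sum_right inner_axis' power2_eq_square)
  also have "\<dots> = (\<Sum>b\<in>B. \<Sum>i\<in>UNIV. (b $ i)\<^sup>2)" by (rule sum.swap)
  also have "\<dots> = (\<Sum>b\<in>B. (norm b)\<^sup>2)"
    by (simp add: norm_vec_def L2_set_def sum_nonneg)
  also have "\<dots> = real k" using B(3,5) assms(2) by simp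
  finally show ?thesis using that lin mem fix_T sym by blast
qed

lemma has_derivative_frechet: "f differentiable at x \<Longrightarrow> (f has_derivative frechet_derivative f (at x)) (at x)"
  by (simp add: frechet_derivative_works)

lemma smooth_on_differentiable: "smooth_on S f \<Longrightarrow> x \<in> S \<Longrightarrow> f differentiable at x"
  unfolding smooth_on_def by (metis Ck_on.simps(2))

text \<open>Conjugating the orthogonal projection onto the tangent space by the chart gives a
  retraction onto the manifold whose differential at the base point is orthogonal.\<close>

lemma local_retraction:
  fixes \<Gamma> :: "(real^'n::finite) set"
  assumes "smooth_submanifold \<Gamma> k" "\<sigma> \<in> \<Gamma>"
  obtains S \<pi> P where "open S" "\<sigma> \<in> S" "Ck_on 2 S \<pi>" "\<And>x. x \<in> S \<Longrightarrow> \<pi> x \<in> \<Gamma>"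
    "\<And>x. x \<in> S \<Longrightarrow> x \<in> \<Gamma> \<Longrightarrow> \<pi> x = x" "frechet_derivative \<pi> (at \<sigma>) = P" "linear P"
    "\<And>x. P (P x) = P x" "\<And>x y. P x \<bullet> y = x \<bullet> P y" "(\<Sum>i\<in>UNIV. axis i 1 \<bullet> P (axis i 1)) = real k"
    "k < CARD('n) \<Longrightarrow> \<exists>e. norm e = 1 \<and> P e = 0"
proof -
  obtain U V \<phi> L where c: "\<sigma> \<in> U" "smooth_diffeo U V \<phi>" "subspace L" "dim L = k" "\<phi> ` (\<Gamma> \<inter> U) = V \<inter> L"
    using assms unfolding smooth_submanifold_def by blast
  obtain \<psi> where d: "open U" "open V" "smooth_on U \<phi>" "smooth_on V \<psi>" "\<phi> ` U = V" "\<psi> ` V = U"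
    "\<And>y. y \<in> U \<Longrightarrow> \<psi> (\<phi> y) = y" "\<And>z. z \<in> V \<Longrightarrow> \<phi> (\<psi> z) = z"
    using smooth_diffeoE[OF c(2)] by metis
  define z where "z = \<phi> \<sigma>"
  have z: "z \<in> V" "\<psi> z = \<sigma>" "z \<in> L" using c assms(2) d unfolding z_def by blast+
  define A where "A = frechet_derivative \<phi> (at \<sigma>)"
  define A' where "A' = frechet_derivative \<psi> (at z)"
  have dA: "(\<phi> has_derivative A) (at \<sigma>)" "(\<psi> has_derivative A') (at z)"
    unfolding A_def A'_def using smooth_on_differentiable d c(1) z
    by (auto intro!: has_derivative_frechet)
  have "((\<lambda>x. \<psi> (\<phi> x)) has_derivative (\<lambda>h. A' (A h))) (at \<sigma>)"
    using has_derivative_compose[OF dA(1), of \<psi> A'] dA(2) by (simp add: z_def)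
  then have "((\<lambda>x. x) has_derivative (\<lambda>h. A' (A h))) (at \<sigma>)"
    by (rule has_derivative_transform_within_open[OF _ d(1) c(1)]) (use d in auto)
  then have A'A: "A' (A h) = h" for h
    using has_derivative_unique[OF _ has_derivative_ident] by metis
  have "((\<lambda>x. \<phi> (\<psi> x)) has_derivative (\<lambda>h. A (A' h))) (at z)"
    using has_derivative_compose[OF dA(2), of \<phi> A] dA(1) z by simp
  then have "((\<lambda>x. x) has_derivative (\<lambda>h. A (A' h))) (at z)"
    by (rule has_derivative_transform_within_open[OF _ d(2) z(1)]) (use d in auto)
  then have AA': "A (A' h) = h" for h
    using has_derivative_unique[OF _ has_derivative_ident] by metis
  have lin: "linear A" "linear A'" using dA by (auto intro: has_derivative_linear)
  \<comment> \<open>The tangent space of \<Gamma> at \<sigma>. The map \<open>prL\<close> below is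
    in general an oblique projection onto L, chosen so that its transport by the chart differential
    is the orthogonal projection P.\<close>
  define T where "T = A' ` L"
  have "inj_on A' (span L)" by (rule inj_on_inverseI[of _ A]) (rule AA')
  then have T: "subspace T" "dim T = k"
    unfolding T_def using linear_subspace_image[OF lin(2) c(3)] dim_image_eq[OF lin(2)] c(4) by auto
  obtain P where P: "linear P" "\<And>x. P x \<in> T" "\<And>x. x \<in> T \<Longrightarrow> P x = x" "\<And>x y. P x \<bullet> y = x \<bullet> P y"
    "(\<Sum>i\<in>UNIV. axis i 1 \<bullet> P (axis i 1)) = real k"
    by (rule orthogonal_projection_exists[OF T]) (rule that)
  define prL where "prL x = A (P (A' x))" for x
  have prLL: "prL x \<in> L" for x
    using P(2)[of "A' x"] AA' unfolding prL_def T_def by auto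
  have prL_fix: "prL x = x" if "x \<in> L" for x
    using P(3)[of "A' x"] that AA' unfolding prL_def T_def by auto
  have bl: "bounded_linear prL"
    using linear_compose[OF linear_compose[OF lin(2) P(1)] lin(1)]
    by (simp add: prL_def[abs_def] comp_def linear_conv_bounded_linear)
  define S where "S = U \<inter> (\<lambda>x. prL (\<phi> x)) -` V"
  have ckU: "Ck_on j U (\<lambda>x. prL (\<phi> x))" for j
    by (rule Ck_on_compose[OF d(1) open_UNIV subset_UNIV d(3)[unfolded smooth_on_def, rule_format] Ck_on_bounded_linear[OF bl]])
  have "open S" unfolding S_def
    by (rule continuous_open_preimage[OF Ck_on_imp_continuous_on[OF ckU] d(1,2)])
  define \<pi> where "\<pi> x = \<psi> (prL (\<phi> x))" for x
  have "\<sigma> \<in> S" using c(1) z prL_fix[OF z(3)] by (simp add: S_def z_def)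
  have ck: "Ck_on 2 S \<pi>"
    unfolding \<pi>_def
  proof -
    have 1: "Ck_on 2 S (\<lambda>x. prL (\<phi> x))" by (rule Ck_on_subset[OF ckU]) (simp add: S_def)
    have 2: "Ck_on 2 V \<psi>" using d(4) by (simp add: smooth_on_def)
    show "Ck_on 2 S (\<lambda>x. \<psi> (prL (\<phi> x)))"
      by (rule Ck_on_compose[OF \<open>open S\<close> d(2) _ 1 2]) (auto simp: S_def)
  qed
  have in\<Gamma>: "\<pi> x \<in> \<Gamma>" if "x \<in> S" for x
  proof -
    have "prL (\<phi> x) \<in> V \<inter> L" using that prLL by (simp add: S_def)
    then obtain g where "g \<in> \<Gamma> \<inter> U" "prL (\<phi> x) = \<phi> g" using c(5) by (metis imageE)
    then show ?thesis using d(7) by (simp add: \<pi>_def)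
  qed
  have fix\<Gamma>: "\<pi> x = x" if "x \<in> S" "x \<in> \<Gamma>" for x
  proof -
    have "\<phi> x \<in> L" using that c(5) by (auto simp: S_def)
    then show ?thesis using that d(7) prL_fix by (simp add: \<pi>_def S_def)
  qed
  have "(\<pi> has_derivative (\<lambda>h. A' (prL (A h)))) (at \<sigma>)"
  proof -
    have 1: "((\<lambda>x. prL (\<phi> x)) has_derivative (\<lambda>h. prL (A h))) (at \<sigma>)"
      by (rule bounded_linear.has_derivative[OF bl dA(1)])
    have "prL (\<phi> \<sigma>) = z" using z prL_fix by (simp add: z_def)
    then show ?thesis using has_derivative_compose[OF 1, of \<psi> A'] dA(2) by (simp add: \<pi>_def[abs_def])
  qed
  then have "(\<pi> has_derivative P) (at \<sigma>)" by (simp add: prL_def A'A)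
  then have fr: "frechet_derivative \<pi> (at \<sigma>) = P" using frechet_derivative_at by metis
  have ex: "\<exists>e. norm e = 1 \<and> P e = 0" if "k < CARD('n)"
  proof -
    have "T \<noteq> UNIV" using T(2) that by (metis dim_UNIV DIM_cart DIM_real mult_1_right less_irrefl)
    then obtain x where x: "x \<notin> T" by auto
    define y where "y = x - P x"
    have y: "y \<noteq> 0" "P y = 0" using x P(2)[of x] P(3)[OF P(2)[of x]] by (auto simp: y_def linear_diff[OF P(1)])
    show ?thesis by (rule exI[of _ "y /\<^sub>R norm y"]) (use y in \<open>simp add: linear_scale[OF P(1)]\<close>)
  qed
  show ?thesis
    by (rule that[OF \<open>open S\<close> \<open>\<sigma> \<in> S\<close> ck in\<Gamma> fix\<Gamma> fr P(1) P(3)[OF P(2)] P(4,5) ex])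
qed

lemma linear_eq_sum_axis:
  fixes G :: "real^'n::finite \<Rightarrow> 'b::real_vector"
  assumes "linear G"
  shows "G h = (\<Sum>j\<in>UNIV. (h $ j) *\<^sub>R G (axis j 1))"
proof -
  have "h = (\<Sum>j\<in>UNIV. (h $ j) *\<^sub>R axis j 1)"
    by (simp add: vec_eq_iff axis_def if_distrib[of "(*) _"] cong: if_cong)
  then have "G h = G (\<Sum>j\<in>UNIV. (h $ j) *\<^sub>R axis j 1)" by simp
  then show ?thesis by (simp add: linear_sum[OF assms] linear_scale[OF assms])
qed

text \<open>The trace is cyclic: expanded in the axes, both sides become the same double sum. It is
  used to place a second normal projection next to the deviation \<open>E\<close> in
  \<open>retraction_estimates\<close>.\<close>

lemma trace_commute_linear:
  fixes G H :: "real^'n::finite \<Rightarrow> real^'n"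
  assumes "linear G" "linear H"
  shows "(\<Sum>i\<in>UNIV. axis i 1 \<bullet> G (H (axis i 1))) = (\<Sum>i\<in>UNIV. axis i 1 \<bullet> H (G (axis i 1)))"
proof -
  have e: "axis i 1 \<bullet> G (H (axis i 1)) = (\<Sum>j\<in>UNIV. H (axis i 1) $ j * G (axis j 1) $ i)"
    if "linear G" for i and G H :: "real^'n \<Rightarrow> real^'n"
    by (subst linear_eq_sum_axis[OF that]) (simp add: inner_axis')
  show ?thesis
    unfolding e[OF assms(1)] e[OF assms(2)] by (subst sum.swap) (simp add: mult.commute)
qed

lemma has_real_derivative_line:
  fixes f :: "real^'n::finite \<Rightarrow> 'b::real_inner"
  assumes "f differentiable at x" "g differentiable at x"
  shows "((\<lambda>s. f (x + s *\<^sub>R axis i 1) \<bullet> g (x + s *\<^sub>R axis i 1)) has_real_derivative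
    partial i f x \<bullet> g x + f x \<bullet> partial i g x) (at 0)"
proof -
  have "((\<lambda>s. f (x + s *\<^sub>R axis i 1)) has_vector_derivative partial i f x) (at 0)"
    "((\<lambda>s. g (x + s *\<^sub>R axis i 1)) has_vector_derivative partial i g x) (at 0)"
    using Ck_on_has_derivative_line[of f x 0 i] Ck_on_has_derivative_line[of g x 0 i] assms by simp_all
  from has_derivative_inner[OF this[unfolded has_vector_derivative_def]]
  have "((\<lambda>s. f (x + s *\<^sub>R axis i 1) \<bullet> g (x + s *\<^sub>R axis i 1)) has_derivative
     (\<lambda>h. f x \<bullet> (h *\<^sub>R partial i g x) + (h *\<^sub>R partial i f x) \<bullet> g x)) (at 0)" by simp
  moreover have "(\<lambda>h. f x \<bullet> (h *\<^sub>R partial i g x) + (h *\<^sub>R partial i f x) \<bullet> g x)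
      = (*) (partial i f x \<bullet> g x + f x \<bullet> partial i g x)"
    by (auto simp: algebra_simps)
  ultimately show ?thesis unfolding has_field_derivative_def by simp
qed

lemma le_mult_weaken: "a \<le> C1 * z \<Longrightarrow> C1 \<le> C \<Longrightarrow> 0 \<le> z \<Longrightarrow> a \<le> C * (z::real)"
  by (meson mult_right_mono order.trans)

text \<open>These are estimates for the gradient and Laplacian of |x - \<pi> x|^2 / 2. The errors
  are of second order in |x - \<sigma>|, although the differential of \<pi> differs from P already
  at first order. The gain comes from \<pi> being idempotent: along F = x - \<pi> x the differential
  is quadratically small, and since it is nearly a projection, its normal-to-normal block changes
  only at second order.\<close>

lemma retraction_estimates:
  fixes \<pi> :: "real^'n::finite \<Rightarrow> real^'n"
  assumes S: "open S" "Ck_on 2 S \<pi>" and r: "cball \<sigma> r \<subseteq> S" "r > 0"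
    and idem: "\<And>x. x \<in> S \<Longrightarrow> \<pi> x \<in> S \<Longrightarrow> \<pi> (\<pi> x) = \<pi> x" and fix_\<sigma>: "\<pi> \<sigma> = \<sigma>"
    and P: "frechet_derivative \<pi> (at \<sigma>) = P" "linear P" "\<And>x. P (P x) = P x" "\<And>x y. P x \<bullet> y = x \<bullet> P y"
      "(\<Sum>i\<in>UNIV. axis i 1 \<bullet> P (axis i 1)) = real k"
  obtains C \<rho> where "C \<ge> 0" "0 < \<rho>" "\<rho> \<le> r"
    "\<And>x. x \<in> cball \<sigma> \<rho> \<Longrightarrow> \<pi> x \<in> cball \<sigma> r"
    "\<And>x. x \<in> cball \<sigma> \<rho> \<Longrightarrow> \<bar>(\<Sum>i\<in>UNIV. ((x - \<pi> x) \<bullet> (axis i 1 - partial i \<pi> x))\<^sup>2) - (norm (x - \<pi> x))\<^sup>2\<bar>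
      \<le> C * (((norm (x - \<sigma>))\<^sup>2 + norm (x - \<pi> x)) * (norm (x - \<pi> x))\<^sup>2)"
    "\<And>x. x \<in> cball \<sigma> \<rho> \<Longrightarrow> \<bar>(\<Sum>i\<in>UNIV. (norm (axis i 1 - partial i \<pi> x))\<^sup>2
        - (x - \<pi> x) \<bullet> partial i (partial i \<pi>) x) - (real CARD('n) - real k)\<bar>
      \<le> C * ((norm (x - \<sigma>))\<^sup>2 + norm (x - \<pi> x))"
    "\<And>x. x \<in> cball \<sigma> \<rho> \<Longrightarrow> \<bar>\<Sum>i\<in>UNIV. ((x - \<pi> x) \<bullet> (axis i 1 - partial i \<pi> x)) * ((x - \<sigma>) $ i)\<bar>
      \<le> C * (norm (x - \<pi> x) * ((norm (x - \<sigma>))\<^sup>2 + norm (x - \<pi> x)))"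
    "\<And>e t. norm e = 1 \<Longrightarrow> P e = 0 \<Longrightarrow> 0 \<le> t \<Longrightarrow> t \<le> \<rho> \<Longrightarrow>
      norm (\<sigma> + t *\<^sub>R e - \<pi> (\<sigma> + t *\<^sub>R e)) \<ge> t / 2"
proof -
  let ?D = "\<lambda>x. frechet_derivative \<pi> (at x)"
  define N where "N = real CARD('n)"
  have N: "N \<ge> 1" by (simp add: N_def Suc_leI)
  obtain C1 where C1: "C1 \<ge> 0"
    "\<And>x y. x \<in> cball \<sigma> r \<Longrightarrow> y \<in> cball \<sigma> r \<Longrightarrow> norm (\<pi> y - \<pi> x - ?D x (y - x)) \<le> C1 * (norm (y - x))\<^sup>2"
    "\<And>x y h. x \<in> cball \<sigma> r \<Longrightarrow> y \<in> cball \<sigma> r \<Longrightarrow> norm (?D y h - ?D x h) \<le> C1 * norm (y - x) * norm h"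
    using Ck_on_taylor2[OF S(2) r(1)] by blast
  have ck1: "Ck_on 1 S \<pi>" "\<And>i. Ck_on 1 S (partial i \<pi>)" "\<And>i. Ck_on 0 S (partial i (partial i \<pi>))"
    using S(2) by (simp_all add: numeral_2_eq_2)
  obtain K where K: "K \<ge> 0" "\<And>x y. x \<in> cball \<sigma> r \<Longrightarrow> y \<in> cball \<sigma> r \<Longrightarrow> norm (\<pi> x - \<pi> y) \<le> K * norm (x - y)"
    using Ck_on_lipschitz[OF ck1(1) r(1)] by blast
  have "\<exists>M\<ge>0. \<forall>x\<in>cball \<sigma> r. norm (partial i (partial i \<pi>) x) \<le> M" for i
  proof -
    have "continuous_on (cball \<sigma> r) (partial i (partial i \<pi>))"
      using continuous_on_subset[OF _ r(1)] ck1(3)[of i] by simp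
    then have "bounded (partial i (partial i \<pi>) ` cball \<sigma> r)"
      by (intro compact_imp_bounded compact_continuous_image compact_cball)
    then show ?thesis by (auto simp: bounded_pos intro: less_imp_le)
  qed
  then obtain M where M: "\<And>i. M i \<ge> 0" "\<And>i x. x \<in> cball \<sigma> r \<Longrightarrow> norm (partial i (partial i \<pi>) x) \<le> M i"
    by metis
  define M0 where "M0 = (\<Sum>i\<in>UNIV. M i)"
  have M0: "M0 \<ge> 0" using M by (simp add: M0_def sum_nonneg)
  have dif: "\<pi> differentiable at x" if "x \<in> S" for x using ck1(1) that by (simp add: One_nat_def)
  have lD: "linear (?D x)" if "x \<in> S" for x using dif[OF that] by (rule linear_frechet_derivative)
  have Pnorm: "norm (P h) \<le> norm h" for h
  proof -
    have "(norm (P h))\<^sup>2 = h \<bullet> P h" using P(3,4) by (simp add: power2_norm_eq_inner)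
    also have "\<dots> \<le> norm h * norm (P h)" by (rule norm_cauchy_schwarz)
    finally have "norm (P h) * norm (P h) \<le> norm h * norm (P h)" by (simp add: power2_eq_square)
    then show ?thesis by (cases "norm (P h) = 0") auto
  qed
  \<comment> \<open>The three bounds make \<pi> map the ball into \<open>cball \<sigma> r\<close>,
    keep |x - \<pi> x| at most 1, and keep the Taylor remainder on a normal line at \<sigma> below
    half of the distance travelled.\<close>
  define \<rho> where "\<rho> = min (r / (K + 1)) (min (1 / (K + 1)) (1 / (2 * C1 + 1)))"
  have "r / (K + 1) \<le> r" "1 / (K + 1) \<le> 1" using K(1) r(2) by (auto simp: field_simps)
  then have \<rho>: "0 < \<rho>" "\<rho> \<le> r" "\<rho> \<le> 1" "\<rho> \<le> r / (K + 1)" "\<rho> \<le> 1 / (K + 1)" "\<rho> \<le> 1 / (2 * C1 + 1)"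
    using K(1) C1(1) r(2) unfolding \<rho>_def by (auto simp: min_le_iff_disj)
  have \<rho>': "\<rho> * (K + 1) \<le> r" "\<rho> * (K + 1) \<le> 1" "C1 * \<rho> \<le> 1 / 2"
  proof -
    show "\<rho> * (K + 1) \<le> r" "\<rho> * (K + 1) \<le> 1" using \<rho>(4,5) K(1) by (simp_all add: le_divide_eq)
    have "\<rho> * (2 * C1 + 1) \<le> 1" using \<rho>(6) C1(1) by (simp add: le_divide_eq)
    then show "C1 * \<rho> \<le> 1 / 2" using \<rho>(1) by (simp add: algebra_simps)
  qed
  have \<sigma>r: "\<sigma> \<in> cball \<sigma> r" using r by simp
  have fct: "x \<in> cball \<sigma> r" "x \<in> S" "\<pi> x \<in> cball \<sigma> r" "\<pi> x \<in> S" "norm (x - \<pi> x) \<le> 1"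
    "norm (x - \<sigma>) \<le> 1" if x: "x \<in> cball \<sigma> \<rho>" for x
  proof -
    have d: "norm (x - \<sigma>) \<le> \<rho>" using x by (simp add: dist_norm norm_minus_commute)
    then show "norm (x - \<sigma>) \<le> 1" using \<rho> by simp
    show 1: "x \<in> cball \<sigma> r" using x \<rho> by simp
    then show "x \<in> S" using r by auto
    have p: "norm (\<pi> x - \<sigma>) \<le> K * norm (x - \<sigma>)" using K(2)[OF 1 \<sigma>r] by (simp add: fix_\<sigma>)
    also have "\<dots> \<le> K * \<rho>" using d K(1) by (rule mult_left_mono)
    also have "\<dots> \<le> r" using \<rho>'(1) \<rho>(1) by (simp add: algebra_simps)
    finally show 2: "\<pi> x \<in> cball \<sigma> r" by (simp add: dist_norm norm_minus_commute)
    then show "\<pi> x \<in> S" using r by auto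
    have "norm (x - \<pi> x) \<le> norm (x - \<sigma>) + norm (\<pi> x - \<sigma>)"
      using norm_triangle_ineq4[of "x - \<sigma>" "\<pi> x - \<sigma>"] by simp
    also have "\<dots> \<le> \<rho> * (K + 1)" using d p mult_left_mono[OF d K(1)] by (simp add: algebra_simps)
    finally show "norm (x - \<pi> x) \<le> 1" using \<rho>'(2) by simp
  qed
  define Ca where "Ca = 2 * C1 + 4 * C1\<^sup>2 + 2 * N * C1\<^sup>2"
  define Cb where "Cb = M0 + N * C1\<^sup>2 + 2 * N * (C1\<^sup>2 + C1 * (1 + C1))"
  define Cc where "Cc = 1 + C1"
  define C where "C = Ca + Cb + Cc"
  have Cpos: "Ca \<ge> 0" "Cb \<ge> 0" "Cc \<ge> 0" using C1(1) N M0 by (auto simp: Ca_def Cb_def Cc_def)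
  show ?thesis
  proof (rule that[of C \<rho>])
    show "C \<ge> 0" using Cpos by (simp add: C_def)
    show "0 < \<rho>" "\<rho> \<le> r" by fact+
  next
    fix x assume "x \<in> cball \<sigma> \<rho>"
    then show "\<pi> x \<in> cball \<sigma> r" using fct by auto
  next
    fix x assume x: "x \<in> cball \<sigma> \<rho>"
    note fx = fct[OF x]
    define F where "F = x - \<pi> x"
    define f where "f = norm F"
    define X where "X = (norm (x - \<sigma>))\<^sup>2"
    define D where "D = ?D x"
    define E where "E h = D h - P h" for h
    have f: "0 \<le> f" "f \<le> 1" "f\<^sup>2 \<le> f"
      using fx(5) by (auto simp: f_def F_def power2_eq_square mult_left_le)
    have X: "0 \<le> X" "X \<le> 1" using fx(6) by (auto simp: X_def power_le_one)
    have linD: "linear D" unfolding D_def using lD fx by simp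
    have linE: "linear E" unfolding E_def by (intro linear_compose_sub linD P(2))
    \<comment> \<open>Expand \<pi> at x and evaluate at \<pi> x. As \<pi> (\<pi> x) = \<pi> x, the
      increment of \<pi> is zero and \<open>D F\<close> is the remainder itself.\<close>
    have DF: "norm (D F) \<le> C1 * f\<^sup>2"
      using C1(2)[OF fx(1,3)] idem[OF fx(2,4)] linear_diff[OF linD, of "\<pi> x" x] linear_diff[OF linD, of x "\<pi> x"]
      by (simp add: D_def F_def f_def norm_minus_commute)
    have Eb: "norm (E h) \<le> C1 * norm (x - \<sigma>) * norm h" for h
      using C1(3)[OF \<sigma>r fx(1), of h] by (simp add: E_def D_def P(1))
    have Eb2: "(norm (E h))\<^sup>2 \<le> C1\<^sup>2 * X * (norm h)\<^sup>2" for h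
      using power_mono[OF Eb norm_ge_zero, of h 2] by (simp add: X_def power_mult_distrib)
    have DPE: "D h = P h + E h" for h by (simp add: E_def)
    have pD: "partial i \<pi> x = D (axis i 1)" for i by (simp add: partial_def D_def)
    have na: "norm (axis i (1::real) :: real^'n) = 1" for i by simp

    \<comment> \<open>Length of the gradient\<close>
    define u where "u i = F \<bullet> D (axis i 1)" for i
    have Fsum: "(\<Sum>i\<in>UNIV. (F $ i)\<^sup>2) = f\<^sup>2"
      by (simp add: f_def norm_vec_def L2_set_def sum_nonneg)
    have Dsum: "(\<Sum>i\<in>UNIV. F $ i * u i) = F \<bullet> D F"
      by (subst linear_eq_sum_axis[OF linD, of F]) (simp add: u_def inner_sum_right)
    have "\<bar>(\<Sum>i\<in>UNIV. (F \<bullet> (axis i 1 - D (axis i 1)))\<^sup>2) - f\<^sup>2\<bar> \<le> Ca * ((X + f) * f\<^sup>2)"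
    proof -
      have "(\<Sum>i\<in>UNIV. (F \<bullet> (axis i 1 - D (axis i 1)))\<^sup>2) = (\<Sum>i\<in>UNIV. (F $ i)\<^sup>2 - 2 * (F $ i * u i) + (u i)\<^sup>2)"
        by (intro sum.cong) (auto simp: u_def inner_diff_right inner_axis power2_eq_square algebra_simps)
      also have "\<dots> = f\<^sup>2 - 2 * (F \<bullet> D F) + (\<Sum>i\<in>UNIV. (u i)\<^sup>2)"
        by (simp add: sum.distrib sum_subtractf sum_distrib_left[symmetric] Fsum Dsum)
      finally have eq: "(\<Sum>i\<in>UNIV. (F \<bullet> (axis i 1 - D (axis i 1)))\<^sup>2) - f\<^sup>2 = (\<Sum>i\<in>UNIV. (u i)\<^sup>2) - 2 * (F \<bullet> D F)"
        by simp
      have 1: "\<bar>F \<bullet> D F\<bar> \<le> C1 * (f * f\<^sup>2)"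
        using Cauchy_Schwarz_ineq2[of F "D F"] mult_left_mono[OF DF, of f] f by (simp add: f_def[symmetric] mult_ac)
      \<comment> \<open>F is almost normal: its tangential part is the difference of
        \<open>D F\<close> and \<open>E F\<close>, which are both small compared with F.\<close>
      have PF: "(norm (P F))\<^sup>2 \<le> 2 * C1\<^sup>2 * ((X + f) * f\<^sup>2)"
      proof -
        have "norm (P F) \<le> norm (D F) + norm (E F)" using norm_triangle_ineq4[of "D F" "E F"] by (simp add: DPE)
        also have "\<dots> \<le> C1 * f\<^sup>2 + C1 * norm (x - \<sigma>) * f" using DF Eb[of F] by (simp add: f_def)
        finally have "norm (P F) \<le> C1 * f * (f + norm (x - \<sigma>))" by (simp add: algebra_simps power2_eq_square)
        then have "(norm (P F))\<^sup>2 \<le> (C1 * f * (f + norm (x - \<sigma>)))\<^sup>2" by (intro power_mono) auto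
        also have "\<dots> = C1\<^sup>2 * f\<^sup>2 * (f + norm (x - \<sigma>))\<^sup>2" by (simp add: power_mult_distrib)
        also have "\<dots> \<le> C1\<^sup>2 * f\<^sup>2 * (2 * (X + f))"
        proof (rule mult_left_mono)
          have "(f + norm (x - \<sigma>))\<^sup>2 \<le> 2 * (f\<^sup>2 + X)"
            using zero_le_power2[of "f - norm (x - \<sigma>)"] by (simp add: X_def power2_diff power2_sum)
          then show "(f + norm (x - \<sigma>))\<^sup>2 \<le> 2 * (X + f)" using f(3) by simp
        qed simp
        finally show ?thesis by (simp add: algebra_simps)
      qed
      have 2: "(\<Sum>i\<in>UNIV. (u i)\<^sup>2) \<le> (4 * C1\<^sup>2 + 2 * N * C1\<^sup>2) * ((X + f) * f\<^sup>2)"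
      proof -
        have "(u i)\<^sup>2 \<le> 2 * (P F $ i)\<^sup>2 + 2 * (C1\<^sup>2 * ((X + f) * f\<^sup>2))" for i
        proof -
          have "u i = P F $ i + F \<bullet> E (axis i 1)"
            using P(4)[of F "axis i 1"] by (simp add: u_def DPE inner_add_right inner_axis)
          moreover have "(F \<bullet> E (axis i 1))\<^sup>2 \<le> C1\<^sup>2 * ((X + f) * f\<^sup>2)"
          proof -
            have "(F \<bullet> E (axis i 1))\<^sup>2 \<le> f\<^sup>2 * (norm (E (axis i 1)))\<^sup>2"
              using Cauchy_Schwarz_ineq[of F "E (axis i 1)"] by (simp add: f_def power2_norm_eq_inner)
            also have "\<dots> \<le> f\<^sup>2 * (C1\<^sup>2 * X)" using Eb2[of "axis i 1"] by (intro mult_left_mono) auto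
            also have "\<dots> \<le> f\<^sup>2 * (C1\<^sup>2 * (X + f))" using f X by (intro mult_left_mono) auto
            finally show ?thesis by (simp add: mult_ac)
          qed
          moreover have "(P F $ i + F \<bullet> E (axis i 1))\<^sup>2 \<le> 2 * (P F $ i)\<^sup>2 + 2 * (F \<bullet> E (axis i 1))\<^sup>2"
            using zero_le_power2[of "P F $ i - F \<bullet> E (axis i 1)"] by (simp add: power2_diff power2_sum)
          ultimately show ?thesis by simp
        qed
        then have "(\<Sum>i\<in>UNIV. (u i)\<^sup>2) \<le> (\<Sum>i\<in>UNIV. 2 * (P F $ i)\<^sup>2 + 2 * (C1\<^sup>2 * ((X + f) * f\<^sup>2)))"
          by (rule sum_mono)
        also have "\<dots> = 2 * (norm (P F))\<^sup>2 + N * (2 * (C1\<^sup>2 * ((X + f) * f\<^sup>2)))"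
          by (simp add: sum.distrib sum_distrib_left[symmetric] N_def norm_vec_def L2_set_def sum_nonneg)
        finally show ?thesis using PF by (simp add: algebra_simps)
      qed
      have 3: "f * f\<^sup>2 \<le> (X + f) * f\<^sup>2" using X by (intro mult_right_mono) auto
      have "2 * (C1 * (f * f\<^sup>2)) \<le> 2 * C1 * ((X + f) * f\<^sup>2)" using mult_left_mono[OF 3 C1(1)] by simp
      moreover have "(\<Sum>i\<in>UNIV. (u i)\<^sup>2) \<ge> 0" by (simp add: sum_nonneg)
      ultimately show ?thesis unfolding eq Ca_def using 1 2 by (simp add: algebra_simps abs_le_iff)
    qed
    then show "\<bar>(\<Sum>i\<in>UNIV. ((x - \<pi> x) \<bullet> (axis i 1 - partial i \<pi> x))\<^sup>2) - (norm (x - \<pi> x))\<^sup>2\<bar>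
      \<le> C * (((norm (x - \<sigma>))\<^sup>2 + norm (x - \<pi> x)) * (norm (x - \<pi> x))\<^sup>2)"
      unfolding pD F_def[symmetric] f_def[symmetric] X_def[symmetric]
      using Cpos X f by (elim le_mult_weaken) (auto simp: C_def)

    \<comment> \<open>Pairing of the gradient with the radial direction\<close>
    have "\<bar>F \<bullet> ((x - \<sigma>) - D (x - \<sigma>))\<bar> \<le> Cc * (f * (X + f))"
    proof -
      \<comment> \<open>Up to sign, the Taylor remainder of the expansion at x evaluated at
        \<sigma>, where \<pi> \<sigma> = \<sigma>. What is left of x - \<sigma> is F, whose product
        with itself is of the allowed order.\<close>
      define R where "R = \<pi> x - \<sigma> - D (x - \<sigma>)"
      have "norm (\<sigma> - \<pi> x - D (\<sigma> - x)) \<le> C1 * X"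
        using C1(2)[OF fx(1) \<sigma>r] by (simp add: fix_\<sigma> D_def X_def norm_minus_commute)
      moreover have "\<sigma> - \<pi> x - D (\<sigma> - x) = - R"
        using linear_diff[OF linD, of \<sigma> x] linear_diff[OF linD, of x \<sigma>] by (simp add: R_def)
      ultimately have R: "norm R \<le> C1 * X" by simp
      have "(x - \<sigma>) - D (x - \<sigma>) = F + R" by (simp add: R_def F_def)
      then have "\<bar>F \<bullet> ((x - \<sigma>) - D (x - \<sigma>))\<bar> \<le> f\<^sup>2 + f * norm R"
        using Cauchy_Schwarz_ineq2[of F R] by (simp add: inner_add_right f_def power2_norm_eq_inner[symmetric] abs_le_iff)
         (smt (verit) zero_le_power2)
      also have "\<dots> \<le> f\<^sup>2 + f * (C1 * X)" using R f by (simp add: mult_left_mono)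
      also have "\<dots> \<le> Cc * (f * (X + f))"
        using X f C1(1) by (simp add: Cc_def algebra_simps power2_eq_square)
      finally show ?thesis .
    qed
    moreover have "(\<Sum>i\<in>UNIV. (F \<bullet> (axis i 1 - D (axis i 1))) * ((x - \<sigma>) $ i)) = F \<bullet> ((x - \<sigma>) - D (x - \<sigma>))"
    proof -
      have "linear (\<lambda>h. h - D h)" by (intro linear_compose_sub linD linear_ident)
      from linear_eq_sum_axis[OF this, of "x - \<sigma>"]
      have "(x - \<sigma>) - D (x - \<sigma>) = (\<Sum>j\<in>UNIV. ((x - \<sigma>) $ j) *\<^sub>R (axis j 1 - D (axis j 1)))" by simp
      then show ?thesis by (simp add: inner_sum_right mult.commute)
    qed
    ultimately have "\<bar>\<Sum>i\<in>UNIV. (F \<bullet> (axis i 1 - D (axis i 1))) * ((x - \<sigma>) $ i)\<bar> \<le> Cc * (f * (X + f))"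
      by simp
    then show "\<bar>\<Sum>i\<in>UNIV. ((x - \<pi> x) \<bullet> (axis i 1 - partial i \<pi> x)) * ((x - \<sigma>) $ i)\<bar>
      \<le> C * (norm (x - \<pi> x) * ((norm (x - \<sigma>))\<^sup>2 + norm (x - \<pi> x)))"
      unfolding pD F_def[symmetric] f_def[symmetric] X_def[symmetric]
      using Cpos X f by (elim le_mult_weaken) (auto simp: C_def)

    \<comment> \<open>The Laplacian\<close>
    define Q where "Q h = h - P h" for h
    have linQ: "linear Q" unfolding Q_def by (intro linear_compose_sub P(2) linear_ident)
    have Qsym: "Q a \<bullet> b = a \<bullet> Q b" for a b by (simp add: Q_def inner_diff_left inner_diff_right P(4))
    have QQ: "Q (Q h) = Q h" and PQ: "P (Q h) = 0" for h
      by (simp_all add: Q_def linear_diff[OF P(2)] P(3))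
    have Qn: "norm (Q h) \<le> norm h" for h
    proof -
      have "(norm (Q h))\<^sup>2 = h \<bullet> Q h" using Qsym[of h "Q h"] by (simp add: QQ power2_norm_eq_inner)
      also have "\<dots> \<le> norm h * norm (Q h)" by (rule norm_cauchy_schwarz)
      finally have "norm (Q h) * norm (Q h) \<le> norm h * norm (Q h)" by (simp add: power2_eq_square)
      then show ?thesis by (cases "norm (Q h) = 0") auto
    qed
    \<comment> \<open>Differentiating \<pi> o \<pi> = \<pi> at x shows that the differential at
      \<pi> x fixes the range of \<open>D\<close>. Moving it from \<pi> x back to x costs a multiple
      of f, so \<open>D\<close> is idempotent up to order f.\<close>
    have DD: "norm (D (D h) - D h) \<le> C1 * f * norm (D h)" for h
    proof -
      have "((\<lambda>y. \<pi> (\<pi> y)) has_derivative (\<lambda>h. ?D (\<pi> x) (D h))) (at x)"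
        unfolding D_def by (rule has_derivative_compose[OF has_derivative_frechet[OF dif[OF fx(2)]] has_derivative_frechet[OF dif[OF fx(4)]]])
      moreover have "open (S \<inter> \<pi> -` S)"
        by (rule continuous_open_preimage[OF Ck_on_imp_continuous_on[OF S(2)] S(1,1)])
      ultimately have "(\<pi> has_derivative (\<lambda>h. ?D (\<pi> x) (D h))) (at x)"
        by (rule has_derivative_transform_within_open) (use fx idem in auto)
      then have "?D (\<pi> x) (D h) = D h" using frechet_derivative_at D_def by metis
      then have "norm (D (D h) - D h) = norm (?D x (D h) - ?D (\<pi> x) (D h))" by (simp add: D_def)
      also have "\<dots> \<le> C1 * norm (x - \<pi> x) * norm (D h)" by (rule C1(3)[OF fx(3,1)])
      finally show ?thesis by (simp add: f_def F_def)
    qed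
    \<comment> \<open>On a normal vector a one has \<open>D a = E a\<close> and
      \<open>P a = 0\<close>. Testing the near idempotence of \<open>D\<close> with a therefore
      expresses the first order quantity a . E a through a . E (E a), which is quadratic in |x -
      \<sigma>|, and an error of order f.\<close>
    have QEQ: "\<bar>Q h \<bullet> E (Q h)\<bar> \<le> (C1\<^sup>2 + C1 * (1 + C1)) * (X + f)" if h: "norm h = 1" for h
    proof -
      define a where "a = Q h"
      have a: "norm a \<le> 1" "P a = 0" "Q a = a" using Qn[of h] h PQ QQ by (auto simp: a_def)
      have Da: "D a = E a" using DPE[of a] a by simp
      have "a \<bullet> (D (D a) - D a) = a \<bullet> E (E a) - a \<bullet> E a"
        using P(4)[of a "E a"] a by (simp add: Da inner_diff_right DPE[of "E a"] inner_add_right)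
      moreover have "\<bar>a \<bullet> (D (D a) - D a)\<bar> \<le> C1 * f * (1 + C1)"
      proof -
        have "norm (D a) \<le> C1 * norm (x - \<sigma>) * norm a" using Da Eb by simp
        also have "\<dots> \<le> C1 * 1 * 1" using fx(6) a C1(1) by (intro mult_mono) auto
        finally have n: "norm (D a) \<le> C1" by simp
        have "\<bar>a \<bullet> (D (D a) - D a)\<bar> \<le> norm a * norm (D (D a) - D a)" by (rule Cauchy_Schwarz_ineq2)
        also have "\<dots> \<le> 1 * (C1 * f * norm (D a))" using a DD f C1(1) by (intro mult_mono) auto
        also have "\<dots> \<le> C1 * f * (1 + C1)" using n f C1(1) by (simp add: mult_left_mono)
        finally show ?thesis .
      qed
      moreover have "\<bar>a \<bullet> E (E a)\<bar> \<le> C1\<^sup>2 * X"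
      proof -
        have "\<bar>a \<bullet> E (E a)\<bar> \<le> norm a * norm (E (E a))" by (rule Cauchy_Schwarz_ineq2)
        also have "\<dots> \<le> 1 * (C1 * norm (x - \<sigma>) * (C1 * norm (x - \<sigma>) * 1))"
        proof (rule mult_mono)
          have "norm (E a) \<le> C1 * norm (x - \<sigma>) * 1"
            using Eb[of a] a(1) mult_left_mono[OF a(1), of "C1 * norm (x - \<sigma>)"] C1(1) by simp
          then show "norm (E (E a)) \<le> C1 * norm (x - \<sigma>) * (C1 * norm (x - \<sigma>) * 1)"
            using Eb[of "E a"] C1(1) by (meson mult_left_mono mult_nonneg_nonneg norm_ge_zero order.trans)
        qed (use a in auto)
        finally show ?thesis by (simp add: X_def power2_eq_square mult_ac)
      qed
      ultimately have "\<bar>a \<bullet> E a\<bar> \<le> C1\<^sup>2 * X + C1 * f * (1 + C1)" by linarith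
      also have "\<dots> \<le> (C1\<^sup>2 + C1 * (1 + C1)) * (X + f)"
        using X f C1(1) by (simp add: algebra_simps)
      finally show ?thesis by (simp add: a_def)
    qed
    \<comment> \<open>Since Q is idempotent and the trace cyclic, a second Q may be inserted; only
      the normal-to-normal block of \<open>E\<close> contributes, to which \<open>QEQ\<close>
      applies.\<close>
    have trQE: "(\<Sum>i\<in>UNIV. Q (axis i 1) \<bullet> E (axis i 1)) = (\<Sum>i\<in>UNIV. Q (axis i 1) \<bullet> E (Q (axis i 1)))"
    proof -
      have "(\<Sum>i\<in>UNIV. axis i 1 \<bullet> Q (E (Q (axis i 1)))) = (\<Sum>i\<in>UNIV. axis i 1 \<bullet> (Q \<circ> E) (Q (axis i 1)))" by simp
      also have "\<dots> = (\<Sum>i\<in>UNIV. axis i 1 \<bullet> Q ((Q \<circ> E) (axis i 1)))"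
        by (rule trace_commute_linear[OF linear_compose[OF linE linQ] linQ])
      finally show ?thesis by (simp add: QQ Qsym)
    qed
    have tr: "\<bar>\<Sum>i\<in>UNIV. Q (axis i 1) \<bullet> E (axis i 1)\<bar> \<le> N * ((C1\<^sup>2 + C1 * (1 + C1)) * (X + f))"
    proof -
      have "\<bar>\<Sum>i\<in>UNIV. Q (axis i 1) \<bullet> E (Q (axis i 1))\<bar> \<le> (\<Sum>i\<in>(UNIV::'n set). (C1\<^sup>2 + C1 * (1 + C1)) * (X + f))"
        by (intro order.trans[OF sum_abs] sum_mono QEQ na)
      then show ?thesis unfolding trQE by (simp add: N_def)
    qed
    have trQ: "(\<Sum>i\<in>UNIV. (norm (Q (axis i 1)))\<^sup>2) = N - real k"
    proof -
      have "(norm (Q (axis i 1)))\<^sup>2 = 1 - axis i 1 \<bullet> P (axis i 1)" for i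
        using Qsym[of "axis i 1" "Q (axis i 1)"] QQ[of "axis i 1"]
        by (simp add: power2_norm_eq_inner) (simp add: Q_def inner_diff_right inner_axis_axis)
      then show ?thesis by (simp add: sum_subtractf P(5) N_def)
    qed
    have "\<bar>(\<Sum>i\<in>UNIV. (norm (axis i 1 - D (axis i 1)))\<^sup>2 - F \<bullet> partial i (partial i \<pi>) x) - (N - real k)\<bar> \<le> Cb * (X + f)"
    proof -
      have "(norm (axis i 1 - D (axis i 1)))\<^sup>2
          = (norm (Q (axis i 1)))\<^sup>2 - 2 * (Q (axis i 1) \<bullet> E (axis i 1)) + (norm (E (axis i 1)))\<^sup>2" for i
      proof -
        have "axis i 1 - D (axis i 1) = Q (axis i 1) - E (axis i 1)" by (simp add: Q_def DPE)
        then show ?thesis by (simp add: power2_norm_eq_inner inner_diff_left inner_diff_right inner_commute)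
      qed
      then have eq: "(\<Sum>i\<in>UNIV. (norm (axis i 1 - D (axis i 1)))\<^sup>2 - F \<bullet> partial i (partial i \<pi>) x) - (N - real k)
        = (\<Sum>i\<in>UNIV. (norm (E (axis i 1)))\<^sup>2) - 2 * (\<Sum>i\<in>UNIV. Q (axis i 1) \<bullet> E (axis i 1))
          - (\<Sum>i\<in>UNIV. F \<bullet> partial i (partial i \<pi>) x)"
        by (simp add: sum.distrib sum_subtractf sum_distrib_left[symmetric] trQ)
      have 1: "(\<Sum>i\<in>UNIV. (norm (E (axis i 1)))\<^sup>2) \<le> N * (C1\<^sup>2 * X)"
      proof -
        have "(\<Sum>i\<in>UNIV. (norm (E (axis i 1)))\<^sup>2) \<le> (\<Sum>i\<in>(UNIV::'n set). C1\<^sup>2 * X)"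
          using Eb2 na by (intro sum_mono) (metis mult_1_right power_one)
        then show ?thesis by (simp add: N_def)
      qed
      have 2: "\<bar>\<Sum>i\<in>UNIV. F \<bullet> partial i (partial i \<pi>) x\<bar> \<le> M0 * f"
      proof -
        have "\<bar>\<Sum>i\<in>UNIV. F \<bullet> partial i (partial i \<pi>) x\<bar> \<le> (\<Sum>i\<in>UNIV. f * M i)"
        proof (intro order.trans[OF sum_abs] sum_mono)
          fix i
          have "\<bar>F \<bullet> partial i (partial i \<pi>) x\<bar> \<le> f * norm (partial i (partial i \<pi>) x)"
            unfolding f_def by (rule Cauchy_Schwarz_ineq2)
          also have "\<dots> \<le> f * M i" using M(2)[OF fx(1)] f by (intro mult_left_mono)
          finally show "\<bar>F \<bullet> partial i (partial i \<pi>) x\<bar> \<le> f * M i" .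
        qed
        then show ?thesis by (simp add: M0_def sum_distrib_left sum_distrib_right mult.commute)
      qed
      have 3: "N * (C1\<^sup>2 * X) \<le> N * C1\<^sup>2 * (X + f)" "M0 * f \<le> M0 * (X + f)"
        using X f M0 N by (simp_all add: mult_left_mono)
      have 4: "(\<Sum>i\<in>UNIV. (norm (E (axis i 1)))\<^sup>2) \<ge> 0" by (simp add: sum_nonneg)
      have 5: "Cb * (X + f) = M0 * (X + f) + N * C1\<^sup>2 * (X + f) + 2 * (N * ((C1\<^sup>2 + C1 * (1 + C1)) * (X + f)))"
        by (simp add: Cb_def algebra_simps)
      show ?thesis unfolding eq 5 using 1 2 3 4 tr by linarith
    qed
    then show "\<bar>(\<Sum>i\<in>UNIV. (norm (axis i 1 - partial i \<pi> x))\<^sup>2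
        - (x - \<pi> x) \<bullet> partial i (partial i \<pi>) x) - (real CARD('n) - real k)\<bar>
      \<le> C * ((norm (x - \<sigma>))\<^sup>2 + norm (x - \<pi> x))"
      unfolding pD F_def[symmetric] f_def[symmetric] X_def[symmetric] N_def[symmetric]
      using Cpos X f by (elim le_mult_weaken) (auto simp: C_def)
  next
    fix e :: "real^'n" and t assume e: "norm e = 1" "P e = 0" and t: "0 \<le> t" "t \<le> \<rho>"
    define x where "x = \<sigma> + t *\<^sub>R e"
    have "x \<in> cball \<sigma> r" using e t \<rho> by (simp add: x_def dist_norm)
    from C1(2)[OF \<sigma>r this] have "norm (\<pi> x - \<sigma> - P (t *\<^sub>R e)) \<le> C1 * t\<^sup>2"
      using e t by (simp add: fix_\<sigma> P(1) x_def)
    then have "norm (\<pi> x - \<sigma>) \<le> C1 * t\<^sup>2" by (simp add: linear_scale[OF P(2)] e)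
    also have "\<dots> \<le> t / 2"
    proof -
      have "C1 * t \<le> 1 / 2" using mult_left_mono[OF t(2) C1(1)] \<rho>'(3) by linarith
      from mult_right_mono[OF this t(1)] show ?thesis by (simp add: power2_eq_square)
    qed
    finally have "norm (\<pi> x - \<sigma>) \<le> t / 2" .
    moreover have "norm (x - \<sigma>) = t" using e t by (simp add: x_def)
    ultimately show "norm (\<sigma> + t *\<^sub>R e - \<pi> (\<sigma> + t *\<^sub>R e)) \<ge> t / 2"
      using norm_triangle_ineq2[of "x - \<sigma>" "\<pi> x - \<sigma>"] by (simp add: x_def[symmetric])
  qed
qed

text \<open>\<open>Y\<close> is a smooth substitute for the squared distance; it only needs to dominate it.\<close>

lemma local_distance_substitute:
  fixes \<Gamma> \<Omega> :: "(real^'n::finite) set"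
  assumes \<Gamma>: "smooth_submanifold \<Gamma> k" "\<sigma> \<in> \<Gamma>" "k < CARD('n)" and \<Omega>: "open \<Omega>" "\<Gamma> \<subseteq> \<Omega>"
    and q: "Ck_on 2 \<Omega> q" "\<forall>\<sigma>\<in>\<Gamma>. q \<sigma> \<le> 1" "q \<sigma> = 1"
  obtains r C Y Y1 Y2 e where "0 < r" "cball \<sigma> r \<subseteq> \<Omega>" "C \<ge> 0"
    "continuous_on (cball \<sigma> r) Y" "\<And>x. Y x \<ge> 0"
    "\<And>x. x \<in> cball \<sigma> r \<Longrightarrow> x \<in> \<Gamma> \<Longrightarrow> Y x = 0"
    "\<And>x i. x \<in> cball \<sigma> r \<Longrightarrow> ((\<lambda>s. Y (x + s *\<^sub>R axis i 1)) has_real_derivative Y1 i x) (at 0)"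
    "\<And>x i. x \<in> cball \<sigma> r \<Longrightarrow> ((\<lambda>s. Y1 i (x + s *\<^sub>R axis i 1)) has_real_derivative Y2 i x) (at 0)"
    "\<And>x. x \<in> cball \<sigma> r \<Longrightarrow> \<bar>(\<Sum>i\<in>UNIV. (Y1 i x)\<^sup>2) - 4 * Y x\<bar> \<le> C * (((norm (x - \<sigma>))\<^sup>2 + sqrt (Y x)) * Y x)"
    "\<And>x. x \<in> cball \<sigma> r \<Longrightarrow> \<bar>(\<Sum>i\<in>UNIV. Y2 i x) - 2 * (real CARD('n) - real k)\<bar> \<le> C * ((norm (x - \<sigma>))\<^sup>2 + sqrt (Y x))"
    "\<And>x. x \<in> cball \<sigma> r \<Longrightarrow> \<bar>\<Sum>i\<in>UNIV. Y1 i x * ((x - \<sigma>) $ i)\<bar>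
      \<le> C * (sqrt (Y x) * ((norm (x - \<sigma>))\<^sup>2 + sqrt (Y x)))"
    "\<And>x. x \<in> cball \<sigma> r \<Longrightarrow> (infdist x \<Gamma>)\<^sup>2 \<le> Y x"
    "\<And>x. x \<in> cball \<sigma> r \<Longrightarrow> q x \<ge> 1 - C * ((norm (x - \<sigma>))\<^sup>2 + sqrt (Y x))"
    "norm e = 1" "\<And>t. 0 \<le> t \<Longrightarrow> t \<le> r \<Longrightarrow> Y (\<sigma> + t *\<^sub>R e) \<ge> t\<^sup>2 / 4"
proof -
  obtain S \<pi> P where S: "open S" "\<sigma> \<in> S" "Ck_on 2 S \<pi>" and \<pi>: "\<And>x. x \<in> S \<Longrightarrow> \<pi> x \<in> \<Gamma>"
    "\<And>x. x \<in> S \<Longrightarrow> x \<in> \<Gamma> \<Longrightarrow> \<pi> x = x" and P: "frechet_derivative \<pi> (at \<sigma>) = P" "linear P"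
    "\<And>x. P (P x) = P x" "\<And>x y. P x \<bullet> y = x \<bullet> P y" "(\<Sum>i\<in>UNIV. axis i 1 \<bullet> P (axis i 1)) = real k"
    and ex: "k < CARD('n) \<Longrightarrow> \<exists>e. norm e = 1 \<and> P e = 0"
    by (rule local_retraction[OF \<Gamma>(1,2)]) (rule that)
  obtain e where e: "norm e = 1" "P e = 0" using ex \<Gamma>(3) by blast
  have "open (S \<inter> \<Omega>)" "\<sigma> \<in> S \<inter> \<Omega>" using S \<Omega> \<Gamma> by auto
  then obtain r1 where r1: "r1 > 0" "cball \<sigma> r1 \<subseteq> S \<inter> \<Omega>" using open_contains_cball by blast
  then have r1S: "cball \<sigma> r1 \<subseteq> S" and r1\<Omega>: "cball \<sigma> r1 \<subseteq> \<Omega>" by auto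
  have idem: "\<pi> (\<pi> x) = \<pi> x" if "x \<in> S" "\<pi> x \<in> S" for x using \<pi> that by blast
  obtain C1 r where C1: "C1 \<ge> 0" and r: "0 < r" "r \<le> r1"
    and E: "\<And>x. x \<in> cball \<sigma> r \<Longrightarrow> \<pi> x \<in> cball \<sigma> r1"
    "\<And>x. x \<in> cball \<sigma> r \<Longrightarrow> \<bar>(\<Sum>i\<in>UNIV. ((x - \<pi> x) \<bullet> (axis i 1 - partial i \<pi> x))\<^sup>2) - (norm (x - \<pi> x))\<^sup>2\<bar>
      \<le> C1 * (((norm (x - \<sigma>))\<^sup>2 + norm (x - \<pi> x)) * (norm (x - \<pi> x))\<^sup>2)"
    "\<And>x. x \<in> cball \<sigma> r \<Longrightarrow> \<bar>(\<Sum>i\<in>UNIV. (norm (axis i 1 - partial i \<pi> x))\<^sup>2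
        - (x - \<pi> x) \<bullet> partial i (partial i \<pi>) x) - (real CARD('n) - real k)\<bar>
      \<le> C1 * ((norm (x - \<sigma>))\<^sup>2 + norm (x - \<pi> x))"
    "\<And>x. x \<in> cball \<sigma> r \<Longrightarrow> \<bar>\<Sum>i\<in>UNIV. ((x - \<pi> x) \<bullet> (axis i 1 - partial i \<pi> x)) * ((x - \<sigma>) $ i)\<bar>
      \<le> C1 * (norm (x - \<pi> x) * ((norm (x - \<sigma>))\<^sup>2 + norm (x - \<pi> x)))"
    "\<And>e t. norm e = 1 \<Longrightarrow> P e = 0 \<Longrightarrow> 0 \<le> t \<Longrightarrow> t \<le> r \<Longrightarrow>
      norm (\<sigma> + t *\<^sub>R e - \<pi> (\<sigma> + t *\<^sub>R e)) \<ge> t / 2"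
    by (rule retraction_estimates[OF S(1,3) r1S r1(1) idem \<pi>(2)[OF S(2) \<Gamma>(2)] P], assumption, assumption) (rule that)
  have rS: "cball \<sigma> r \<subseteq> S" and r\<Omega>: "cball \<sigma> r \<subseteq> \<Omega>" using r1S r1\<Omega> r(2) by (auto simp: subset_iff)
  have ck1: "Ck_on 1 S \<pi>" "\<And>i. Ck_on 1 S (partial i \<pi>)"
    using S(3) by (simp_all add: numeral_2_eq_2)
  obtain C2 where C2: "C2 \<ge> 0" "\<And>x y. x \<in> cball \<sigma> r1 \<Longrightarrow> y \<in> cball \<sigma> r1 \<Longrightarrow> norm (q x - q y) \<le> C2 * norm (x - y)"
    using Ck_on_lipschitz[OF _ r1\<Omega>, of q] Ck_on_mono[OF q(1), of 1] by auto
  have ckq: "Ck_on 2 S (\<lambda>x. q (\<pi> x))"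
    by (rule Ck_on_compose[OF S(1) \<Omega>(1) _ S(3) q(1)]) (use \<pi>(1) \<Omega>(2) in auto)
  obtain C3 where C3: "C3 \<ge> 0"
    "\<And>x y. x \<in> cball \<sigma> r1 \<Longrightarrow> y \<in> cball \<sigma> r1 \<Longrightarrow>
      norm (q (\<pi> y) - q (\<pi> x) - frechet_derivative (\<lambda>x. q (\<pi> x)) (at x) (y - x)) \<le> C3 * (norm (y - x))\<^sup>2"
    by (rule Ck_on_taylor2[OF ckq r1S]) (rule that)
  \<comment> \<open>A maximum of q along \<Gamma> is a constrained one. Composition with the
    retraction makes it a free maximum at \<sigma>, so the differential vanishes and q (\<pi> x)
    differs from 1 only at second order.\<close>
  have grad0: "frechet_derivative (\<lambda>x. q (\<pi> x)) (at \<sigma>) = (\<lambda>v. 0)"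
  proof (rule differential_zero_maxmin[OF S(2,1)])
    have "Ck_on 1 S (\<lambda>x. q (\<pi> x))" using Ck_on_mono[OF ckq, of 1] by simp
    then show "((\<lambda>x. q (\<pi> x)) has_derivative frechet_derivative (\<lambda>x. q (\<pi> x)) (at \<sigma>)) (at \<sigma>)"
      using S(2) by (simp add: frechet_derivative_works[symmetric])
    show "(\<forall>y\<in>S. q (\<pi> y) \<le> q (\<pi> \<sigma>)) \<or> (\<forall>y\<in>S. q (\<pi> \<sigma>) \<le> q (\<pi> y))"
      using \<pi> q(2,3) S(2) \<Gamma>(2) by auto
  qed
  define Y where "Y x = (x - \<pi> x) \<bullet> (x - \<pi> x)" for x
  define Y1 where "Y1 i x = 2 * ((x - \<pi> x) \<bullet> (axis i 1 - partial i \<pi> x))" for i x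
  define Y2 where "Y2 i x = 2 * ((norm (axis i 1 - partial i \<pi> x))\<^sup>2 - (x - \<pi> x) \<bullet> partial i (partial i \<pi>) x)" for i x
  have sY: "sqrt (Y x) = norm (x - \<pi> x)" "Y x = (norm (x - \<pi> x))\<^sup>2" for x
    by (simp_all add: Y_def norm_eq_sqrt_inner)
  have pF: "partial i (\<lambda>x. x - \<pi> x) x = axis i 1 - partial i \<pi> x" if "x \<in> S" for i x
  proof -
    have "(\<pi> has_derivative frechet_derivative \<pi> (at x)) (at x)"
      using ck1(1) that by (simp add: frechet_derivative_works[symmetric])
    from partial_eqI[OF has_derivative_diff[OF has_derivative_ident this], of i]
    show ?thesis by (simp add: partial_def)
  qed
  have dF: "(\<lambda>x. x - \<pi> x) differentiable at x" if "x \<in> S" for x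
    using ck1(1) that by (intro differentiable_diff) auto
  have dG: "(\<lambda>x. axis i 1 - partial i \<pi> x) differentiable at x" if "x \<in> S" for x i
    using ck1(2)[of i] that by (intro differentiable_diff) auto
  have pG: "partial i (\<lambda>x. axis i 1 - partial i \<pi> x) x = - partial i (partial i \<pi>) x" if "x \<in> S" for i x
  proof -
    have "(partial i \<pi> has_derivative frechet_derivative (partial i \<pi>) (at x)) (at x)"
      using ck1(2)[of i] that by (simp add: frechet_derivative_works[symmetric])
    from partial_eqI[OF has_derivative_diff[OF has_derivative_const this], of i]
    show ?thesis by (simp add: partial_def[of i "partial i \<pi>"])
  qed
  define C where "C = 4 * C1 + C2 + C3"
  have CC: "C \<ge> 0" "4 * C1 \<le> C" "2 * C1 \<le> C" "C2 \<le> C" "C3 \<le> C" using C1 C2 C3 by (auto simp: C_def)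
  show ?thesis
  proof (rule that[of r C Y Y1 Y2 e])
    show "0 < r" "cball \<sigma> r \<subseteq> \<Omega>" "C \<ge> 0" "norm e = 1" by fact+
    show "continuous_on (cball \<sigma> r) Y"
      unfolding Y_def using continuous_on_subset[OF Ck_on_imp_continuous_on[OF S(3)] rS]
      by (intro continuous_intros)
    show "Y x \<ge> 0" for x by (simp add: Y_def)
    show "Y (\<sigma> + t *\<^sub>R e) \<ge> t\<^sup>2 / 4" if "0 \<le> t" "t \<le> r" for t
      using power_mono[OF E(5)[OF e that], of 2] that unfolding sY(2) by (simp add: power_divide)
  next
    fix x assume x: "x \<in> cball \<sigma> r"
    then have xS: "x \<in> S" using rS by auto
    define X where "X = (norm (x - \<sigma>))\<^sup>2"
    define f where "f = norm (x - \<pi> x)"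
    have Xf: "X \<ge> 0" "f \<ge> 0" by (auto simp: X_def f_def)
    show "Y x = 0" if "x \<in> \<Gamma>" using \<pi>(2)[OF xS that] by (simp add: Y_def)
    show "((\<lambda>s. Y (x + s *\<^sub>R axis i 1)) has_real_derivative Y1 i x) (at 0)" for i
      using has_real_derivative_line[OF dF[OF xS] dF[OF xS], of i]
      by (simp add: Y_def Y1_def pF[OF xS] inner_commute)
    show "((\<lambda>s. Y1 i (x + s *\<^sub>R axis i 1)) has_real_derivative Y2 i x) (at 0)" for i
      using DERIV_cmult[OF has_real_derivative_line[OF dF[OF xS] dG[OF xS, of i], of i], of 2]
      by (simp add: Y1_def Y2_def pF[OF xS] pG[OF xS] power2_norm_eq_inner)
    have "(\<Sum>i\<in>UNIV. (Y1 i x)\<^sup>2) - 4 * Y x = 4 * ((\<Sum>i\<in>UNIV. ((x - \<pi> x) \<bullet> (axis i 1 - partial i \<pi> x))\<^sup>2) - (norm (x - \<pi> x))\<^sup>2)"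
      by (simp add: Y1_def sY(2) power_mult_distrib sum_distrib_left)
    then have "\<bar>(\<Sum>i\<in>UNIV. (Y1 i x)\<^sup>2) - 4 * Y x\<bar> \<le> 4 * C1 * (((norm (x - \<sigma>))\<^sup>2 + norm (x - \<pi> x)) * (norm (x - \<pi> x))\<^sup>2)"
      using E(2)[OF x] by (simp add: abs_mult)
    then show "\<bar>(\<Sum>i\<in>UNIV. (Y1 i x)\<^sup>2) - 4 * Y x\<bar> \<le> C * (((norm (x - \<sigma>))\<^sup>2 + sqrt (Y x)) * Y x)"
      unfolding sY(1) unfolding sY(2) by (rule le_mult_weaken) (use CC in auto)
    have "(\<Sum>i\<in>UNIV. Y2 i x) - 2 * (real CARD('n) - real k)
        = 2 * ((\<Sum>i\<in>UNIV. (norm (axis i 1 - partial i \<pi> x))\<^sup>2 - (x - \<pi> x) \<bullet> partial i (partial i \<pi>) x) - (real CARD('n) - real k))"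
      by (simp add: Y2_def sum_distrib_left)
    then have "\<bar>(\<Sum>i\<in>UNIV. Y2 i x) - 2 * (real CARD('n) - real k)\<bar> \<le> 2 * C1 * ((norm (x - \<sigma>))\<^sup>2 + norm (x - \<pi> x))"
      using E(3)[OF x] by (simp add: abs_mult)
    then show "\<bar>(\<Sum>i\<in>UNIV. Y2 i x) - 2 * (real CARD('n) - real k)\<bar> \<le> C * ((norm (x - \<sigma>))\<^sup>2 + sqrt (Y x))"
      unfolding sY(1) unfolding sY(2) by (rule le_mult_weaken) (use CC in auto)
    have "(\<Sum>i\<in>UNIV. Y1 i x * ((x - \<sigma>) $ i)) = 2 * (\<Sum>i\<in>UNIV. ((x - \<pi> x) \<bullet> (axis i 1 - partial i \<pi> x)) * ((x - \<sigma>) $ i))"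
      by (simp add: Y1_def sum_distrib_left mult.assoc)
    then have "\<bar>\<Sum>i\<in>UNIV. Y1 i x * ((x - \<sigma>) $ i)\<bar> \<le> 2 * C1 * (norm (x - \<pi> x) * ((norm (x - \<sigma>))\<^sup>2 + norm (x - \<pi> x)))"
      using E(4)[OF x] by (simp add: abs_mult)
    then show "\<bar>\<Sum>i\<in>UNIV. Y1 i x * ((x - \<sigma>) $ i)\<bar> \<le> C * (sqrt (Y x) * ((norm (x - \<sigma>))\<^sup>2 + sqrt (Y x)))"
      unfolding sY(1) by (rule le_mult_weaken) (use CC in auto)
    have "infdist x \<Gamma> \<le> norm (x - \<pi> x)" using infdist_le[OF \<pi>(1)[OF xS], of x] by (simp add: dist_norm)
    then show "(infdist x \<Gamma>)\<^sup>2 \<le> Y x" unfolding sY(2) by (intro power_mono infdist_nonneg)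
    have xr: "x \<in> cball \<sigma> r1" "\<sigma> \<in> cball \<sigma> r1" using x r r1 by auto
    have "\<bar>q x - q (\<pi> x)\<bar> \<le> C2 * f" using C2(2)[OF xr(1) E(1)[OF x]] by (simp add: f_def)
    moreover have "\<bar>q (\<pi> x) - 1\<bar> \<le> C3 * X"
      using C3(2)[OF xr(2,1)] \<pi>(2)[OF S(2) \<Gamma>(2)] q(3) by (simp add: grad0 X_def)
    moreover have "C2 * f \<le> C * f" "C3 * X \<le> C * X" using CC Xf by (auto intro!: mult_right_mono)
    ultimately show "q x \<ge> 1 - C * ((norm (x - \<sigma>))\<^sup>2 + sqrt (Y x))"
      unfolding sY(1) X_def[symmetric] f_def[symmetric] by (simp add: distrib_left)
  qed
qed

section \<open>Radial mollifiers\<close>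

text \<open>In the variable s = 1 / t the derivative of poly p s * exp (- s) with respect to t is
  s^2 (p - p') at s times exp (- s). So \<open>bump n\<close> is the n-th derivative of exp (- 1 /
  t), extended by 0 to t \<le> 0.\<close>

primrec bump_poly :: "nat \<Rightarrow> real poly" where
  "bump_poly 0 = 1"
| "bump_poly (Suc n) = [:0, 0, 1:] * (bump_poly n - pderiv (bump_poly n))"

definition bump :: "nat \<Rightarrow> real \<Rightarrow> real" where
  "bump n t = (if t \<le> 0 then 0 else poly (bump_poly n) (1 / t) * exp (- (1 / t)))"

lemma bump_nonpos [simp]: "t \<le> 0 \<Longrightarrow> bump n t = 0"
  by (simp add: bump_def)

lemma bump_0_pos: "t > 0 \<Longrightarrow> bump 0 t > 0"
  by (simp add: bump_def)

lemma bump_1_pos: "t > 0 \<Longrightarrow> bump 1 t > 0"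
  by (simp add: bump_def)

lemma tendsto_poly_exp_minus:
  fixes p :: "real poly"
  shows "((\<lambda>x. poly p x * exp (- x)) \<longlongrightarrow> 0) at_top"
proof -
  have "((\<lambda>x. \<Sum>i\<le>degree p. coeff p i * (x ^ i / exp x)) \<longlongrightarrow> (\<Sum>i\<le>degree p. coeff p i * 0)) at_top"
    by (intro tendsto_sum tendsto_mult tendsto_const tendsto_power_div_exp_0)
  moreover have "(\<Sum>i\<le>degree p. coeff p i * (x ^ i / exp x)) = poly p x * exp (- x)" for x
    by (simp add: poly_altdef exp_minus sum_distrib_right divide_inverse mult.assoc)
  ultimately show ?thesis by simp
qed

lemma bump_has_derivative: "(bump n has_real_derivative bump (Suc n) t) (at t)"
proof -
  consider "t < 0" | "t > 0" | "t = 0" by linarith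
  then show ?thesis
  proof cases
    case 1
    have "((\<lambda>t. 0) has_real_derivative 0) (at t)" by simp
    then have "(bump n has_real_derivative 0) (at t)"
      by (rule has_field_derivative_transform_within_open[of _ _ _ "{..<0}"]) (use 1 in auto)
    then show ?thesis using 1 by simp
  next
    case 2
    have "((\<lambda>t. poly (bump_poly n) (1 / t) * exp (- (1 / t))) has_real_derivative bump (Suc n) t) (at t)"
      using 2 by (auto intro!: derivative_eq_intros DERIV_chain2[OF poly_DERIV]
          simp: bump_def field_simps power2_eq_square)
    then show ?thesis
      by (rule has_field_derivative_transform_within_open[of _ _ _ "{0<..}"]) (use 2 in \<open>auto simp: bump_def\<close>)
  next
    case 3
    \<comment> \<open>Dividing by h multiplies the polynomial in 1 / h by its variable, which is
      \<open>pCons 0\<close>; the quotient keeps its form and the exponential wins.\<close>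
    have "((\<lambda>h. bump n h / h) \<longlongrightarrow> 0) (at_right 0)"
    proof (rule Lim_transform_eventually)
      have "((\<lambda>h::real. poly (pCons 0 (bump_poly n)) (inverse h) * exp (- inverse h)) \<longlongrightarrow> 0) (at_right 0)"
        by (rule filterlim_compose[OF tendsto_poly_exp_minus filterlim_inverse_at_top_right])
      then show "((\<lambda>h::real. poly (pCons 0 (bump_poly n)) (1 / h) * exp (- (1 / h))) \<longlongrightarrow> 0) (at_right 0)"
        by (simp add: inverse_eq_divide)
      show "\<forall>\<^sub>F h in at_right (0::real). poly (pCons 0 (bump_poly n)) (1 / h) * exp (- (1 / h)) = bump n h / h"
        by (auto simp: eventually_at_filter bump_def)
    qed
    moreover have "((\<lambda>h. bump n h / h) \<longlongrightarrow> 0) (at_left 0)"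
      by (rule Lim_transform_eventually[of "\<lambda>h. 0"]) (auto simp: eventually_at_filter)
    ultimately have "((\<lambda>h. bump n h / h) \<longlongrightarrow> 0) (at 0)"
      using filterlim_split_at by blast
    then show ?thesis using 3 by (simp add: has_field_derivative_iff)
  qed
qed

lemma continuous_on_bump: "continuous_on S (bump n)"
  by (intro continuous_at_imp_continuous_on ballI DERIV_isCont[OF bump_has_derivative])

lemma bump_bounded:
  obtains B where "B > 0" "\<And>t. t \<le> 1 \<Longrightarrow> \<bar>bump n t\<bar> \<le> B"
proof -
  have "bounded (bump n ` {0..1})"
    by (intro compact_imp_bounded compact_continuous_image continuous_on_bump) auto
  then obtain B where B: "B > 0" "\<And>t. t \<in> {0..1} \<Longrightarrow> \<bar>bump n t\<bar> \<le> B"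
    by (auto simp: bounded_pos)
  show ?thesis by (rule that[of B]) (use B in \<open>auto, metis abs_zero atLeastAtMost_iff bump_nonpos le_cases less_imp_le\<close>)
qed

text \<open>One application of l'Hopital leaves the symmetric difference quotient of f', which
  converges by the definition of the derivative of f' at 0. Second differentiability is thus asked
  for at the single point 0.\<close>

lemma second_difference_tendsto:
  fixes f f' :: "real \<Rightarrow> real"
  assumes "\<forall>\<^sub>F s in nhds 0. (f has_real_derivative f' s) (at s)"
    and f'': "(f' has_real_derivative f'') (at 0)"
  shows "((\<lambda>h. (f h + f (- h) - 2 * f 0) / h\<^sup>2) \<longlongrightarrow> f'') (at 0)"
proof -
  obtain d where d: "d > 0" "\<And>s. \<bar>s\<bar> < d \<Longrightarrow> (f has_real_derivative f' s) (at s)"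
    using assms(1) by (auto simp: eventually_nhds_metric dist_real_def)
  have ev: "\<forall>\<^sub>F s in at 0. \<bar>s\<bar> < d \<and> s \<noteq> 0"
    using d(1) by (auto simp: eventually_at dist_real_def)
  have cf: "isCont f 0" using d(2)[of 0] d(1) DERIV_isCont[of f "f' 0" 0] by simp
  show ?thesis
  proof (rule lhopital[where f' = "\<lambda>h. f' h - f' (- h)" and g' = "\<lambda>h. 2 * h"])
    have "((\<lambda>h. f (- h)) \<longlongrightarrow> f 0) (at 0)"
      by (rule isCont_tendsto_compose[OF cf]) (auto intro!: tendsto_eq_intros)
    then show "((\<lambda>h. f h + f (- h) - 2 * f 0) \<longlongrightarrow> 0) (at 0)"
      using cf unfolding isCont_def by (auto intro!: tendsto_eq_intros)
    show "((\<lambda>h::real. h\<^sup>2) \<longlongrightarrow> 0) (at 0)" by (auto intro!: tendsto_eq_intros)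
    show "\<forall>\<^sub>F h::real in at 0. h\<^sup>2 \<noteq> 0" "\<forall>\<^sub>F h::real in at 0. 2 * h \<noteq> 0"
      using ev by (auto elim: eventually_mono)
    show "\<forall>\<^sub>F h in at 0. ((\<lambda>h. f h + f (- h) - 2 * f 0) has_real_derivative f' h - f' (- h)) (at h)"
      using ev
    proof eventually_elim
      case (elim h)
      have "((\<lambda>h. f (- h)) has_real_derivative - f' (- h)) (at h)"
        using d(2)[of "- h"] elim by (simp add: DERIV_mirror)
      then show ?case using d(2)[of h] elim by (auto intro!: derivative_eq_intros)
    qed
    show "\<forall>\<^sub>F h in at 0. ((\<lambda>h. h\<^sup>2) has_real_derivative 2 * h) (at h)"
      by (auto intro!: derivative_eq_intros always_eventually)
    have t: "((\<lambda>h. (f' h - f' 0) / h) \<longlongrightarrow> f'') (at 0)" using f'' by (simp add: has_field_derivative_iff)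
    have "filterlim uminus (at (0::real)) (at 0)"
      by (auto simp: filterlim_at intro!: tendsto_eq_intros simp: eventually_at_filter)
    from filterlim_compose[OF t this]
    have "((\<lambda>h. (f' (- h) - f' 0) / (- h)) \<longlongrightarrow> f'') (at 0)" by simp
    from tendsto_add[OF t this]
    have "((\<lambda>h. ((f' h - f' 0) / h + (f' (- h) - f' 0) / (- h)) / 2) \<longlongrightarrow> (f'' + f'') / 2) (at 0)"
      by (intro tendsto_divide) auto
    moreover have "\<forall>\<^sub>F h in at 0. ((f' h - f' 0) / h + (f' (- h) - f' 0) / (- h)) / 2 = (f' h - f' (- h)) / (2 * h)"
      using ev by eventually_elim (auto simp: field_simps)
    ultimately show "((\<lambda>h. (f' h - f' (- h)) / (2 * h)) \<longlongrightarrow> f'') (at 0)"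
      using Lim_transform_eventually by fastforce
  qed
qed

text \<open>The constant does not depend on the step, so it dominates the difference quotients when
  a limit is taken under the integral. The mean value theorem is applied to f h + f (- h) and then
  to f'.\<close>

lemma second_difference_bound:
  fixes f f' f'' :: "real \<Rightarrow> real"
  assumes "\<And>s. (f has_real_derivative f' s) (at s)" "\<And>s. (f' has_real_derivative f'' s) (at s)"
    and "\<And>s. \<bar>f'' s\<bar> \<le> B"
  shows "\<bar>f h + f (- h) - 2 * f 0\<bar> \<le> 2 * B * h\<^sup>2"
proof -
  have B: "B \<ge> 0" using assms(3)[of 0] by linarith
  have *: "\<bar>f h + f (- h) - 2 * f 0\<bar> \<le> 2 * B * h\<^sup>2" if "h > 0" for h
  proof -
    have "((\<lambda>h. f h + f (- h)) has_real_derivative f' s - f' (- s)) (at s)" for s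
    proof -
      have "((\<lambda>h. f (- h)) has_real_derivative - f' (- s)) (at s)"
        using assms(1)[of "- s"] by (simp add: DERIV_mirror)
      from DERIV_add[OF assms(1)[of s] this] show ?thesis by simp
    qed
    from MVT2[OF that this] obtain z where z: "0 < z" "z < h"
      "f h + f (- h) - (f 0 + f (- 0)) = (h - 0) * (f' z - f' (- z))" by metis
    have "- z < z" using z by simp
    from MVT2[OF this assms(2)] obtain y where "f' z - f' (- z) = (z - - z) * f'' y" by metis
    then have "\<bar>f' z - f' (- z)\<bar> \<le> 2 * h * B"
      using z assms(3)[of y] B by (simp add: abs_mult mult_mono)
    then have "h * \<bar>f' z - f' (- z)\<bar> \<le> h * (2 * h * B)" using that by simp
    then show ?thesis using z that by (simp add: abs_mult power2_eq_square mult_ac)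
  qed
  show ?thesis using *[of h] *[of "- h"] by (cases h "0::real" rule: linorder_cases) (auto simp: add_ac)
qed

text \<open>The two kernels are \<open>moll 0\<close> and \<open>moll 1\<close>: the radius derivative of the normalised
  \<open>moll 1\<close> is a multiple of the Laplacian of \<open>moll 0\<close>.\<close>

definition moll :: "nat \<Rightarrow> real \<Rightarrow> real^'n::finite \<Rightarrow> real^'n \<Rightarrow> real" where
  "moll n r x y = bump n (1 - (norm (x - y))\<^sup>2 / r\<^sup>2)"

text \<open>The second derivative of \<open>moll n r x y\<close> along axis i, in x or equally in y:
  each derivative raises the index of the profile by one and brings out a factor from 1 - |x - y|^2
  / r^2.\<close>

definition moll2 :: "nat \<Rightarrow> real \<Rightarrow> 'n::finite \<Rightarrow> real^'n \<Rightarrow> real^'n \<Rightarrow> real" where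
  "moll2 n r i x y = 4 * ((x - y) $ i)\<^sup>2 / r ^ 4 * moll (n + 2) r x y - 2 / r\<^sup>2 * moll (n + 1) r x y"

lemma moll_zero: "r > 0 \<Longrightarrow> norm (x - y) \<ge> r \<Longrightarrow> moll n r x y = 0"
  unfolding moll_def by (rule bump_nonpos) (simp add: field_simps power_mono)

lemma moll2_zero: "r > 0 \<Longrightarrow> norm (x - y) \<ge> r \<Longrightarrow> moll2 n r i x y = 0"
  by (simp add: moll2_def moll_zero)

lemma moll_0_nonneg: "moll 0 r x y \<ge> 0"
  unfolding moll_def using bump_0_pos bump_nonpos by (metis le_cases less_eq_real_def not_le)

lemma moll_1_nonneg: "moll 1 r x y \<ge> 0"
  unfolding moll_def using bump_1_pos bump_nonpos by (metis le_cases less_eq_real_def not_le)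

lemma moll_1_pos: "norm (x - y) < r \<Longrightarrow> moll 1 r x y > 0"
  unfolding moll_def
  by (rule bump_1_pos) (smt (verit) divide_less_eq_1_pos norm_ge_zero power_strict_mono zero_less_power pos2)

lemma moll_commute: "moll n r x y = moll n r y x"
  by (simp add: moll_def norm_minus_commute)

lemma Ck_on_moll: "Ck_on k UNIV (\<lambda>y. moll n r (x::real^'n::finite) y)"
proof -
  have "Ck_on k UNIV (\<lambda>y::real^'n. x - y)"
    by (rule Ck_on_diff[OF open_UNIV Ck_on_const Ck_on_bounded_linear[OF bounded_linear_ident]])
  note Ck_on_inner[OF open_UNIV this this]
  then have "Ck_on k UNIV (\<lambda>y. 1 - ((x - y) \<bullet> (x - y)) * inverse (r\<^sup>2))"
    by (intro Ck_on_diff Ck_on_mult Ck_on_const open_UNIV)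
  from Ck_on_compose_real[OF open_UNIV this, of bump n] bump_has_derivative
  show ?thesis by (simp add: moll_def power2_norm_eq_inner divide_inverse)
qed

lemma continuous_on_moll: "continuous_on S (\<lambda>y. moll n r x y)"
  using Ck_on_imp_continuous_on[OF Ck_on_moll] continuous_on_subset by blast

lemma continuous_on_moll2: "continuous_on S (\<lambda>y. moll2 n r i x y)"
  unfolding moll2_def divide_inverse by (intro continuous_intros continuous_on_moll)

lemma moll_line_derivative:
  fixes x y :: "real^'n::finite"
  shows "((\<lambda>s. moll n r (x + s *\<^sub>R axis i 1) y) has_real_derivative
      - (2 * ((x + s *\<^sub>R axis i 1 - y) $ i) / r\<^sup>2 * moll (n + 1) r (x + s *\<^sub>R axis i 1) y)) (at s)"
proof -
  have e: "axis i (1::real) \<bullet> axis i 1 = 1" "z \<bullet> axis i (1::real) = z $ i" for z :: "real^'n"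
    by (auto simp: inner_axis)
  have "(norm (x + s *\<^sub>R axis i 1 - y))\<^sup>2 = (norm (x - y))\<^sup>2 + 2 * s * ((x - y) $ i) + s\<^sup>2" for s
  proof -
    have "x + s *\<^sub>R axis i 1 - y = (x - y) + s *\<^sub>R axis i 1" by simp
    then show ?thesis unfolding power2_norm_eq_inner
      by (simp only: inner_add_left inner_add_right inner_scaleR_left inner_scaleR_right e
          inner_commute[of "axis i 1" "x - y"]) (simp add: power2_eq_square algebra_simps)
  qed
  then have m: "moll n r (x + s *\<^sub>R axis i 1) y
      = bump n (1 - ((norm (x - y))\<^sup>2 + 2 * s * ((x - y) $ i) + s\<^sup>2) / r\<^sup>2)" for n s
    by (simp add: moll_def)
  have "((\<lambda>s. 1 - ((norm (x - y))\<^sup>2 + 2 * s * ((x - y) $ i) + s\<^sup>2) / r\<^sup>2) has_real_derivative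
       - (2 * ((x - y) $ i) + 2 * s) / r\<^sup>2) (at s)"
    unfolding divide_inverse by (auto intro!: derivative_eq_intros simp: algebra_simps)
  from DERIV_chain2[OF bump_has_derivative[of n] this]
  show ?thesis unfolding m by (rule DERIV_cong) (simp add: divide_simps algebra_simps)
qed

lemma moll_line_derivative2:
  fixes x y :: "real^'n::finite"
  assumes "r > 0"
  shows "((\<lambda>s. - (2 * ((x + s *\<^sub>R axis i 1 - y) $ i) / r\<^sup>2 * moll (n + 1) r (x + s *\<^sub>R axis i 1) y))
      has_real_derivative moll2 n r i (x + s *\<^sub>R axis i 1) y) (at s)"
proof -
  have "((\<lambda>s. - (2 * ((x + s *\<^sub>R axis i 1 - y) $ i) / r\<^sup>2)) has_real_derivative - (2 / r\<^sup>2)) (at s)"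
    using assms by (auto intro!: derivative_eq_intros simp: divide_simps)
  from DERIV_mult[OF this moll_line_derivative[of "n + 1" r x i y s]]
  have "((\<lambda>s. - (2 * ((x + s *\<^sub>R axis i 1 - y) $ i) / r\<^sup>2) * moll (n + 1) r (x + s *\<^sub>R axis i 1) y)
      has_real_derivative moll2 n r i (x + s *\<^sub>R axis i 1) y) (at s)"
    by (rule DERIV_cong) (use assms in \<open>simp add: moll2_def field_simps power2_eq_square numeral_eq_Suc\<close>)
  then show ?thesis by (simp only: minus_mult_left)
qed

lemma partial_eq_line_derivative:
  fixes f :: "real^'n::finite \<Rightarrow> real"
  assumes "f differentiable at x" "((\<lambda>s. f (x + s *\<^sub>R axis i 1)) has_real_derivative D) (at 0)"
  shows "partial i f x = D"
proof -
  have "((\<lambda>s. f (x + s *\<^sub>R axis i 1)) has_real_derivative partial i f x) (at 0)"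
    using Ck_on_has_derivative_line[of f x 0 i] assms(1) by (simp add: has_real_derivative_iff_has_vector_derivative)
  then show ?thesis using assms(2) DERIV_unique by blast
qed

lemma laplacian_moll:
  fixes x y :: "real^'n::finite"
  assumes "r > 0"
  shows "laplacian (\<lambda>y. moll n r x y) y = (\<Sum>i\<in>UNIV. moll2 n r i x y)"
proof -
  have p1: "partial i (\<lambda>y. moll n r x y) = (\<lambda>y. - (2 * ((y - x) $ i) / r\<^sup>2 * moll (n + 1) r y x))" for i
  proof
    fix y
    have "(\<lambda>y. moll n r x y) differentiable at y"
      using Ck_on_imp_differentiable[OF Ck_on_moll, of y] by simp
    then show "partial i (\<lambda>y. moll n r x y) y = - (2 * ((y - x) $ i) / r\<^sup>2 * moll (n + 1) r y x)"
      by (rule partial_eq_line_derivative)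
        (use moll_line_derivative[of n r y i x 0] in \<open>simp add: moll_commute[of n r x]\<close>)
  qed
  have "partial i (partial i (\<lambda>y. moll n r x y)) y = moll2 n r i x y" for i
  proof -
    have "partial i (\<lambda>y. moll n r x y) differentiable at y"
      by (rule Ck_on_imp_differentiable[OF Ck_on_partial[OF Ck_on_moll]]) simp
    then have "partial i (partial i (\<lambda>y. moll n r x y)) y = moll2 n r i y x"
      by (rule partial_eq_line_derivative)
        (use moll_line_derivative2[OF assms, of y i x n 0] in \<open>simp add: p1\<close>)
    also have "\<dots> = moll2 n r i x y"
      using power2_commute[of "y $ i" "x $ i"] by (simp add: moll2_def moll_commute)
    finally show ?thesis .
  qed
  then show ?thesis by (simp add: laplacian_def)
qed

lemma test_fun_moll:
  fixes x :: "real^'n::finite"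
  assumes "r > 0" "cball x r \<subseteq> S"
  shows "test_fun S (moll n r x)"
proof -
  have "{y. moll n r x y \<noteq> 0} \<subseteq> cball x r"
    using moll_zero[OF assms(1), of x] by (force simp: dist_norm)
  then have sub: "closure {y. moll n r x y \<noteq> 0} \<subseteq> cball x r" by (rule closure_minimal) simp
  then have "compact (closure {y. moll n r x y \<noteq> 0})"
    by (metis closed_closure compact_cball compact_Int_closed inf.absorb_iff2)
  moreover have "smooth_on UNIV (moll n r x)"
    unfolding smooth_on_def by (intro allI Ck_on_moll)
  ultimately show ?thesis unfolding test_fun_def using sub assms(2) by blast
qed

lemma moll_bounded:
  assumes "r0 > 0"
  obtains B where "B > 0" "\<And>r x y. r \<ge> r0 \<Longrightarrow> \<bar>moll n r x y\<bar> \<le> B"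
    "\<And>r i x y. r \<ge> r0 \<Longrightarrow> \<bar>moll2 n r i x y\<bar> \<le> B"
proof -
  obtain B where B: "B > 0" "\<And>t. t \<le> 1 \<Longrightarrow> \<bar>bump n t\<bar> \<le> B" using bump_bounded by blast
  obtain B1 where B1: "B1 > 0" "\<And>t. t \<le> 1 \<Longrightarrow> \<bar>bump (n+1) t\<bar> \<le> B1" using bump_bounded by blast
  obtain B2 where B2: "B2 > 0" "\<And>t. t \<le> 1 \<Longrightarrow> \<bar>bump (n+2) t\<bar> \<le> B2" using bump_bounded by blast
  define C where "C = B + 4 / r0\<^sup>2 * B2 + 2 / r0\<^sup>2 * B1"
  have C: "C > 0" "C \<ge> B" "C \<ge> 4 / r0\<^sup>2 * B2 + 2 / r0\<^sup>2 * B1"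
    using B B1 B2 assms by (auto simp: C_def intro!: add_pos_nonneg)
  have 1: "\<bar>moll n r x y\<bar> \<le> C" if "r \<ge> r0" for r x y
    using B(2)[of "1 - (norm (x - y))\<^sup>2 / r\<^sup>2"] C by (simp add: moll_def)
  have 2: "\<bar>moll2 n r i x y\<bar> \<le> C" if "r \<ge> r0" for r i x y
  proof (cases "norm (x - y) \<ge> r")
    case True
    then show ?thesis using moll2_zero[of r x y] C assms that by simp
  next
    case False
    have r: "r > 0" "r\<^sup>2 \<ge> r0\<^sup>2" using assms that by (auto intro!: power_mono)
    have "\<bar>(x - y) $ i\<bar> \<le> r" using component_le_norm_cart[of "x - y" i] False by linarith
    then have "((x - y) $ i)\<^sup>2 \<le> r\<^sup>2" using r(1) power_mono[of "\<bar>(x - y) $ i\<bar>" r 2] by simp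
    then have "4 * ((x - y) $ i)\<^sup>2 / r ^ 4 \<le> 4 * r\<^sup>2 / r ^ 4"
      by (intro divide_right_mono mult_left_mono) auto
    also have "\<dots> = 4 / r\<^sup>2"
      using r by (simp add: field_simps power2_eq_square numeral_eq_Suc)
    also have "\<dots> \<le> 4 / r0\<^sup>2" using r assms by (intro divide_left_mono) auto
    finally have a: "4 * ((x - y) $ i)\<^sup>2 / r ^ 4 \<le> 4 / r0\<^sup>2" .
    have b: "2 / r\<^sup>2 \<le> 2 / r0\<^sup>2" using r assms by (intro divide_left_mono) auto
    have "\<bar>moll2 n r i x y\<bar> \<le> \<bar>4 * ((x - y) $ i)\<^sup>2 / r ^ 4\<bar> * \<bar>moll (n + 2) r x y\<bar> + \<bar>2 / r\<^sup>2\<bar> * \<bar>moll (n + 1) r x y\<bar>"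
      unfolding moll2_def abs_mult[symmetric] by (rule abs_triangle_ineq4)
    also have "\<dots> \<le> 4 / r0\<^sup>2 * B2 + 2 / r0\<^sup>2 * B1"
      using a b B1(2)[of "1 - (norm (x - y))\<^sup>2 / r\<^sup>2"] B2(2)[of "1 - (norm (x - y))\<^sup>2 / r\<^sup>2"] B1(1) B2(1) r assms
      by (intro add_mono mult_mono) (auto simp: moll_def)
    finally show ?thesis using C by linarith
  qed
  show ?thesis using that[of C] C(1) 1 2 by blast
qed

lemma moll_second_difference:
  fixes x y :: "real^'n::finite"
  assumes "r > 0"
  shows "((\<lambda>h. (moll n r (x + h *\<^sub>R axis i 1) y + moll n r (x - h *\<^sub>R axis i 1) y - 2 * moll n r x y) / h\<^sup>2)
      \<longlongrightarrow> moll2 n r i x y) (at 0)"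
  using second_difference_tendsto[OF always_eventually[OF allI[OF moll_line_derivative]],
      OF moll_line_derivative2[OF assms, where s = 0 and n = n and x = x and y = y and i = i]] by simp

lemma moll_second_difference_bound:
  fixes x y :: "real^'n::finite"
  assumes "r > 0" "\<And>x y. \<bar>moll2 n r i x y\<bar> \<le> B"
  shows "\<bar>moll n r (x + h *\<^sub>R axis i 1) y + moll n r (x - h *\<^sub>R axis i 1) y - 2 * moll n r x y\<bar> \<le> 2 * B * h\<^sup>2"
  using second_difference_bound[OF moll_line_derivative[where n = n and r = r and x = x and y = y and i = i]
      moll_line_derivative2[OF assms(1)] assms(2), where h = h]
  by (simp add: algebra_simps)

text \<open>The profile of \<open>moll 1\<close> is the derivative of that of \<open>moll 0\<close>,
  and the factor r^N in the denominator produces exactly the term with \<open>bump 1\<close> in the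
  Laplacian. By this identity the sign of a distributional Laplacian tested with
  \<open>moll 0\<close> decides the monotonicity of averages in the radius.\<close>

lemma moll_radius_derivative:
  fixes x y :: "real^'n::finite"
  assumes "r > 0"
  shows "((\<lambda>r. moll 1 r x y / r ^ CARD('n)) has_real_derivative
     r / (2 * r ^ CARD('n)) * (\<Sum>i\<in>UNIV. moll2 0 r i x y)) (at r)"
proof -
  define d where "d = (norm (x - y))\<^sup>2"
  define N where "N = CARD('n)"
  have N: "N > 0" by (simp add: N_def)
  have d: "d = (\<Sum>i\<in>UNIV. ((x - y) $ i)\<^sup>2)"
    by (simp add: d_def norm_vec_def L2_set_def sum_nonneg)
  have s: "(\<Sum>i\<in>UNIV. moll2 0 r i x y) = 4 * d / r ^ 4 * bump 2 (1 - d / r\<^sup>2) - 2 * N / r\<^sup>2 * bump 1 (1 - d / r\<^sup>2)"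
  proof -
    have "(\<Sum>i\<in>UNIV. moll2 0 r i x y)
        = (\<Sum>i\<in>UNIV. ((x - y) $ i)\<^sup>2 * (4 / r ^ 4 * bump 2 (1 - d / r\<^sup>2)) - 2 / r\<^sup>2 * bump 1 (1 - d / r\<^sup>2))"
      unfolding moll2_def moll_def d_def by (intro sum.cong) (auto simp: numeral_2_eq_2)
    also have "\<dots> = d * (4 / r ^ 4 * bump 2 (1 - d / r\<^sup>2)) - N * (2 / r\<^sup>2 * bump 1 (1 - d / r\<^sup>2))"
      unfolding sum_subtractf sum_distrib_right[symmetric] d[symmetric] N_def by simp
    finally show ?thesis by (simp add: mult_ac)
  qed
  have "((\<lambda>r. 1 - d / r\<^sup>2) has_real_derivative 2 * d / r ^ 3) (at r)"
    using assms by (auto intro!: derivative_eq_intros simp: field_simps power2_eq_square numeral_eq_Suc)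
  from DERIV_chain2[OF bump_has_derivative[of 1] this]
  have 1: "((\<lambda>r. bump 1 (1 - d / r\<^sup>2)) has_real_derivative bump 2 (1 - d / r\<^sup>2) * (2 * d / r ^ 3)) (at r)"
    by (simp add: numeral_2_eq_2)
  have 2: "((\<lambda>r. r ^ N) has_real_derivative N * r ^ (N - 1)) (at r)"
    by (auto intro!: derivative_eq_intros)
  have "(bump 2 (1 - d / r\<^sup>2) * (2 * d / r ^ 3) * r ^ N - bump 1 (1 - d / r\<^sup>2) * (real N * r ^ (N - 1))) / (r ^ N * r ^ N)
     = r / (2 * r ^ N) * (4 * d / r ^ 4 * bump 2 (1 - d / r\<^sup>2) - 2 * N / r\<^sup>2 * bump 1 (1 - d / r\<^sup>2))"
  proof -
    define a where "a = r ^ (N - 1)"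
    define b1 b2 where "b1 = bump 1 (1 - d / r\<^sup>2)" and "b2 = bump 2 (1 - d / r\<^sup>2)"
    have a: "r ^ N = r * a" "a \<noteq> 0" using N assms by (auto simp: a_def power_Suc[symmetric])
    have "(b2 * (2 * d / r ^ 3) * (r * a) - b1 * (real N * a)) / (r * a * (r * a))
        = r / (2 * (r * a)) * (4 * d / r ^ 4 * b2 - 2 * N / r\<^sup>2 * b1)"
      using a(2) assms by (simp add: field_simps power2_eq_square power3_eq_cube power4_eq_xxxx)
    then show ?thesis unfolding a a_def[symmetric] b1_def b2_def .
  qed
  with DERIV_divide[OF 1 2] assms show ?thesis
    unfolding s moll_def d_def[symmetric] N_def[symmetric] by simp
qed

section \<open>Averages of weak supersolutions\<close>

text \<open>After scaling by a the claim is p z \<le> z powr p + p - 1, which is Young's inequality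
  with second factor 1.\<close>

lemma powr_ge_tangent:
  fixes a w p :: real
  assumes "a > 0" "w \<ge> 0" "p > 1"
  shows "w powr p \<ge> a powr p + p * a powr (p - 1) * (w - a)"
proof -
  define z where "z = w / a"
  have z: "z \<ge> 0" "w = a * z" unfolding z_def using assms by simp_all
  have ap: "a powr p = a powr (p - 1) * a" using assms by (simp add: powr_diff)
  show ?thesis
  proof (cases "w = 0")
    case True
    have "0 \<le> a powr p * (p - 1)" using assms by simp
    then show ?thesis using True assms by (simp add: ap algebra_simps)
  next
    case False
    then have z0: "z > 0" using z assms by (auto simp: less_le)
    have "p * (1 / p) = 1" using assms by simp
    then have zp: "(z powr p) powr (1 / p) = z" unfolding powr_powr using z(1) by simp
    have "(z powr p) powr (1 / p) * 1 powr (1 - 1 / p) \<le> (1 / p) * z powr p + (1 - 1 / p) * 1"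
      by (rule Youngs_inequality_0) (use assms z0 in auto)
    then have "z \<le> (1 / p) * z powr p + (1 - 1 / p)" using zp by simp
    then have "p * z \<le> p * ((1 / p) * z powr p + (1 - 1 / p))" using assms by (intro mult_left_mono) auto
    also have "\<dots> = z powr p + (p - 1)" using assms by (simp add: distrib_left right_diff_distrib)
    finally have "p * z \<le> z powr p + (p - 1)" .
    then have "a powr p * (p * z) \<le> a powr p * (z powr p + (p - 1))" by (intro mult_left_mono) auto
    moreover have "w powr p = a powr p * z powr p" using z assms by (simp add: powr_mult)
    ultimately show ?thesis unfolding z(2) using ap by (simp add: algebra_simps)
  qed
qed

lemma integrable_mult_compact:
  fixes w g :: "real^'n::finite \<Rightarrow> real"
  assumes C: "compact C" and w: "integrable lebesgue (\<lambda>y. indicator C y * w y)"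
    and g: "continuous_on C g" "\<And>y. y \<notin> C \<Longrightarrow> g y = 0"
  shows "integrable lebesgue (\<lambda>y. w y * g y)"
proof -
  have "bounded (g ` C)" by (intro compact_imp_bounded compact_continuous_image g C)
  then obtain B where B: "B > 0" "\<And>y. y \<in> C \<Longrightarrow> \<bar>g y\<bar> \<le> B" by (auto simp: bounded_pos)
  have "(\<lambda>y. indicator C y *\<^sub>R g y) \<in> borel_measurable borel"
    by (rule borel_measurable_continuous_on_indicator) (use g C in \<open>auto simp: compact_imp_closed\<close>)
  then have m: "(\<lambda>y. indicator C y * g y) \<in> borel_measurable lebesgue"
    by (simp add: measurable_completion)
  have e: "w y * g y = indicator C y * w y * (indicator C y * g y)" for y
    using g(2)[of y] by (simp add: indicator_def)
  show ?thesis
  proof (rule Bochner_Integration.integrable_bound)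
    show "integrable lebesgue (\<lambda>y. B * (indicator C y * w y))" using w by simp
    show "(\<lambda>y. w y * g y) \<in> borel_measurable lebesgue"
      unfolding e by (rule borel_measurable_times[OF borel_measurable_integrable[OF w] m])
    show "AE y in lebesgue. norm (w y * g y) \<le> norm (B * (indicator C y * w y))"
      using B g(2) by (intro AE_I2) (auto simp: indicator_def abs_mult mult.commute intro!: mult_right_mono)
  qed
qed

text \<open>All derivatives of averages, in the radius and in the centre, are limits of this kind.
  The conditions on the kernels are asked for eventually because supports stay in the compact set
  only for small increments.\<close>

lemma tendsto_integral_mult_compact:
  fixes w :: "real^'n::finite \<Rightarrow> real" and g :: "nat \<Rightarrow> real^'n \<Rightarrow> real"
  assumes C: "compact C" and w: "integrable lebesgue (\<lambda>y. indicator C y * w y)"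
    and g: "\<forall>\<^sub>F k in sequentially. continuous_on C (g k) \<and> (\<forall>y. \<bar>g k y\<bar> \<le> B) \<and> (\<forall>y. y \<notin> C \<longrightarrow> g k y = 0)"
    and G: "continuous_on C G" "\<And>y. y \<notin> C \<Longrightarrow> G y = 0"
    and lim: "\<And>y. (\<lambda>k. g k y) \<longlonglongrightarrow> G y"
  shows "(\<lambda>k. \<integral>y. w y * g k y \<partial>lebesgue) \<longlonglongrightarrow> (\<integral>y. w y * G y \<partial>lebesgue)"
proof -
  obtain n where n: "\<And>k. k \<ge> n \<Longrightarrow> continuous_on C (g k)" "\<And>k y. k \<ge> n \<Longrightarrow> \<bar>g k y\<bar> \<le> B"
    "\<And>k y. k \<ge> n \<Longrightarrow> y \<notin> C \<Longrightarrow> g k y = 0"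
    using g by (auto simp: eventually_sequentially)
  have "(\<lambda>k. \<integral>y. w y * g (k + n) y \<partial>lebesgue) \<longlonglongrightarrow> (\<integral>y. w y * G y \<partial>lebesgue)"
  proof (rule integral_dominated_convergence)
    show "integrable lebesgue (\<lambda>y. B * \<bar>indicator C y * w y\<bar>)" using w by simp
    show "(\<lambda>y. w y * G y) \<in> borel_measurable lebesgue"
      using integrable_mult_compact[OF C w G] by auto
    show "(\<lambda>y. w y * g (k + n) y) \<in> borel_measurable lebesgue" for k
      using integrable_mult_compact[OF C w n(1) n(3)] by auto
    show "AE y in lebesgue. (\<lambda>k. w y * g (k + n) y) \<longlonglongrightarrow> w y * G y"
      by (intro AE_I2 tendsto_mult tendsto_const LIMSEQ_ignore_initial_segment lim)
    show "AE y in lebesgue. norm (w y * g (k + n) y) \<le> B * \<bar>indicator C y * w y\<bar>" for k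
    proof (rule AE_I2)
      fix y
      show "norm (w y * g (k + n) y) \<le> B * \<bar>indicator C y * w y\<bar>"
        using n(2)[of "k + n" y] n(3)[of "k + n" y]
        by (cases "y \<in> C") (auto simp: abs_mult mult.commute[of "\<bar>w y\<bar>"] intro!: mult_right_mono)
    qed
  qed
  then show ?thesis by (rule LIMSEQ_offset)
qed

text \<open>The function w is nonnegative everywhere, while the sign of the given u is known only
  almost everywhere on the punctured domain. The manifold is visible only through the open set W and
  the continuous potential V.\<close>

locale weak_supersolution =
  fixes W :: "(real^'n::finite) set" and w V :: "real^'n \<Rightarrow> real" and p :: real
  assumes open_W: "open W"
    and w_nonneg: "w y \<ge> 0"
    and integrable_w: "compact C \<Longrightarrow> C \<subseteq> W \<Longrightarrow> integrable lebesgue (\<lambda>y. indicator C y * w y)"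
    and integrable_wp: "compact C \<Longrightarrow> C \<subseteq> W \<Longrightarrow> integrable lebesgue (\<lambda>y. indicator C y * w y powr p)"
    and V_nonneg: "y \<in> W \<Longrightarrow> V y \<ge> 0"
    and V_cont: "continuous_on W V"
    and p: "p > 1"
    and weak: "test_fun W \<phi> \<Longrightarrow> (\<And>y. \<phi> y \<ge> 0) \<Longrightarrow>
      (\<integral>y. w y powr p * \<phi> y \<partial>lebesgue) \<le> (\<integral>y. w y * (- laplacian \<phi> y - V y * \<phi> y) \<partial>lebesgue)"
begin

text \<open>Division by r^N gives the kernel the same mass for every radius, though not mass 1; the
  constant c of \<open>mean_supersolution\<close> accounts for this.\<close>

definition mean :: "real \<Rightarrow> real^'n \<Rightarrow> real" where
  "mean r x = (\<integral>y. w y * moll 1 r x y \<partial>lebesgue) / r ^ CARD('n)"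

lemma integrable_w_moll:
  assumes "r > 0" "cball x r \<subseteq> W"
  shows "integrable lebesgue (\<lambda>y. w y * moll n r x y)"
    "integrable lebesgue (\<lambda>y. w y powr p * moll n r x y)"
    "integrable lebesgue (\<lambda>y. w y * moll2 n r i x y)"
    "integrable lebesgue (\<lambda>y. w y * (V y * moll n r x y))"
proof -
  note I = integrable_w[OF compact_cball assms(2)] integrable_wp[OF compact_cball assms(2)]
  have z: "moll n r x y = 0" "moll2 n r i x y = 0" if "y \<notin> cball x r" for y
    using that moll_zero[OF assms(1), of x y] moll2_zero[OF assms(1), of x y] by (auto simp: dist_norm)
  have "continuous_on (cball x r) V" using V_cont assms(2) by (rule continuous_on_subset)
  then have "continuous_on (cball x r) (\<lambda>y. V y * moll n r x y)"
    by (intro continuous_on_mult continuous_on_moll)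
  then show "integrable lebesgue (\<lambda>y. w y * (V y * moll n r x y))"
    by (rule integrable_mult_compact[OF compact_cball I(1)]) (simp add: z)
  show "integrable lebesgue (\<lambda>y. w y * moll n r x y)"
    by (rule integrable_mult_compact[OF compact_cball I(1) continuous_on_moll z(1)])
  show "integrable lebesgue (\<lambda>y. w y powr p * moll n r x y)"
    by (rule integrable_mult_compact[OF compact_cball I(2) continuous_on_moll z(1)])
  show "integrable lebesgue (\<lambda>y. w y * moll2 n r i x y)"
    by (rule integrable_mult_compact[OF compact_cball I(1) continuous_on_moll2 z(2)])
qed

lemma mean_nonneg: "r > 0 \<Longrightarrow> mean r x \<ge> 0"
  unfolding mean_def by (intro divide_nonneg_pos integral_nonneg_AE AE_I2 mult_nonneg_nonneg w_nonneg moll_1_nonneg) auto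

text \<open>The kernel is itself the test function, and a replaces V on its support. The case n = 0
  serves the derivative in the radius, n = 1 the pointwise inequality for the averages; for both the
  profile is nonnegative.\<close>

lemma weak_moll:
  assumes r: "r > 0" "cball x r \<subseteq> W" and n: "n = 0 \<or> n = 1" and a: "\<And>y. y \<in> cball x r \<Longrightarrow> a \<le> V y"
  shows "(\<Sum>i\<in>UNIV. \<integral>y. w y * moll2 n r i x y \<partial>lebesgue)
      \<le> - a * (\<integral>y. w y * moll n r x y \<partial>lebesgue) - (\<integral>y. w y powr p * moll n r x y \<partial>lebesgue)"
proof -
  note I = integrable_w_moll[OF r]
  have m: "moll n r x y \<ge> 0" for y using n moll_0_nonneg[of r x y] moll_1_nonneg[of r x y] by auto
  have z: "moll n r x y = 0" if "y \<notin> cball x r" for y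
    using that moll_zero[OF r(1), of x y] by (auto simp: dist_norm)
  have "(\<integral>y. w y powr p * moll n r x y \<partial>lebesgue)
      \<le> (\<integral>y. w y * (- laplacian (\<lambda>y. moll n r x y) y - V y * moll n r x y) \<partial>lebesgue)"
    using weak[of "moll n r x"] test_fun_moll[OF r, of n] m by simp
  also have "\<dots> = (\<integral>y. - (\<Sum>i\<in>UNIV. w y * moll2 n r i x y) - w y * (V y * moll n r x y) \<partial>lebesgue)"
    by (simp add: laplacian_moll[OF r(1)] sum_distrib_left algebra_simps)
  also have "\<dots> = - (\<Sum>i\<in>UNIV. \<integral>y. w y * moll2 n r i x y \<partial>lebesgue) - (\<integral>y. w y * (V y * moll n r x y) \<partial>lebesgue)"
    by (simp add: I)
  finally have 1: "(\<integral>y. w y powr p * moll n r x y \<partial>lebesgue) \<le> \<dots>" .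
  have "(\<integral>y. a * (w y * moll n r x y) \<partial>lebesgue) \<le> (\<integral>y. w y * (V y * moll n r x y) \<partial>lebesgue)"
  proof (rule integral_mono)
    fix y
    show "a * (w y * moll n r x y) \<le> w y * (V y * moll n r x y)"
      using a[of y] z[of y] mult_right_mono[OF a[of y] mult_nonneg_nonneg[OF w_nonneg[of y] m[of y]]]
      by (cases "y \<in> cball x r") (auto simp: mult_ac)
  qed (use I in auto)
  with 1 show ?thesis by simp
qed

lemma cball_subset_W_enlarge:
  assumes "cball x r \<subseteq> W" "r > 0"
  obtains R where "R > r" "cball x R \<subseteq> W"
proof -
  have "(- W) \<inter> cball x r = {}" using assms by auto
  moreover have "closed (- W)" using open_W by (rule closed_Compl)
  ultimately obtain d where d: "d > 0" "\<And>y z. y \<in> cball x r \<Longrightarrow> z \<in> - W \<Longrightarrow> d \<le> dist y z"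
    using separate_compact_closed[of "cball x r" "- W"] by (metis compact_cball inf_commute)
  have "cball x (r + d / 2) \<subseteq> W"
  proof (rule ccontr)
    assume "\<not> cball x (r + d / 2) \<subseteq> W"
    then obtain z where z: "dist x z \<le> r + d / 2" "z \<notin> W" using mem_cball by blast
    define t where "t = r / (r + d / 2)"
    have t: "0 < t" "t < 1" using assms d(1) by (auto simp: t_def)
    define y where "y = x + t *\<^sub>R (z - x)"
    have "dist x y = t * dist x z" using t by (simp add: y_def dist_norm norm_minus_commute)
    also have "\<dots> \<le> t * (r + d / 2)" using z t by simp
    also have "\<dots> = r" using assms d(1) by (simp add: t_def)
    finally have y: "y \<in> cball x r" by simp
    have "y - z = - ((1 - t) *\<^sub>R (z - x))" by (simp add: y_def algebra_simps)
    then have "dist y z = (1 - t) * dist x z" using t by (simp add: dist_norm norm_minus_commute)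
    also have "\<dots> \<le> (1 - t) * (r + d / 2)" using z t by simp
    also have "\<dots> = d / 2" using assms d(1) by (simp add: t_def field_simps)
    finally show False using d(2)[OF y, of z] d(1) z(2) by simp
  qed
  then show ?thesis using that[of "r + d / 2"] d(1) by simp
qed

text \<open>Differentiation under the integral. The enlarged ball contains the supports of the
  kernels for all nearby radii, and the mean value theorem in the radius bounds the difference
  quotients.\<close>

lemma mean_has_derivative:
  assumes s: "s > 0" "cball x s \<subseteq> W"
  shows "((\<lambda>r. mean r x) has_real_derivative
    s / (2 * s ^ CARD('n)) * (\<Sum>i\<in>UNIV. \<integral>y. w y * moll2 0 s i x y \<partial>lebesgue)) (at s)"
proof -
  obtain R where R: "R > s" "cball x R \<subseteq> W" using cball_subset_W_enlarge[OF s(2,1)] by blast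
  define N where "N = CARD('n)"
  define D where "D t y = t / (2 * t ^ N) * (\<Sum>i\<in>UNIV. moll2 0 t i x y)" for t y
  obtain B where B: "B > 0" "\<And>t i y. t \<ge> s / 2 \<Longrightarrow> \<bar>moll2 0 t i x y\<bar> \<le> B"
    using moll_bounded[of "s / 2" 0] s(1) by (metis half_gt_zero)
  define B' where "B' = R / (2 * (s / 2) ^ N) * (N * B)"
  have D: "\<bar>D t y\<bar> \<le> B'" if "s / 2 \<le> t" "t \<le> R" for t y
  proof -
    have t: "t > 0" using that s by linarith
    have "\<bar>\<Sum>i\<in>UNIV. moll2 0 t i x y\<bar> \<le> (\<Sum>i\<in>(UNIV::'n set). B)"
      using B(2)[OF that(1)] by (intro order.trans[OF sum_abs] sum_mono)
    then have 1: "\<bar>\<Sum>i\<in>UNIV. moll2 0 t i x y\<bar> \<le> N * B" by (simp add: N_def)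
    have "t / (2 * t ^ N) \<le> R / (2 * (s / 2) ^ N)"
      using that t s by (intro frac_le mult_left_mono power_mono) auto
    then show ?thesis unfolding D_def B'_def abs_mult using 1 t s R by (intro mult_mono) auto
  qed
  have m: "((\<lambda>r. moll 1 r x y / r ^ N) has_real_derivative D t y) (at t)" if "t > 0" for t y
    unfolding D_def N_def by (rule moll_radius_derivative[OF that])
  have "((\<lambda>h. (mean (s + h) x - mean s x) / h) \<longlongrightarrow> (\<integral>y. w y * D s y \<partial>lebesgue)) (at 0)"
    unfolding tendsto_at_iff_sequentially comp_def
  proof (intro allI impI)
    fix h :: "nat \<Rightarrow> real"
    assume h0: "\<forall>k. h k \<in> UNIV - {0}" and h: "h \<longlonglongrightarrow> 0"
    define \<delta> where "\<delta> = min (s / 2) (R - s)"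
    have "\<delta> > 0" using s R by (simp add: \<delta>_def)
    then have ev: "\<forall>\<^sub>F k in sequentially. \<bar>h k\<bar> < \<delta>"
      using h by (auto simp: tendsto_iff dist_real_def)
    define g where "g k y = (moll 1 (s + h k) x y / (s + h k) ^ N - moll 1 s x y / s ^ N) / h k" for k y
    have "(\<lambda>k. \<integral>y. w y * g k y \<partial>lebesgue) \<longlonglongrightarrow> (\<integral>y. w y * D s y \<partial>lebesgue)"
    proof (rule tendsto_integral_mult_compact[OF compact_cball integrable_w[OF compact_cball R(2)]])
      show "\<forall>\<^sub>F k in sequentially. continuous_on (cball x R) (g k) \<and> (\<forall>y. \<bar>g k y\<bar> \<le> B') \<and> (\<forall>y. y \<notin> cball x R \<longrightarrow> g k y = 0)"
        using ev
      proof eventually_elim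
        case (elim k)
        then have k: "s / 2 < s + h k" "s + h k < R" "h k \<noteq> 0" using h0 by (auto simp: \<delta>_def)
        have "continuous_on (cball x R) (g k)"
          unfolding g_def divide_inverse by (intro continuous_intros continuous_on_moll)
        moreover have "g k y = 0" if "y \<notin> cball x R" for y
          using that moll_zero[of "s + h k" x y 1] moll_zero[of s x y 1] k s R by (simp add: g_def dist_norm)
        moreover have "\<bar>g k y\<bar> \<le> B'" for y
        proof -
          have "\<bar>moll 1 (s + h k) x y / (s + h k) ^ N - moll 1 s x y / s ^ N\<bar> \<le> B' * \<bar>s + h k - s\<bar>"
            unfolding real_norm_def[symmetric]
          proof (rule field_differentiable_bound[of "{s/2..R}" "\<lambda>r. moll 1 r x y / r ^ N" "\<lambda>t. D t y"])
            fix t assume "t \<in> {s/2..R}"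
            then show "((\<lambda>r. moll 1 r x y / r ^ N) has_real_derivative D t y) (at t within {s / 2..R})"
              "norm (D t y) \<le> B'"
              using m[of t y] D[of t y] s by (auto intro: has_field_derivative_at_within)
          qed (use k R s in auto)
          then show ?thesis using k by (simp add: g_def divide_simps)
        qed
        ultimately show ?case by blast
      qed
      show "continuous_on (cball x R) (D s)"
        unfolding D_def by (intro continuous_intros continuous_on_moll2)
      show "D s y = 0" if "y \<notin> cball x R" for y
        using that moll2_zero[of s x y 0] s R by (simp add: D_def dist_norm)
      show "(\<lambda>k. g k y) \<longlonglongrightarrow> D s y" for y
      proof -
        have "((\<lambda>h. (moll 1 (s + h) x y / (s + h) ^ N - moll 1 s x y / s ^ N) / h) \<longlongrightarrow> D s y) (at 0)"
          using m[OF s(1), of y] by (simp add: DERIV_def)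
        then show ?thesis unfolding g_def using h h0
          by (simp add: tendsto_at_iff_sequentially comp_def)
      qed
    qed
    moreover have "\<forall>\<^sub>F k in sequentially. (\<integral>y. w y * g k y \<partial>lebesgue) = (mean (s + h k) x - mean s x) / h k"
      using ev
    proof eventually_elim
      case (elim k)
      then have k: "0 < s + h k" "s + h k < R" "h k \<noteq> 0" using h0 s by (auto simp: \<delta>_def)
      have sub: "cball x (s + h k) \<subseteq> W" using R k by (meson less_imp_le order.trans subset_cball)
      have "(\<integral>y. w y * g k y \<partial>lebesgue)
          = (\<integral>y. (w y * moll 1 (s + h k) x y / (s + h k) ^ N - w y * moll 1 s x y / s ^ N) / h k \<partial>lebesgue)"
        by (simp add: g_def right_diff_distrib)
      also have "\<dots> = (mean (s + h k) x - mean s x) / h k"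
        using integrable_w_moll(1)[OF k(1) sub, of 1] integrable_w_moll(1)[OF s, of 1]
        by (simp add: mean_def N_def)
      finally show ?case .
    qed
    ultimately show "(\<lambda>k. (mean (s + h k) x - mean s x) / h k) \<longlonglongrightarrow> (\<integral>y. w y * D s y \<partial>lebesgue)"
      by (rule Lim_transform_eventually)
  qed
  moreover have "(\<integral>y. w y * D s y \<partial>lebesgue)
      = s / (2 * s ^ N) * (\<Sum>i\<in>UNIV. \<integral>y. w y * moll2 0 s i x y \<partial>lebesgue)"
  proof -
    have "(\<integral>y. w y * D s y \<partial>lebesgue) = (\<integral>y. s / (2 * s ^ N) * (\<Sum>i\<in>UNIV. w y * moll2 0 s i x y) \<partial>lebesgue)"
      by (intro Bochner_Integration.integral_cong refl)
        (simp only: D_def sum_distrib_left[symmetric] mult.left_commute[of "s / (2 * s ^ N)"])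
    then show ?thesis by (simp only: integral_mult_right_zero Bochner_Integration.integral_sum[OF integrable_w_moll(3)[OF s]])
  qed
  ultimately show ?thesis by (simp add: DERIV_def N_def)
qed

text \<open>Here V \<ge> 0 enters, through \<open>weak_moll\<close> with a = 0. A lower bound found
  at one radius holds at all smaller ones, so constants survive a later reduction of the
  radius.\<close>

lemma mean_antimono:
  assumes "0 < r" "r \<le> R" "cball x R \<subseteq> W"
  shows "mean R x \<le> mean r x"
proof (rule DERIV_nonpos_imp_nonincreasing[OF assms(2)])
  fix s assume s: "r \<le> s" "s \<le> R"
  have s0: "s > 0" "cball x s \<subseteq> W" using s assms by auto
  have "(\<Sum>i\<in>UNIV. \<integral>y. w y * moll2 0 s i x y \<partial>lebesgue)
      \<le> - 0 * (\<integral>y. w y * moll 0 s x y \<partial>lebesgue) - (\<integral>y. w y powr p * moll 0 s x y \<partial>lebesgue)"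
    by (rule weak_moll[OF s0]) (use s0 V_nonneg in auto)
  moreover have "(\<integral>y. w y powr p * moll 0 s x y \<partial>lebesgue) \<ge> 0"
    by (intro integral_nonneg_AE AE_I2 mult_nonneg_nonneg powr_ge_zero moll_0_nonneg)
  ultimately have "(\<Sum>i\<in>UNIV. \<integral>y. w y * moll2 0 s i x y \<partial>lebesgue) \<le> 0" by simp
  then show "\<exists>y. ((\<lambda>r. mean r x) has_real_derivative y) (at s) \<and> y \<le> 0"
    using s0(1) by (intro exI[of _ "s / (2 * s ^ CARD('n)) * (\<Sum>i\<in>UNIV. \<integral>y. w y * moll2 0 s i x y \<partial>lebesgue)"] conjI
        mean_has_derivative[OF s0] mult_nonneg_nonpos) auto
qed

text \<open>Second differences along the axes are what \<open>touching_comparison\<close> compares,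
  and the limits found here are the integrals whose sum \<open>mean_supersolution\<close>
  bounds.\<close>

lemma mean_second_difference:
  assumes r: "r > 0" "cball x r \<subseteq> W"
  shows "((\<lambda>h. (mean r (x + h *\<^sub>R axis i 1) + mean r (x - h *\<^sub>R axis i 1) - 2 * mean r x) / h\<^sup>2)
     \<longlongrightarrow> (\<integral>y. w y * moll2 1 r i x y \<partial>lebesgue) / r ^ CARD('n)) (at 0)"
  unfolding tendsto_at_iff_sequentially comp_def
proof (intro allI impI)
  fix h :: "nat \<Rightarrow> real"
  assume h0: "\<forall>k. h k \<in> UNIV - {0}" and h: "h \<longlonglongrightarrow> 0"
  obtain R where R: "R > r" "cball x R \<subseteq> W" using cball_subset_W_enlarge[OF r(2,1)] by blast
  define e :: "real^'n" where "e = axis i 1"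
  have e: "norm e = 1" by (simp add: e_def)
  obtain B where B: "B > 0" "\<And>x y :: real^'n. \<bar>moll2 1 r i x y\<bar> \<le> B" using moll_bounded[OF r(1)] by (metis order_refl)
  have ev: "\<forall>\<^sub>F k in sequentially. \<bar>h k\<bar> < R - r"
    using h R by (auto simp: tendsto_iff dist_real_def)
  define g where "g k y = (moll 1 r (x + h k *\<^sub>R e) y + moll 1 r (x - h k *\<^sub>R e) y - 2 * moll 1 r x y) / (h k)\<^sup>2" for k y
  have "(\<lambda>k. \<integral>y. w y * g k y \<partial>lebesgue) \<longlonglongrightarrow> (\<integral>y. w y * moll2 1 r i x y \<partial>lebesgue)"
  proof (rule tendsto_integral_mult_compact[OF compact_cball integrable_w[OF compact_cball R(2)]])
    show "\<forall>\<^sub>F k in sequentially. continuous_on (cball x R) (g k) \<and> (\<forall>y. \<bar>g k y\<bar> \<le> 2 * B) \<and> (\<forall>y. y \<notin> cball x R \<longrightarrow> g k y = 0)"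
      using ev
    proof eventually_elim
      case (elim k)
      have "continuous_on (cball x R) (g k)"
        unfolding g_def divide_inverse by (intro continuous_intros continuous_on_moll)
      moreover have "g k y = 0" if "y \<notin> cball x R" for y
      proof -
        have d: "norm (x - y) > R" using that by (simp add: dist_norm)
        have "norm (x - y) \<le> norm (x + h k *\<^sub>R e - y) + norm (h k *\<^sub>R e)"
          "norm (x - y) \<le> norm (x - h k *\<^sub>R e - y) + norm (h k *\<^sub>R e)"
          using norm_triangle_ineq4[of "x + h k *\<^sub>R e - y" "h k *\<^sub>R e"]
            norm_triangle_ineq[of "x - h k *\<^sub>R e - y" "h k *\<^sub>R e"] by simp_all
        then have "norm (x + h k *\<^sub>R e - y) \<ge> r" "norm (x - h k *\<^sub>R e - y) \<ge> r"
          using d elim e by auto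
        then have "moll 1 r (x + h k *\<^sub>R e) y = 0" "moll 1 r (x - h k *\<^sub>R e) y = 0" "moll 1 r x y = 0"
          using d R by (auto intro!: moll_zero[OF r(1)] simp del: One_nat_def)
        then show ?thesis by (simp add: g_def)
      qed
      moreover have "\<bar>g k y\<bar> \<le> 2 * B" for y
        using moll_second_difference_bound[OF r(1) B(2), of x "h k" y] h0
        by (simp add: g_def e_def abs_mult divide_le_eq)
      ultimately show ?case by blast
    qed
    show "continuous_on (cball x R) (moll2 1 r i x)" by (rule continuous_on_moll2)
    show "moll2 1 r i x y = 0" if "y \<notin> cball x R" for y
      using that moll2_zero[OF r(1), of x y] R by (simp add: dist_norm)
    show "(\<lambda>k. g k y) \<longlonglongrightarrow> moll2 1 r i x y" for y
      using moll_second_difference[OF r(1), of 1 x i y] h h0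
      unfolding g_def e_def by (simp add: tendsto_at_iff_sequentially comp_def)
  qed
  then have "(\<lambda>k. (\<integral>y. w y * g k y \<partial>lebesgue) / r ^ CARD('n))
      \<longlonglongrightarrow> (\<integral>y. w y * moll2 1 r i x y \<partial>lebesgue) / r ^ CARD('n)"
    by (intro tendsto_divide tendsto_const) (use r in auto)
  moreover have "\<forall>\<^sub>F k in sequentially. (\<integral>y. w y * g k y \<partial>lebesgue) / r ^ CARD('n)
      = (mean r (x + h k *\<^sub>R e) + mean r (x - h k *\<^sub>R e) - 2 * mean r x) / (h k)\<^sup>2"
    using ev
  proof eventually_elim
    case (elim k)
    have "cball (x + h k *\<^sub>R e) r \<subseteq> cball x R" "cball (x - h k *\<^sub>R e) r \<subseteq> cball x R"
      using elim e by (auto simp: cball_subset_cball_iff dist_norm)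
    then have "cball (x + h k *\<^sub>R e) r \<subseteq> W" "cball (x - h k *\<^sub>R e) r \<subseteq> W" using R by auto
    note I = integrable_w_moll(1)[OF r(1) this(1), of 1] integrable_w_moll(1)[OF r(1) this(2), of 1]
      integrable_w_moll(1)[OF r, of 1]
    have "(\<integral>y. w y * g k y \<partial>lebesgue)
        = (\<integral>y. (w y * moll 1 r (x + h k *\<^sub>R e) y + w y * moll 1 r (x - h k *\<^sub>R e) y - 2 * (w y * moll 1 r x y)) / (h k)\<^sup>2 \<partial>lebesgue)"
      by (simp add: g_def algebra_simps)
    also have "\<dots> = ((\<integral>y. w y * moll 1 r (x + h k *\<^sub>R e) y \<partial>lebesgue) + (\<integral>y. w y * moll 1 r (x - h k *\<^sub>R e) y \<partial>lebesgue)
        - 2 * (\<integral>y. w y * moll 1 r x y \<partial>lebesgue)) / (h k)\<^sup>2"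
      using I by simp
    finally show ?case
      using r(1) by (simp add: mean_def diff_divide_distrib add_divide_distrib divide_divide_eq_left mult.commute)
  qed
  ultimately show "(\<lambda>k. (mean r (x + h k *\<^sub>R axis i 1) + mean r (x - h k *\<^sub>R axis i 1) - 2 * mean r x) / (h k)\<^sup>2)
     \<longlonglongrightarrow> (\<integral>y. w y * moll2 1 r i x y \<partial>lebesgue) / r ^ CARD('n)"
    unfolding e_def by (rule Lim_transform_eventually)
qed

lemma mean_isCont:
  assumes r: "r > 0" "cball x r \<subseteq> W"
  shows "isCont (mean r) x"
  unfolding continuous_at_sequentially comp_def
proof (intro allI impI)
  fix z :: "nat \<Rightarrow> real^'n"
  assume z: "z \<longlonglongrightarrow> x"
  obtain R where R: "R > r" "cball x R \<subseteq> W" using cball_subset_W_enlarge[OF r(2,1)] by blast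
  obtain B where B: "B > 0" "\<And>x y :: real^'n. \<bar>moll 1 r x y\<bar> \<le> B" using moll_bounded[OF r(1)] by (metis order_refl)
  have ev: "\<forall>\<^sub>F k in sequentially. dist (z k) x < R - r" using z R by (auto simp: tendsto_iff)
  have "(\<lambda>k. \<integral>y. w y * moll 1 r (z k) y \<partial>lebesgue) \<longlonglongrightarrow> (\<integral>y. w y * moll 1 r x y \<partial>lebesgue)"
  proof (rule tendsto_integral_mult_compact[OF compact_cball integrable_w[OF compact_cball R(2)]])
    show "\<forall>\<^sub>F k in sequentially. continuous_on (cball x R) (moll 1 r (z k)) \<and> (\<forall>y. \<bar>moll 1 r (z k) y\<bar> \<le> B)
        \<and> (\<forall>y. y \<notin> cball x R \<longrightarrow> moll 1 r (z k) y = 0)"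
      using ev
    proof eventually_elim
      case (elim k)
      have "moll 1 r (z k) y = 0" if "y \<notin> cball x R" for y
      proof (rule moll_zero[OF r(1)])
        show "r \<le> norm (z k - y)"
          using that elim dist_triangle[of x y "z k"] by (simp add: dist_norm norm_minus_commute)
      qed
      then show ?case by (intro conjI allI impI B(2) continuous_on_moll)
    qed
    show "moll 1 r x y = 0" if "y \<notin> cball x R" for y
      using that moll_zero[OF r(1), of x y] R by (simp add: dist_norm)
    show "(\<lambda>k. moll 1 r (z k) y) \<longlonglongrightarrow> moll 1 r x y" for y
    proof -
      have "isCont (moll 1 r y) x"
        using continuous_on_moll[of UNIV 1 r y] by (simp add: continuous_on_eq_continuous_at)
      then show ?thesis using isCont_tendsto_compose[OF _ z] by (simp add: moll_commute[of _ _ _ y])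
    qed
  qed (rule continuous_on_moll)
  then show "(\<lambda>k. mean r (z k)) \<longlonglongrightarrow> mean r x"
    unfolding mean_def by (intro tendsto_divide tendsto_const) (use r in auto)
qed

text \<open>Only an upper bound for the mass of the kernel is used, so instead of Jensen's inequality
  the tangent line of \<open>w powr p\<close> at a suitable point is integrated.\<close>

lemma mean_supersolution:
  obtains c where "c > 0"
    "\<And>r x a. r > 0 \<Longrightarrow> cball x r \<subseteq> W \<Longrightarrow> (\<And>y. y \<in> cball x r \<Longrightarrow> a \<le> V y) \<Longrightarrow>
      (\<Sum>i\<in>UNIV. (\<integral>y. w y * moll2 1 r i x y \<partial>lebesgue) / r ^ CARD('n)) \<le> - a * mean r x - c * mean r x powr p"
proof -
  obtain B where B: "B > 0" "\<And>t. t \<le> 1 \<Longrightarrow> \<bar>bump 1 t\<bar> \<le> B" using bump_bounded by blast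
  \<comment> \<open>Bounds the mass of the normalised kernel: the profile is at most B on a ball
    whose volume is r^N times that of the unit ball.\<close>
  define C0 where "C0 = B * unit_ball_vol (real CARD('n))"
  have C0: "C0 > 0" using B by (simp add: C0_def)
  show ?thesis
  proof (rule that[of "C0 powr (1 - p)"])
    show "C0 powr (1 - p) > 0" using C0 by simp
    fix r x a assume r: "r > 0" "cball x r \<subseteq> W" and a: "\<And>y. y \<in> cball x r \<Longrightarrow> a \<le> V y"
    define N where "N = CARD('n)"
    have rN: "r ^ N > 0" using r by simp
    have z: "moll 1 r x y = 0" if "y \<notin> cball x r" for y
      using that moll_zero[OF r(1), of x y] by (auto simp: dist_norm)
    have im: "integrable lebesgue (moll 1 r x)"
    proof -
      have "integrable lebesgue (indicator (cball x r) :: real^'n \<Rightarrow> real)"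
        using lmeasurable_cball[of x r] fmeasurableD2[of "cball x r" lebesgue]
        by (auto simp: less_top[symmetric] intro!: integrable_real_indicator)
      then have "integrable lebesgue (\<lambda>y. indicator (cball x r) y * (1::real))" by simp
      from integrable_mult_compact[OF compact_cball this continuous_on_moll z] show ?thesis by simp
    qed
    have "(\<integral>y. moll 1 r x y \<partial>lebesgue) \<le> (\<integral>y. B * indicator (cball x r) y \<partial>lebesgue)"
    proof (rule integral_mono[OF im])
      show "integrable lebesgue (\<lambda>y. B * indicator (cball x r) y)"
        using lmeasurable_cball[of x r] fmeasurableD2[of "cball x r" lebesgue]
        by (auto simp: less_top[symmetric] intro!: integrable_real_indicator)
      fix y show "moll 1 r x y \<le> B * indicator (cball x r) y"
        using z[of y] B(2)[of "1 - (norm (x - y))\<^sup>2 / r\<^sup>2"]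
        by (cases "y \<in> cball x r") (auto simp: moll_def)
    qed
    also have "\<dots> = B * measure lebesgue (cball x r)" by simp
    also have "measure lebesgue (cball x r) = unit_ball_vol (real N) * r ^ N"
      using content_cball[of r x] r by (simp add: N_def)
    finally have mass: "(\<integral>y. moll 1 r x y \<partial>lebesgue) / r ^ N \<le> C0"
      using rN by (simp add: C0_def N_def divide_le_eq mult_ac)
    have mass0: "(\<integral>y. moll 1 r x y \<partial>lebesgue) / r ^ N \<ge> 0"
      using rN by (intro divide_nonneg_pos integral_nonneg_AE AE_I2 moll_1_nonneg)
    define U where "U = mean r x"
    have U: "U = (\<integral>y. w y * moll 1 r x y \<partial>lebesgue) / r ^ N" by (simp add: U_def mean_def N_def)
    have "C0 powr (1 - p) * U powr p \<le> (\<integral>y. w y powr p * moll 1 r x y \<partial>lebesgue) / r ^ N"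
    proof (cases "U = 0")
      case True
      then show ?thesis using p rN
        by (auto intro!: divide_nonneg_pos integral_nonneg_AE AE_I2 mult_nonneg_nonneg moll_1_nonneg simp del: One_nat_def)
    next
      case False
      then have U0: "U > 0" using mean_nonneg[OF r(1), of x] by (simp add: U_def)
      \<comment> \<open>The constant part of the tangent at A has the negative coefficient - (p - 1)
        A powr p, so there the mass may be replaced by its bound C0. With A * C0 = U the two
        contributions then combine to A powr (p - 1) * U.\<close>
      define A where "A = U / C0"
      have A: "A > 0" "A * C0 = U" using U0 C0 by (auto simp: A_def)
      note I = integrable_w_moll[OF r, of 1]
      have "(\<integral>y. (A powr p - p * A powr (p - 1) * A) * moll 1 r x y + p * A powr (p - 1) * (w y * moll 1 r x y) \<partial>lebesgue)
          \<le> (\<integral>y. w y powr p * moll 1 r x y \<partial>lebesgue)"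
      proof (rule integral_mono)
        fix y
        have "(A powr p + p * A powr (p - 1) * (w y - A)) * moll 1 r x y \<le> w y powr p * moll 1 r x y"
          by (intro mult_right_mono powr_ge_tangent A w_nonneg p moll_1_nonneg)
        then show "(A powr p - p * A powr (p - 1) * A) * moll 1 r x y + p * A powr (p - 1) * (w y * moll 1 r x y)
            \<le> w y powr p * moll 1 r x y"
          by (simp add: algebra_simps)
      qed (use I im in auto)
      also have "(\<integral>y. (A powr p - p * A powr (p - 1) * A) * moll 1 r x y + p * A powr (p - 1) * (w y * moll 1 r x y) \<partial>lebesgue)
         = (A powr p - p * A powr (p - 1) * A) * (\<integral>y. moll 1 r x y \<partial>lebesgue)
           + p * A powr (p - 1) * (\<integral>y. w y * moll 1 r x y \<partial>lebesgue)"
        using I im by simp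
      finally have le: "(A powr p - p * A powr (p - 1) * A) * (\<integral>y. moll 1 r x y \<partial>lebesgue)
           + p * A powr (p - 1) * (\<integral>y. w y * moll 1 r x y \<partial>lebesgue) \<le> (\<integral>y. w y powr p * moll 1 r x y \<partial>lebesgue)" .
      have "(A powr p - p * A powr (p - 1) * A) * ((\<integral>y. moll 1 r x y \<partial>lebesgue) / r ^ N) + p * A powr (p - 1) * U
          \<le> (\<integral>y. w y powr p * moll 1 r x y \<partial>lebesgue) / r ^ N"
        using divide_right_mono[OF le, of "r ^ N"] rN
        unfolding U by (simp add: add_divide_distrib)
      moreover have "A powr p - p * A powr (p - 1) * A = - ((p - 1) * A powr (p - 1) * A)"
      proof -
        have "A powr p = A powr (p - 1) * A" using A by (simp add: powr_diff)
        then show ?thesis by (simp add: algebra_simps)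
      qed
      moreover have "(p - 1) * A powr (p - 1) * A * ((\<integral>y. moll 1 r x y \<partial>lebesgue) / r ^ N)
          \<le> (p - 1) * A powr (p - 1) * A * C0"
        using mass A p by (intro mult_left_mono) auto
      moreover have "(p - 1) * A powr (p - 1) * A * C0 = (p - 1) * A powr (p - 1) * U"
        using A(2) by (metis mult.assoc)
      moreover have "C0 powr (1 - p) * U powr p = A powr (p - 1) * U"
      proof -
        have "U powr p = U powr (p - 1) * U" using U0 by (simp add: powr_diff)
        moreover have "A powr (p - 1) = U powr (p - 1) * C0 powr (1 - p)"
          using U0 C0 by (simp add: A_def powr_divide powr_minus_divide[symmetric] divide_powr_uminus minus_diff_eq[symmetric, of 1 p] del: minus_diff_eq)
        ultimately show ?thesis by simp
      qed
      ultimately show ?thesis by (simp add: algebra_simps)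
    qed
    moreover have "(\<Sum>i\<in>UNIV. \<integral>y. w y * moll2 1 r i x y \<partial>lebesgue) / r ^ N
       \<le> (- a * (\<integral>y. w y * moll 1 r x y \<partial>lebesgue) - (\<integral>y. w y powr p * moll 1 r x y \<partial>lebesgue)) / r ^ N"
      using weak_moll[OF r _ a, of 1] rN by (intro divide_right_mono) auto
    ultimately show "(\<Sum>i\<in>UNIV. (\<integral>y. w y * moll2 1 r i x y \<partial>lebesgue) / r ^ CARD('n))
        \<le> - a * mean r x - C0 powr (1 - p) * mean r x powr p"
      unfolding U_def[symmetric] N_def[symmetric] sum_divide_distrib[symmetric]
      unfolding U by (simp add: diff_divide_distrib)
  qed
qed

lemma mean_eq_0_imp:
  assumes "r > 0" "cball x r \<subseteq> W" "mean r x = 0"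
  shows "AE y in lebesgue. y \<in> ball x r \<longrightarrow> w y = 0"
proof -
  have "(\<integral>y. w y * moll 1 r x y \<partial>lebesgue) = 0" using assms by (simp add: mean_def)
  then have "AE y in lebesgue. w y * moll 1 r x y = 0"
    using integral_nonneg_eq_0_iff_AE[OF integrable_w_moll(1)[OF assms(1,2), of 1]]
      AE_I2[of lebesgue "\<lambda>y. 0 \<le> w y * moll 1 r x y"] mult_nonneg_nonneg[OF w_nonneg moll_1_nonneg[of r x]] by blast
  then show ?thesis
  proof eventually_elim
    case (elim y)
    then show ?case using moll_1_pos[of x y r] by (auto simp: dist_norm)
  qed
qed

text \<open>A strong minimum principle by an open-closed argument. The set \<open>Z\<close> of
  points near which w vanishes almost everywhere is open; so is its complement in W, because
  positivity of one average passes to nearby centres by continuity and to smaller radii by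
  monotonicity.\<close>

lemma mean_pos:
  assumes "connected W" "\<not> (AE y in lebesgue. y \<in> W \<longrightarrow> w y = 0)" and r: "r > 0" "cball x r \<subseteq> W"
  shows "mean r x > 0"
proof -
  define Z where "Z = {x. \<exists>r>0. ball x r \<subseteq> W \<and> (AE y in lebesgue. y \<in> ball x r \<longrightarrow> w y = 0)}"
  have "open Z"
    unfolding open_contains_ball
  proof
    fix x assume "x \<in> Z"
    then obtain r where r: "r > 0" "ball x r \<subseteq> W" "AE y in lebesgue. y \<in> ball x r \<longrightarrow> w y = 0"
      by (auto simp: Z_def)
    have "ball x (r / 2) \<subseteq> Z"
    proof
      fix z assume "z \<in> ball x (r / 2)"
      then have sub: "ball z (r / 2) \<subseteq> ball x r"
        by (smt (verit) dist_commute dist_triangle field_sum_of_halves mem_ball subsetI)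
      have "AE y in lebesgue. y \<in> ball z (r / 2) \<longrightarrow> w y = 0"
        using r(3) by eventually_elim (use sub in auto)
      then show "z \<in> Z" using r sub unfolding Z_def by (auto intro!: exI[of _ "r / 2"])
    qed
    then show "\<exists>e>0. ball x e \<subseteq> Z" using r(1) by (auto intro!: exI[of _ "r / 2"])
  qed
  have pos: "mean r x > 0" if "x \<notin> Z" "r > 0" "cball x r \<subseteq> W" for r x
  proof (rule ccontr)
    assume "\<not> mean r x > 0"
    then have "mean r x = 0" using mean_nonneg[OF that(2)] by (meson not_less order.antisym)
    then have "x \<in> Z" using mean_eq_0_imp that ball_subset_cball unfolding Z_def by blast
    then show False using that by simp
  qed
  have "open (W - Z)"
    unfolding open_contains_ball
  proof
    fix x assume x: "x \<in> W - Z"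
    then obtain R where R: "R > 0" "cball x R \<subseteq> W" using open_W open_contains_cball by blast
    define d where "d = R / 2"
    have d: "d > 0" "cball x d \<subseteq> W" using R by (auto simp: d_def)
    have "mean d x > 0" using pos x d by simp
    then have "\<forall>\<^sub>F y in nhds x. mean d y > 0"
      using mean_isCont[OF d] by (simp add: order_tendstoD(1) isCont_def tendsto_nhds_iff)
    then obtain e where e: "e > 0" "\<And>y. dist y x < e \<Longrightarrow> mean d y > 0"
      by (auto simp: eventually_nhds_metric)
    have "ball x (min e d) \<subseteq> W - Z"
    proof
      fix y assume y: "y \<in> ball x (min e d)"
      have sub: "cball y d \<subseteq> W"
      proof -
        have "cball y d \<subseteq> cball x R"
          using y by (auto simp: cball_subset_cball_iff d_def dist_commute)
        then show ?thesis using R by simp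
      qed
      have "y \<notin> Z"
      proof
        assume "y \<in> Z"
        then obtain s where s: "s > 0" "AE z in lebesgue. z \<in> ball y s \<longrightarrow> w z = 0" by (auto simp: Z_def)
        define t where "t = min s d"
        have t: "t > 0" "t \<le> d" "t \<le> s" using s d by (auto simp: t_def)
        have "AE z in lebesgue. w z * moll 1 t y z = 0"
          using s(2)
        proof eventually_elim
          case (elim z)
          then show ?case using moll_zero[OF t(1), of y z 1] t by (cases "z \<in> ball y s") (auto simp: dist_norm)
        qed
        then have "(\<integral>z. w z * moll 1 t y z \<partial>lebesgue) = 0" by (simp add: integral_eq_zero_AE)
        then have "mean t y = 0" by (simp add: mean_def)
        then show False using mean_antimono[OF t(1,2) sub] e(2)[of y] y by (auto simp: dist_commute)
      qed
      then show "y \<in> W - Z" using sub d by auto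
    qed
    then show "\<exists>e>0. ball x e \<subseteq> W - Z" using e d by (auto intro!: exI[of _ "min e d"])
  qed
  have ZW: "Z \<subseteq> W" unfolding Z_def by auto
  then have "Z = {} \<or> W - Z = {}"
    using connectedD[OF assms(1) \<open>open Z\<close> \<open>open (W - Z)\<close>] by auto
  moreover have "W - Z \<noteq> {}"
  proof
    assume "W - Z = {}"
    have "\<forall>x\<in>Z. \<exists>r>0. AE y in lebesgue. y \<in> ball x r \<longrightarrow> w y = 0" unfolding Z_def by auto
    then obtain r where r: "\<And>x. x \<in> Z \<Longrightarrow> r x > 0" "\<And>x. x \<in> Z \<Longrightarrow> AE y in lebesgue. y \<in> ball x (r x) \<longrightarrow> w y = 0"
      by metis
    \<comment> \<open>Almost everywhere statements pass only through countable unions, so the balls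
      covering W are first reduced to countably many.\<close>
    obtain F where F: "F \<subseteq> (\<lambda>x. ball x (r x)) ` Z" "countable F" "\<Union>F = \<Union>((\<lambda>x. ball x (r x)) ` Z)"
      by (rule Lindelof[of "(\<lambda>x. ball x (r x)) ` Z"]) auto
    have "AE y in lebesgue. \<forall>S\<in>F. y \<in> S \<longrightarrow> w y = 0"
      using F(1) r(2) by (subst AE_ball_countable[OF F(2)]) auto
    then have "AE y in lebesgue. y \<in> W \<longrightarrow> w y = 0"
    proof eventually_elim
      case (elim y)
      show ?case
      proof
        assume "y \<in> W"
        then have "y \<in> Z" using \<open>W - Z = {}\<close> by auto
          then have "y \<in> \<Union>F" unfolding F(3) using r(1) by (intro UN_I[of y]) auto
        then show "w y = 0" using elim by auto
      qed
    qed
    then show False using assms(2) by simp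
  qed
  ultimately have "Z = {}" by simp
  then show ?thesis using pos r by simp
qed

end

section \<open>Comparison and reduced coordinates\<close>

abbreviation has_second_difference :: "(real^'n::finite \<Rightarrow> real) \<Rightarrow> real^'n \<Rightarrow> 'n \<Rightarrow> real \<Rightarrow> bool" where
  "has_second_difference f x i l \<equiv>
    ((\<lambda>h. (f (x + h *\<^sub>R axis i 1) + f (x - h *\<^sub>R axis i 1) - 2 * f x) / h\<^sup>2) \<longlongrightarrow> l) (at 0)"

text \<open>At a maximum point z of v / U with value l above \<theta>, the function v - l U attains
  its maximum 0, so the second differences of v are at most l times those of U. Since v z = l U z,
  this contradicts \<open>lap\<close>. The product form of \<open>lap\<close> makes terms of order
  zero with a common coefficient cancel; \<open>inner\<close> keeps z off the boundary.\<close>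

lemma touching_comparison:
  fixes U v :: "real^'n::finite \<Rightarrow> real"
  assumes D: "compact D" and cont: "continuous_on D U" "continuous_on D v" and pos: "\<And>x. x \<in> D \<Longrightarrow> U x > 0"
    and \<theta>: "\<theta> \<ge> 0"
    and inner: "\<And>x. x \<in> D \<Longrightarrow> v x > \<theta> * U x \<Longrightarrow> \<exists>e>0. ball x e \<subseteq> D"
    and lap: "\<And>x. x \<in> D \<Longrightarrow> v x > \<theta> * U x \<Longrightarrow> \<exists>L M.
      (\<forall>i. has_second_difference U x i (L i)) \<and>
      (\<forall>i. has_second_difference v x i (M i)) \<and>
      (\<Sum>i\<in>UNIV. L i) * v x < (\<Sum>i\<in>UNIV. M i) * U x"
    and x: "x \<in> D"
  shows "v x \<le> \<theta> * U x"
proof (rule ccontr)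
  assume "\<not> v x \<le> \<theta> * U x"
  then have x1: "v x / U x > \<theta>" using pos[OF x] by (simp add: less_divide_eq)
  have "continuous_on D (\<lambda>x. v x / U x)"
    using pos by (intro continuous_on_divide cont) fastforce
  from continuous_attains_sup[OF D _ this] x
  obtain z where z: "z \<in> D" "\<And>y. y \<in> D \<Longrightarrow> v y / U y \<le> v z / U z" by blast
  define l where "l = v z / U z"
  have Uz: "U z > 0" using pos z by simp
  have l: "l > \<theta>" "v z = l * U z" using z(2)[OF x] x1 Uz by (auto simp: l_def)
  then have vz: "v z > \<theta> * U z" using Uz by simp
  have le: "v y \<le> l * U y" if "y \<in> D" for y
    using z(2)[OF that] pos[OF that] by (simp add: l_def divide_le_eq)
  obtain e where e: "e > 0" "ball z e \<subseteq> D" using inner[OF z(1) vz] by blast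
  obtain L M where LM:
    "\<And>i. has_second_difference U z i (L i)"
    "\<And>i. has_second_difference v z i (M i)"
    "(\<Sum>i\<in>UNIV. L i) * v z < (\<Sum>i\<in>UNIV. M i) * U z"
    using lap[OF z(1) vz] by blast
  have "M i \<le> l * L i" for i
  proof (rule tendsto_le[OF _ tendsto_mult[OF tendsto_const LM(1)] LM(2)])
    have "\<forall>\<^sub>F h in at 0. \<bar>h\<bar> < e" using e(1) by (auto simp: eventually_at dist_real_def)
    then show "\<forall>\<^sub>F h in at 0. (v (z + h *\<^sub>R axis i 1) + v (z - h *\<^sub>R axis i 1) - 2 * v z) / h\<^sup>2
        \<le> l * ((U (z + h *\<^sub>R axis i 1) + U (z - h *\<^sub>R axis i 1) - 2 * U z) / h\<^sup>2)"
    proof eventually_elim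
      case (elim h)
      have "z + h *\<^sub>R axis i 1 \<in> ball z e" "z - h *\<^sub>R axis i 1 \<in> ball z e" using elim by (auto simp: dist_norm)
      then have "v (z + h *\<^sub>R axis i 1) \<le> l * U (z + h *\<^sub>R axis i 1)" "v (z - h *\<^sub>R axis i 1) \<le> l * U (z - h *\<^sub>R axis i 1)"
        using le[OF subsetD[OF e(2)]] by blast+
      then show ?case
        unfolding times_divide_eq_right by (intro divide_right_mono) (auto simp: l(2) algebra_simps)
    qed
  qed simp
  then have "(\<Sum>i\<in>UNIV. M i) \<le> l * (\<Sum>i\<in>UNIV. L i)"
    unfolding sum_distrib_left by (rule sum_mono)
  then have "(\<Sum>i\<in>UNIV. M i) * U z \<le> l * (\<Sum>i\<in>UNIV. L i) * U z" using Uz by (intro mult_right_mono) auto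
  then show False using LM(3) by (simp add: l(2) mult_ac)
qed

text \<open>Total differentiability with gradient (a, b), as the chain rule along curves requires.
  The coefficients are arguments, so derivatives of explicit barriers are assembled by rules and
  then adjusted with \<open>has_partials_cong\<close>.\<close>

definition has_partials :: "(real \<Rightarrow> real \<Rightarrow> real) \<Rightarrow> real \<Rightarrow> real \<Rightarrow> real \<Rightarrow> real \<Rightarrow> bool" where
  "has_partials f a b t X \<longleftrightarrow> ((\<lambda>p. f (fst p) (snd p)) has_derivative (\<lambda>h. a * fst h + b * snd h)) (at (t, X))"

lemma has_partials_const: "has_partials (\<lambda>t X. c) 0 0 t X"
  by (simp add: has_partials_def)

lemma has_partials_fst: "has_partials (\<lambda>t X. t) 1 0 t X"
  and has_partials_snd: "has_partials (\<lambda>t X. X) 0 1 t X"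
  unfolding has_partials_def by (auto intro!: derivative_eq_intros)

lemma has_partials_add:
  "has_partials f a b t X \<Longrightarrow> has_partials g c d t X \<Longrightarrow> has_partials (\<lambda>t X. f t X + g t X) (a + c) (b + d) t X"
  unfolding has_partials_def by (auto intro!: derivative_eq_intros simp: algebra_simps)

lemma has_partials_diff:
  "has_partials f a b t X \<Longrightarrow> has_partials g c d t X \<Longrightarrow> has_partials (\<lambda>t X. f t X - g t X) (a - c) (b - d) t X"
  unfolding has_partials_def by (auto intro!: derivative_eq_intros simp: algebra_simps)

lemma has_partials_mult:
  "has_partials f a b t X \<Longrightarrow> has_partials g c d t X \<Longrightarrow>
    has_partials (\<lambda>t X. f t X * g t X) (a * g t X + f t X * c) (b * g t X + f t X * d) t X"
  unfolding has_partials_def by (drule (1) has_derivative_mult) (simp add: algebra_simps)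

lemma has_partials_compose:
  assumes "has_partials f a b t X" "(\<phi> has_real_derivative D) (at (f t X))"
  shows "has_partials (\<lambda>t X. \<phi> (f t X)) (D * a) (D * b) t X"
  using has_derivative_compose[OF assms(1)[unfolded has_partials_def], of \<phi> "(*) D"] assms(2)
  unfolding has_partials_def has_field_derivative_def by (simp add: algebra_simps)

lemma has_partials_cong: "has_partials f a b t X \<Longrightarrow> a = c \<Longrightarrow> b = d \<Longrightarrow> has_partials f c d t X"
  by simp

lemma has_partials_curve:
  assumes "has_partials f a b (t s) (X s)" "(t has_real_derivative t') (at s)" "(X has_real_derivative X') (at s)"
  shows "((\<lambda>s. f (t s) (X s)) has_real_derivative a * t' + b * X') (at s)"
proof -
  have "((\<lambda>s. (t s, X s)) has_derivative (\<lambda>h. (h * t', h * X'))) (at s)"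
    using assms(2,3) by (auto intro!: has_derivative_Pair simp: has_field_derivative_def mult_commute_abs)
  note has_derivative_compose[OF this assms(1)[unfolded has_partials_def]]
  moreover have "(\<lambda>h. a * fst (h * t', h * X') + b * snd (h * t', h * X')) = (*) (a * t' + b * X')"
    by (auto simp: algebra_simps)
  ultimately show ?thesis by (simp add: has_field_derivative_def)
qed

text \<open>The chain rule of second order. One coefficient GtX stands for both mixed derivatives,
  so their symmetry is verified with the partial derivatives of each explicit barrier.\<close>

lemma second_difference_curve:
  fixes G Gt GX :: "real \<Rightarrow> real \<Rightarrow> real"
  assumes ev: "\<forall>\<^sub>F s in nhds 0. (t has_real_derivative td s) (at s) \<and> (X has_real_derivative Xd s) (at s) \<and>
      has_partials G (Gt (t s) (X s)) (GX (t s) (X s)) (t s) (X s)"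
    and 2: "(td has_real_derivative tdd) (at 0)" "(Xd has_real_derivative Xdd) (at 0)"
      "has_partials Gt Gtt GtX (t 0) (X 0)" "has_partials GX GtX GXX (t 0) (X 0)"
  shows "((\<lambda>h. (G (t h) (X h) + G (t (- h)) (X (- h)) - 2 * G (t 0) (X 0)) / h\<^sup>2) \<longlongrightarrow>
    Gtt * (td 0)\<^sup>2 + 2 * GtX * (td 0 * Xd 0) + GXX * (Xd 0)\<^sup>2 + Gt (t 0) (X 0) * tdd + GX (t 0) (X 0) * Xdd) (at 0)"
proof (rule second_difference_tendsto)
  let ?D = "\<lambda>s. Gt (t s) (X s) * td s + GX (t s) (X s) * Xd s"
  show "\<forall>\<^sub>F s in nhds 0. ((\<lambda>s. G (t s) (X s)) has_real_derivative ?D s) (at s)"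
    using ev by eventually_elim (auto intro: has_partials_curve)
  have d: "(t has_real_derivative td 0) (at 0)" "(X has_real_derivative Xd 0) (at 0)"
    using eventually_nhds_x_imp_x[OF ev] by auto
  have "((\<lambda>s. Gt (t s) (X s)) has_real_derivative Gtt * td 0 + GtX * Xd 0) (at 0)"
    "((\<lambda>s. GX (t s) (X s)) has_real_derivative GtX * td 0 + GXX * Xd 0) (at 0)"
    using has_partials_curve[OF 2(3) d] has_partials_curve[OF 2(4) d] by auto
  from DERIV_add[OF DERIV_mult[OF this(1) 2(1)] DERIV_mult[OF this(2) 2(2)]]
  show "(?D has_real_derivative Gtt * (td 0)\<^sup>2 + 2 * GtX * (td 0 * Xd 0) + GXX * (Xd 0)\<^sup>2
      + Gt (t 0) (X 0) * tdd + GX (t 0) (X 0) * Xdd) (at 0)"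
    by (rule DERIV_cong) (simp add: power2_eq_square algebra_simps)
qed

text \<open>In the coordinates \<open>t = - ln (dist x \<Gamma>)\<close>, \<open>X = |x - \<sigma>|\<^sup>2\<close> and after division by
  \<open>dist powr - \<alpha>\<close>, the Hardy operator becomes the second derivative in \<open>t\<close> up to the
  errors collected here.\<close>

definition reduced_op :: "real \<Rightarrow> real \<Rightarrow> real \<Rightarrow> real \<Rightarrow> real \<Rightarrow> real \<Rightarrow> real \<Rightarrow> real \<Rightarrow> real \<Rightarrow> real \<Rightarrow> real" where
  "reduced_op K N t X g gt gtt gX gtX gXX = gtt - K * (X + exp (- t)) * (\<bar>gtt\<bar> + \<bar>gt\<bar> + \<bar>g\<bar>)
     - K * (exp (- t) * (X + exp (- t))) * (\<bar>gtX\<bar> + \<bar>gX\<bar>) + (exp (- t))\<^sup>2 * (4 * X * gXX + 2 * N * gX)"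

text \<open>With Y = exp (- 2 t) one has Y |grad t|^2 = 1 and Y laplacian t = - 2 \<alpha>, up to
  the errors in \<open>E\<close>. Applied to exp (\<alpha> t) g, the term 2 \<alpha> gt of the
  product rule cancels against the one from laplacian t, and \<alpha>^2 - 2 \<alpha>^2 leaves the
  Hardy term - \<alpha>^2 g. This is the reason for the exponent \<alpha>; the codimension is 2
  \<alpha> + 2.\<close>

lemma barrier_laplacian:
  fixes Y :: "real^'n::finite \<Rightarrow> real"
  assumes r: "cball x e \<subseteq> B" "e > 0" and Ypos: "\<And>z. z \<in> cball x e \<Longrightarrow> Y z > 0"
    and Y1: "\<And>x i. x \<in> B \<Longrightarrow> ((\<lambda>s. Y (x + s *\<^sub>R axis i 1)) has_real_derivative Y1 i x) (at 0)"
    and Y2: "\<And>x i. x \<in> B \<Longrightarrow> ((\<lambda>s. Y1 i (x + s *\<^sub>R axis i 1)) has_real_derivative Y2 i x) (at 0)"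
    and t: "t = - ln (Y x) / 2" and X: "X = (norm (x - \<sigma>))\<^sup>2"
    and E: "\<bar>(\<Sum>i\<in>UNIV. (Y1 i x)\<^sup>2) - 4 * Y x\<bar> \<le> C * ((X + sqrt (Y x)) * Y x)"
      "\<bar>(\<Sum>i\<in>UNIV. Y2 i x) - 2 * (2 * \<alpha> + 2)\<bar> \<le> C * (X + sqrt (Y x))"
      "\<bar>\<Sum>i\<in>UNIV. Y1 i x * ((x - \<sigma>) $ i)\<bar> \<le> C * (sqrt (Y x) * (X + sqrt (Y x)))"
    and C: "C \<ge> 0" "\<alpha> \<ge> 0"
    and g: "\<And>z. z \<in> cball x e \<Longrightarrow> has_partials g (gt (- ln (Y z) / 2) ((norm (z - \<sigma>))\<^sup>2)) (gX (- ln (Y z) / 2) ((norm (z - \<sigma>))\<^sup>2))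
        (- ln (Y z) / 2) ((norm (z - \<sigma>))\<^sup>2)"
      "has_partials gt gtt gtX t X" "has_partials gX gtX gXX t X"
    and v: "\<And>z. v z = c * (exp (\<alpha> * (- ln (Y z) / 2)) * g (- ln (Y z) / 2) ((norm (z - \<sigma>))\<^sup>2))" and c: "c > 0"
  shows "\<exists>M. (\<forall>i. has_second_difference v x i (M i)) \<and>
    (\<Sum>i\<in>UNIV. M i) * Y x \<ge> c * (exp (\<alpha> * t) *
      (reduced_op (2 * C * (1 + \<alpha>)\<^sup>2) (real CARD('n)) t X (g t X) (gt t X) gtt (gX t X) gtX gXX - \<alpha>\<^sup>2 * g t X))"
proof -
  define G where "G t X = exp (\<alpha> * t) * g t X" for t X
  define Gt where "Gt t X = exp (\<alpha> * t) * (gt t X + \<alpha> * g t X)" for t X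
  define GX where "GX t X = exp (\<alpha> * t) * gX t X" for t X
  define Gtt where "Gtt = exp (\<alpha> * t) * (gtt + 2 * \<alpha> * gt t X + \<alpha>\<^sup>2 * g t X)"
  define GtX where "GtX = exp (\<alpha> * t) * (gtX + \<alpha> * gX t X)"
  define GXX where "GXX = exp (\<alpha> * t) * gXX"
  define y where "y = Y x"
  have x: "x \<in> cball x e" using r by simp
  have y: "y > 0" using Ypos[OF x] by (simp add: y_def)
  have sy: "sqrt y = exp (- t)" "y = (exp (- t))\<^sup>2"
  proof -
    have "exp (- t) = exp (ln y / 2)" by (simp add: t y_def)
    also have "\<dots> = sqrt y" using y by (simp add: ln_sqrt[symmetric])
    finally show "sqrt y = exp (- t)" by simp
    then show "y = (exp (- t))\<^sup>2" using y by (metis real_sqrt_pow2 less_imp_le)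
  qed
  have ex: "has_partials (\<lambda>t X. exp (\<alpha> * t)) (\<alpha> * exp (\<alpha> * t)) 0 t X" for t X
  proof -
    have "has_partials (\<lambda>t X. \<alpha> * t) \<alpha> 0 t X"
      using has_partials_mult[OF has_partials_const[of \<alpha>] has_partials_fst] by simp
    from has_partials_compose[OF this DERIV_exp] show ?thesis by (simp add: mult.commute)
  qed
  have pG: "has_partials G (Gt t X) (GX t X) t X" if "has_partials g (gt t X) (gX t X) t X" for t X
    unfolding G_def by (rule has_partials_cong[OF has_partials_mult[OF ex that]]) (auto simp: Gt_def GX_def algebra_simps)
  have gx: "has_partials g (gt t X) (gX t X) t X" using g(1)[OF x] by (simp add: t X)
  have pGt: "has_partials Gt Gtt GtX t X"
    unfolding Gt_def
    by (rule has_partials_cong[OF has_partials_mult[OF ex has_partials_add[OF g(2) has_partials_mult[OF has_partials_const gx]]]])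
      (auto simp: Gtt_def GtX_def algebra_simps power2_eq_square)
  have pGX: "has_partials GX GtX GXX t X"
    unfolding GX_def
    by (rule has_partials_cong[OF has_partials_mult[OF ex g(3)]]) (auto simp: GtX_def GXX_def algebra_simps)
  \<comment> \<open>At x, \<open>a1\<close> and \<open>a2\<close> are the first and second
    derivatives of t along axis i, and \<open>b1\<close> is the first derivative of X, whose second
    derivative is 2.\<close>
  define a1 where "a1 i = - Y1 i x / (2 * y)" for i
  define a2 where "a2 i = - (Y2 i x / y - (Y1 i x)\<^sup>2 / y\<^sup>2) / 2" for i
  define b1 where "b1 i = 2 * ((x - \<sigma>) $ i)" for i
  define M where "M i = Gtt * (a1 i)\<^sup>2 + 2 * GtX * (a1 i * b1 i) + GXX * (b1 i)\<^sup>2 + Gt t X * a2 i + GX t X * 2" for i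
  have lim: "has_second_difference v x i (c * M i)" for i
  proof -
    let ?z = "\<lambda>s. x + s *\<^sub>R axis i 1"
    let ?t = "\<lambda>s. - ln (Y (?z s)) / 2" and ?X = "\<lambda>s. (norm (?z s - \<sigma>))\<^sup>2"
    have dY: "((\<lambda>s. Y (?z s)) has_real_derivative Y1 i (?z s)) (at s)" if "?z s \<in> B" for s
      using Y1[OF that, of i] DERIV_shift[of "\<lambda>s. Y (?z s)" "Y1 i (?z s)" 0 s] by (simp add: algebra_simps)
    have ball: "?z s \<in> cball x e" if "\<bar>s\<bar> < e" for s using that by (simp add: dist_norm)
    have "((\<lambda>h. (G (?t h) (?X h) + G (?t (- h)) (?X (- h)) - 2 * G (?t 0) (?X 0)) / h\<^sup>2) \<longlongrightarrow>
      Gtt * (- Y1 i (?z 0) / (2 * Y (?z 0)))\<^sup>2 + 2 * GtX * (- Y1 i (?z 0) / (2 * Y (?z 0)) * (2 * ((?z 0 - \<sigma>) $ i)))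
       + GXX * (2 * ((?z 0 - \<sigma>) $ i))\<^sup>2 + Gt (?t 0) (?X 0) * a2 i + GX (?t 0) (?X 0) * 2) (at 0)"
    proof (rule second_difference_curve[where t = ?t and X = ?X and td = "\<lambda>s. - Y1 i (?z s) / (2 * Y (?z s))"
          and Xd = "\<lambda>s. 2 * ((?z s - \<sigma>) $ i)" and tdd = "a2 i" and Xdd = 2])
      have "\<forall>\<^sub>F s in nhds 0. \<bar>s\<bar> < e" using r(2) by (auto simp: eventually_nhds_metric dist_real_def)
      then show "\<forall>\<^sub>F s in nhds 0. (?t has_real_derivative - Y1 i (?z s) / (2 * Y (?z s))) (at s) \<and>
        (?X has_real_derivative 2 * ((?z s - \<sigma>) $ i)) (at s) \<and>
        has_partials G (Gt (?t s) (?X s)) (GX (?t s) (?X s)) (?t s) (?X s)"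
      proof eventually_elim
        case (elim s)
        note b = ball[OF elim]
        have "((\<lambda>s. ln (Y (?z s))) has_real_derivative 1 / Y (?z s) * Y1 i (?z s)) (at s)"
          by (rule DERIV_chain2[OF DERIV_ln_divide dY]) (use b r Ypos in auto)
        from DERIV_cdivide[OF DERIV_minus[OF this], of 2]
        have "(?t has_real_derivative - Y1 i (?z s) / (2 * Y (?z s))) (at s)" by (simp add: field_simps)
        moreover have "(?X has_real_derivative 2 * ((?z s - \<sigma>) $ i)) (at s)"
        proof -
          have "?X s = (x - \<sigma>) \<bullet> (x - \<sigma>) + 2 * s * ((x - \<sigma>) $ i) + s\<^sup>2" for s
          proof -
            have "?z s - \<sigma> = (x - \<sigma>) + s *\<^sub>R axis i 1" by simp
            then show ?thesis unfolding power2_norm_eq_inner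
              by (simp only: inner_add_left inner_add_right inner_scaleR_left inner_scaleR_right inner_axis inner_axis')
                (simp add: power2_eq_square algebra_simps inner_axis inner_axis')
          qed
          then have "?X = (\<lambda>s. (x - \<sigma>) \<bullet> (x - \<sigma>) + 2 * s * ((x - \<sigma>) $ i) + s\<^sup>2)" by (rule ext)
          then show ?thesis by (simp only:) (auto intro!: derivative_eq_intros)
        qed
        moreover have "has_partials G (Gt (?t s) (?X s)) (GX (?t s) (?X s)) (?t s) (?X s)"
          by (rule pG[OF g(1)[OF b]])
        ultimately show ?case by blast
      qed
      have "((\<lambda>s. - Y1 i (?z s) / (2 * Y (?z s))) has_real_derivative
          (- Y2 i x * (2 * Y (?z 0)) - - Y1 i (?z 0) * (2 * Y1 i x)) / ((2 * Y (?z 0)) * (2 * Y (?z 0)))) (at 0)"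
        by (rule DERIV_divide[OF DERIV_minus[OF Y2] DERIV_cmult[OF Y1]]) (use x r y in \<open>auto simp: y_def\<close>)
      then show "((\<lambda>s. - Y1 i (?z s) / (2 * Y (?z s))) has_real_derivative a2 i) (at 0)"
        by (rule DERIV_cong) (use y in \<open>simp add: a2_def y_def[symmetric] field_simps power2_eq_square\<close>)
      show "((\<lambda>s. 2 * ((?z s - \<sigma>) $ i)) has_real_derivative 2) (at 0)"
        by (auto intro!: derivative_eq_intros)
      show "has_partials Gt Gtt GtX (?t 0) (?X 0)" "has_partials GX GtX GXX (?t 0) (?X 0)"
        using pGt pGX by (simp_all add: t X)
    qed
    then have "((\<lambda>h. (G (?t h) (?X h) + G (?t (- h)) (?X (- h)) - 2 * G (?t 0) (?X 0)) / h\<^sup>2) \<longlongrightarrow> M i) (at 0)"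
      by (simp add: M_def a1_def b1_def t X y_def)
    from tendsto_mult[OF tendsto_const[of c] this] show ?thesis
      by (simp add: v G_def algebra_simps)
  qed
  define \<eta> where "\<eta> = X + sqrt y"
  have \<eta>: "\<eta> \<ge> 0" using y by (simp add: \<eta>_def X)
  \<comment> \<open>\<open>E1\<close> is the deviation of Y |grad t|^2 from 1 and \<open>E2\<close>
    that of laplacian Y from twice the codimension; \<open>E4\<close> is Y times the inner product
    of grad t and grad X, which is small itself.\<close>
  define E1 where "E1 = ((\<Sum>i\<in>UNIV. (Y1 i x)\<^sup>2) - 4 * y) / (4 * y)"
  define E2 where "E2 = (\<Sum>i\<in>UNIV. Y2 i x) - 2 * (2 * \<alpha> + 2)"
  define E4 where "E4 = - (\<Sum>i\<in>UNIV. Y1 i x * ((x - \<sigma>) $ i))"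
  have E1: "\<bar>E1\<bar> \<le> C * \<eta> / 4" and E2: "\<bar>E2\<bar> \<le> C * \<eta>" and E4: "\<bar>E4\<bar> \<le> C * (exp (- t) * \<eta>)"
    using E y by (auto simp: E1_def E2_def E4_def \<eta>_def y_def[symmetric] sy(1)[symmetric] abs_mult divide_le_eq mult_ac)
  have s1: "(\<Sum>i\<in>UNIV. (a1 i)\<^sup>2) * y = 1 + E1"
    using y by (simp add: a1_def E1_def power_divide sum_divide_distrib[symmetric] field_simps power2_eq_square)
  have s2: "(\<Sum>i\<in>UNIV. a2 i) * y = - (2 * \<alpha> + (E2 / 2 - 2 * E1))"
  proof -
    have "(\<Sum>i\<in>UNIV. a2 i) = - ((\<Sum>i\<in>UNIV. Y2 i x) / y - (\<Sum>i\<in>UNIV. (Y1 i x)\<^sup>2) / y\<^sup>2) / 2"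
      by (simp add: a2_def sum_divide_distrib[symmetric] sum_subtractf sum_negf)
    then show ?thesis using y by (simp add: E1_def E2_def field_simps power2_eq_square)
  qed
  have s3: "(\<Sum>i\<in>UNIV. a1 i * b1 i) * y = E4"
  proof -
    have "(\<Sum>i\<in>UNIV. a1 i * b1 i) = (\<Sum>i\<in>UNIV. - (Y1 i x * ((x - \<sigma>) $ i)) / y)"
      by (intro sum.cong) (auto simp: a1_def b1_def simp del: vector_minus_component)
    then show ?thesis using y by (simp add: E4_def sum_divide_distrib[symmetric] sum_negf)
  qed
  have s4: "(\<Sum>i\<in>UNIV. (b1 i)\<^sup>2) = 4 * X"
    by (simp add: b1_def X power_mult_distrib sum_distrib_left[symmetric] norm_vec_def L2_set_def sum_nonneg del: vector_minus_component)
  have "(\<Sum>i\<in>UNIV. M i) * y = Gtt * ((\<Sum>i\<in>UNIV. (a1 i)\<^sup>2) * y) + 2 * GtX * ((\<Sum>i\<in>UNIV. a1 i * b1 i) * y)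
      + GXX * (\<Sum>i\<in>UNIV. (b1 i)\<^sup>2) * y + Gt t X * ((\<Sum>i\<in>UNIV. a2 i) * y) + GX t X * (2 * real CARD('n)) * y"
    unfolding M_def sum.distrib sum_distrib_left[symmetric] by (simp add: algebra_simps)
  also have "\<dots> = exp (\<alpha> * t) * (gtt - \<alpha>\<^sup>2 * g t X + E1 * (gtt + 2 * \<alpha> * gt t X + \<alpha>\<^sup>2 * g t X)
      - (E2 / 2 - 2 * E1) * (gt t X + \<alpha> * g t X) + 2 * E4 * (gtX + \<alpha> * gX t X) + y * (4 * X * gXX + 2 * real CARD('n) * gX t X))"
    unfolding s1 s2 s3 s4 Gtt_def GtX_def GXX_def Gt_def GX_def
    by (simp add: algebra_simps power2_eq_square)
  finally have sumM: "(\<Sum>i\<in>UNIV. M i) * y = \<dots>" .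
  define K where "K = 2 * C * (1 + \<alpha>)\<^sup>2"
  have Ks: "C / 4 \<le> K" "C * \<alpha> / 2 + C \<le> K" "C * \<alpha>\<^sup>2 / 4 + C * \<alpha> \<le> K" "2 * C \<le> K" "2 * C * \<alpha> \<le> K"
  proof -
    have "K = 2 * C + 4 * (C * \<alpha>) + 2 * (C * \<alpha>\<^sup>2)" by (simp add: K_def power2_sum algebra_simps)
    moreover have "C * \<alpha> \<ge> 0" "C * \<alpha>\<^sup>2 \<ge> 0" using C by auto
    ultimately show "C / 4 \<le> K" "C * \<alpha> / 2 + C \<le> K" "C * \<alpha>\<^sup>2 / 4 + C * \<alpha> \<le> K" "2 * C \<le> K" "2 * C * \<alpha> \<le> K"
      using C by auto
  qed
  define p0 p1 p2 p3 p4 where "p0 = \<bar>g t X\<bar>" and "p1 = \<bar>gt t X\<bar>" and "p2 = \<bar>gtt\<bar>" and "p3 = \<bar>gtX\<bar>" and "p4 = \<bar>gX t X\<bar>"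
  have p: "p0 \<ge> 0" "p1 \<ge> 0" "p2 \<ge> 0" "p3 \<ge> 0" "p4 \<ge> 0" by (auto simp: p0_def p1_def p2_def p3_def p4_def)
  have e1: "\<bar>E1 * (gtt + 2 * \<alpha> * gt t X + \<alpha>\<^sup>2 * g t X)\<bar> \<le> C * \<eta> / 4 * (p2 + 2 * \<alpha> * p1 + \<alpha>\<^sup>2 * p0)"
  proof -
    have "\<bar>gtt + 2 * \<alpha> * gt t X + \<alpha>\<^sup>2 * g t X\<bar> \<le> p2 + 2 * \<alpha> * p1 + \<alpha>\<^sup>2 * p0"
      using abs_triangle_ineq[of "gtt + 2 * \<alpha> * gt t X" "\<alpha>\<^sup>2 * g t X"] abs_triangle_ineq[of gtt "2 * \<alpha> * gt t X"] C(2)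
      by (simp add: p0_def p1_def p2_def abs_mult)
    then show ?thesis unfolding abs_mult using E1 C \<eta> by (intro mult_mono) auto
  qed
  have e2: "\<bar>(E2 / 2 - 2 * E1) * (gt t X + \<alpha> * g t X)\<bar> \<le> C * \<eta> * (p1 + \<alpha> * p0)"
  proof -
    have "\<bar>gt t X + \<alpha> * g t X\<bar> \<le> p1 + \<alpha> * p0"
      using abs_triangle_ineq[of "gt t X" "\<alpha> * g t X"] C(2) by (simp add: p0_def p1_def abs_mult)
    moreover have "\<bar>E2 / 2 - 2 * E1\<bar> \<le> C * \<eta>" using E1 E2 by linarith
    ultimately show ?thesis unfolding abs_mult using C \<eta> by (intro mult_mono) auto
  qed
  have e4: "\<bar>2 * E4 * (gtX + \<alpha> * gX t X)\<bar> \<le> 2 * (C * (exp (- t) * \<eta>)) * (p3 + \<alpha> * p4)"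
  proof -
    have "\<bar>gtX + \<alpha> * gX t X\<bar> \<le> p3 + \<alpha> * p4"
      using abs_triangle_ineq[of gtX "\<alpha> * gX t X"] C(2) by (simp add: p3_def p4_def abs_mult)
    moreover have "\<bar>2 * E4\<bar> \<le> 2 * (C * (exp (- t) * \<eta>))" using E4 by simp
    ultimately show ?thesis unfolding abs_mult[of "2 * E4"] using C \<eta> by (intro mult_mono) auto
  qed
  have k1: "C * \<eta> / 4 * (p2 + 2 * \<alpha> * p1 + \<alpha>\<^sup>2 * p0) + C * \<eta> * (p1 + \<alpha> * p0) \<le> K * \<eta> * (p2 + p1 + p0)"
  proof -
    have "C / 4 * p2 + (C * \<alpha> / 2 + C) * p1 + (C * \<alpha>\<^sup>2 / 4 + C * \<alpha>) * p0 \<le> K * p2 + K * p1 + K * p0"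
      using Ks p by (intro add_mono mult_right_mono)
    from mult_left_mono[OF this \<eta>] show ?thesis by (simp add: algebra_simps)
  qed
  have k2: "2 * (C * (exp (- t) * \<eta>)) * (p3 + \<alpha> * p4) \<le> K * (exp (- t) * \<eta>) * (p3 + p4)"
  proof -
    have "2 * C * p3 + 2 * C * \<alpha> * p4 \<le> K * p3 + K * p4"
      using Ks p by (intro add_mono mult_right_mono)
    from mult_left_mono[OF this, of "exp (- t) * \<eta>"] \<eta> show ?thesis by (simp add: algebra_simps)
  qed
  have "reduced_op K (real CARD('n)) t X (g t X) (gt t X) gtt (gX t X) gtX gXX - \<alpha>\<^sup>2 * g t X
     \<le> gtt - \<alpha>\<^sup>2 * g t X + E1 * (gtt + 2 * \<alpha> * gt t X + \<alpha>\<^sup>2 * g t X)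
      - (E2 / 2 - 2 * E1) * (gt t X + \<alpha> * g t X) + 2 * E4 * (gtX + \<alpha> * gX t X) + y * (4 * X * gXX + 2 * real CARD('n) * gX t X)"
    using e1 e2 e4 k1 k2
    unfolding reduced_op_def p0_def[symmetric] p1_def[symmetric] p2_def[symmetric] p3_def[symmetric] p4_def[symmetric]
      sy(1)[symmetric] \<eta>_def[symmetric] real_sqrt_pow2[OF less_imp_le[OF y]]
    by linarith
  then have "exp (\<alpha> * t) * (reduced_op K (real CARD('n)) t X (g t X) (gt t X) gtt (gX t X) gtX gXX - \<alpha>\<^sup>2 * g t X)
     \<le> (\<Sum>i\<in>UNIV. M i) * y" unfolding sumM by (intro mult_left_mono) auto
  then have "c * (exp (\<alpha> * t) * (reduced_op K (real CARD('n)) t X (g t X) (gt t X) gtt (gX t X) gtX gXX - \<alpha>\<^sup>2 * g t X))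
     \<le> (\<Sum>i\<in>UNIV. c * M i) * Y x"
    using c by (simp add: sum_distrib_left[symmetric] y_def mult.assoc)
  then show ?thesis using lim unfolding K_def by (intro exI[of _ "\<lambda>i. c * M i"]) auto
qed

section \<open>Barriers\<close>

text \<open>The function r replaces t sqrt X, which is not differentiable at X = 0. The added 1 /
  t^2 changes it by at most 1 / t and keeps it at least 1 / t, so its derivatives grow only
  polynomially in t.\<close>

lemma has_partials_sqrt_barrier:
  assumes "t > 0" "X \<ge> 0"
  defines "r \<equiv> \<lambda>t X. sqrt (t\<^sup>2 * X + 1 / t\<^sup>2)"
  shows "has_partials r ((t * X - 1 / t ^ 3) / r t X) (t\<^sup>2 / (2 * r t X)) t X"
    "has_partials (\<lambda>t X. (t * X - 1 / t ^ 3) / r t X)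
      ((X + 3 / t ^ 4) / r t X - ((t * X - 1 / t ^ 3) / r t X)\<^sup>2 / r t X)
      (t / r t X - ((t * X - 1 / t ^ 3) / r t X) * (t\<^sup>2 / (2 * r t X)) / r t X) t X"
    "has_partials (\<lambda>t X. t\<^sup>2 / (2 * r t X))
      (t / r t X - ((t * X - 1 / t ^ 3) / r t X) * (t\<^sup>2 / (2 * r t X)) / r t X)
      (- ((t\<^sup>2 / (2 * r t X))\<^sup>2 / r t X)) t X"
proof -
  define s where "s = t\<^sup>2 * X + 1 / t\<^sup>2"
  have s: "s > 0" using assms by (auto simp: s_def intro!: add_nonneg_pos)
  have rs: "r t X = sqrt s" "sqrt s > 0" using s by (auto simp: r_def s_def)
  have d: "has_partials (\<lambda>t X. t\<^sup>2) (2 * t) 0 t X" "has_partials (\<lambda>t X. 1 / t\<^sup>2) (- 2 / t ^ 3) 0 t X"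
     "has_partials (\<lambda>t X. 1 / t ^ 3) (- 3 / t ^ 4) 0 t X"
  proof -
    have "((\<lambda>t. t\<^sup>2) has_real_derivative 2 * t) (at t)" "((\<lambda>t. 1 / t\<^sup>2) has_real_derivative - 2 / t ^ 3) (at t)"
      "((\<lambda>t. 1 / t ^ 3) has_real_derivative - 3 / t ^ 4) (at t)"
      using assms(1) by (auto intro!: derivative_eq_intros simp: field_simps power2_eq_square power3_eq_cube power4_eq_xxxx)
    from this[THEN has_partials_compose[OF has_partials_fst]]
    show "has_partials (\<lambda>t X. t\<^sup>2) (2 * t) 0 t X" "has_partials (\<lambda>t X. 1 / t\<^sup>2) (- 2 / t ^ 3) 0 t X"
     "has_partials (\<lambda>t X. 1 / t ^ 3) (- 3 / t ^ 4) 0 t X" by simp_all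
  qed
  have "has_partials (\<lambda>t X. t\<^sup>2 * X + 1 / t\<^sup>2) (2 * t * X - 2 / t ^ 3) (t\<^sup>2) t X"
    by (rule has_partials_cong[OF has_partials_add[OF has_partials_mult[OF d(1) has_partials_snd] d(2)]]) auto
  then have "has_partials (\<lambda>t X. sqrt (t\<^sup>2 * X + 1 / t\<^sup>2))
      (inverse (sqrt s) / 2 * (2 * t * X - 2 / t ^ 3)) (inverse (sqrt s) / 2 * t\<^sup>2) t X"
    by (rule has_partials_compose) (use DERIV_real_sqrt[OF s] in \<open>simp add: s_def\<close>)
  then show r1: "has_partials r ((t * X - 1 / t ^ 3) / r t X) (t\<^sup>2 / (2 * r t X)) t X"
    unfolding rs(1) unfolding r_def by (elim has_partials_cong) (use rs(2) in \<open>auto simp: field_simps\<close>)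
  define R n q where "R = r t X" and "n = t * X - 1 / t ^ 3" and "q = t\<^sup>2 / (2 * r t X)"
  have R: "R > 0" using rs by (simp add: R_def)
  have inv: "has_partials (\<lambda>t X. inverse (r t X)) (- (n / R / R\<^sup>2)) (- (q / R\<^sup>2)) t X"
  proof (rule has_partials_cong[OF has_partials_compose[OF r1 DERIV_inverse]])
    have a: "- (inverse R ^ Suc (Suc 0)) * (c / R) = - (c / R / R\<^sup>2)" "- (inverse R ^ Suc (Suc 0)) * q = - (q / R\<^sup>2)" for c
      by (simp_all add: power2_eq_square divide_inverse mult_ac)
    show "r t X \<noteq> 0" using R by (simp add: R_def)
    show "- (inverse (r t X) ^ Suc (Suc 0)) * ((t * X - 1 / t ^ 3) / r t X) = - (n / R / R\<^sup>2)"
      "- (inverse (r t X) ^ Suc (Suc 0)) * (t\<^sup>2 / (2 * r t X)) = - (q / R\<^sup>2)"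
      using a(1)[of n] a(2) unfolding R_def n_def q_def .
  qed
  have e: "A * inverse R + n * - (n / R / R\<^sup>2) = A / R - (n / R)\<^sup>2 / R"
    "t * inverse R + n * - (q / R\<^sup>2) = t / R - n / R * q / R" for A
    by (simp_all add: power2_eq_square divide_inverse algebra_simps)
  have "has_partials (\<lambda>t X. t * X - 1 / t ^ 3) (X + 3 / t ^ 4) t t X"
    by (rule has_partials_cong[OF has_partials_diff[OF has_partials_mult[OF has_partials_fst has_partials_snd] d(3)]]) auto
  from has_partials_mult[OF this inv]
  have "has_partials (\<lambda>t X. (t * X - 1 / t ^ 3) * inverse (r t X))
      ((X + 3 / t ^ 4) / R - (n / R)\<^sup>2 / R) (t / R - n / R * q / R) t X"
    unfolding R_def[symmetric] n_def[symmetric] e .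
  then show "has_partials (\<lambda>t X. (t * X - 1 / t ^ 3) / r t X)
      ((X + 3 / t ^ 4) / r t X - ((t * X - 1 / t ^ 3) / r t X)\<^sup>2 / r t X)
      (t / r t X - ((t * X - 1 / t ^ 3) / r t X) * (t\<^sup>2 / (2 * r t X)) / r t X) t X"
    unfolding q_def[symmetric] unfolding R_def[symmetric] n_def[symmetric] by (simp add: divide_inverse[of _ "r _ _"])
  have q: "t\<^sup>2 = 2 * R * q" using R by (simp add: q_def R_def)
  have "has_partials (\<lambda>t X. t\<^sup>2 * inverse (r t X) * (1 / 2)) (t / R - n / R * q / R) (- (q\<^sup>2 / R)) t X"
  proof (rule has_partials_cong[OF has_partials_mult[OF has_partials_mult[OF d(1) inv] has_partials_const[of "1 / 2"]]])
    show "(2 * t * inverse (r t X) + t\<^sup>2 * - (n / R / R\<^sup>2)) * (1 / 2) + t\<^sup>2 * inverse (r t X) * 0 = t / R - n / R * q / R"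
      unfolding R_def[symmetric] q using R by (simp add: field_simps power2_eq_square)
    show "(0 * inverse (r t X) + t\<^sup>2 * - (q / R\<^sup>2)) * (1 / 2) + t\<^sup>2 * inverse (r t X) * 0 = - (q\<^sup>2 / R)"
      unfolding q using R by (simp add: field_simps power2_eq_square)
  qed
  moreover have fe: "(\<lambda>t X. t\<^sup>2 / (2 * r t X)) = (\<lambda>t X. t\<^sup>2 * inverse (r t X) * (1 / 2))"
    by (intro ext) (simp add: inverse_eq_divide)
  ultimately show "has_partials (\<lambda>t X. t\<^sup>2 / (2 * r t X))
      (t / r t X - ((t * X - 1 / t ^ 3) / r t X) * (t\<^sup>2 / (2 * r t X)) / r t X)
      (- ((t\<^sup>2 / (2 * r t X))\<^sup>2 / r t X)) t X"
    unfolding fe unfolding q_def[symmetric] unfolding R_def[symmetric] n_def[symmetric] by simp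
qed

text \<open>Polynomial growth is harmless where a factor exp (- t) is present. The delicate bounds
  concern t alone: the second t-derivative is at most 6 / t ^ 3, and since rt vanishes at X = 1 / t
  ^ 4, a lower bound of rt^2 by a multiple of X is claimed only from 2 / t ^ 4 on.\<close>

lemma sqrt_barrier_bounds:
  fixes t X :: real
  assumes t: "t \<ge> 1" and X: "X \<ge> 0"
  defines "r \<equiv> sqrt (t\<^sup>2 * X + 1 / t\<^sup>2)"
  defines "rt \<equiv> (t * X - 1 / t ^ 3) / r" and "rX \<equiv> t\<^sup>2 / (2 * r)"
  shows "r > 0" "r \<ge> t * sqrt X" "r \<le> t * sqrt X + 1 / t"
    "\<bar>rt\<bar> \<le> sqrt X + 1 / t\<^sup>2" "0 \<le> rX" "rX \<le> t ^ 3 / 2"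
    "0 \<le> (X + 3 / t ^ 4) / r - rt\<^sup>2 / r" "(X + 3 / t ^ 4) / r - rt\<^sup>2 / r \<le> 6 / t ^ 3"
    "\<bar>t / r - rt * rX / r\<bar> \<le> t\<^sup>2 + t ^ 4 / 2 * \<bar>rt\<bar>"
    "X \<ge> 2 / t ^ 4 \<Longrightarrow> rt\<^sup>2 \<ge> X / 6"
proof -
  have t0: "t > 0" using t by simp
  define a where "a = 1 / t"
  have a: "a > 0" "t * a = 1" "a \<le> 1" using t0 t by (auto simp: a_def)
  have pw: "1 / t\<^sup>2 = a\<^sup>2" "1 / t ^ 3 = a ^ 3" "3 / t ^ 4 = 3 * a ^ 4" "6 / t ^ 3 = 6 * a ^ 3" "2 / t ^ 4 = 2 * a ^ 4" "1 / t = a"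
    by (simp_all add: a_def power_divide)
  have r2: "r\<^sup>2 = t\<^sup>2 * X + a\<^sup>2" using X unfolding r_def pw by simp
  show r0: "r > 0" using X t0 unfolding r_def by (simp add: add_nonneg_pos)
  have ra: "r \<ge> a" by (rule power2_le_imp_le) (use r2 X r0 in auto)
  have ta: "t = 1 / a" using a by (simp add: field_simps)
  show rX': "r \<ge> t * sqrt X"
    by (rule power2_le_imp_le) (use r2 X r0 in \<open>auto simp: power_mult_distrib\<close>)
  show "r \<le> t * sqrt X + 1 / t" unfolding pw
    by (rule power2_le_imp_le) (use r2 X t0 a in \<open>auto simp: power2_sum power_mult_distrib\<close>)
  have ir: "1 / r \<le> t" using ra r0 a t0 by (simp add: ta frac_le)
  have rt: "rt = t * X / r - a ^ 3 / r" unfolding rt_def pw by (simp add: diff_divide_distrib)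
  have 1: "0 \<le> t * X / r" "t * X / r \<le> sqrt X"
  proof -
    show "0 \<le> t * X / r" using t0 X r0 by simp
    have "t * X = (t * sqrt X) * sqrt X" using X by simp
    also have "\<dots> \<le> r * sqrt X" using rX' X by (intro mult_right_mono) auto
    finally show "t * X / r \<le> sqrt X" using r0 by (simp add: divide_le_eq mult.commute)
  qed
  have 2: "0 \<le> a ^ 3 / r" "a ^ 3 / r \<le> a\<^sup>2"
    using a r0 ra mult_left_mono[OF ra, of "a\<^sup>2"] by (auto simp: divide_le_eq power2_eq_square power3_eq_cube)
  show "\<bar>rt\<bar> \<le> sqrt X + 1 / t\<^sup>2" unfolding rt pw using 1 2 by linarith
  show rX0: "0 \<le> rX" using r0 by (simp add: rX_def)
  have "t\<^sup>2 * (1 / r) \<le> t\<^sup>2 * t" using ir by (intro mult_left_mono) auto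
  then show rX3: "rX \<le> t ^ 3 / 2" by (simp add: rX_def power2_eq_square power3_eq_cube)
  \<comment> \<open>Over the common denominator the terms in X^2 cancel; with t * a = 1 the
    remaining numerator is small enough for the bound 6 / t ^ 3.\<close>
  have rtt: "(X + 3 / t ^ 4) / r - rt\<^sup>2 / r = (6 * a\<^sup>2 * X + 2 * a ^ 6) / (r * r\<^sup>2)"
  proof -
    have q: "rt\<^sup>2 * r\<^sup>2 = (t * X - a ^ 3)\<^sup>2" unfolding rt_def pw using r0 by (simp add: power_divide)
    have "A / r - B / r = (A * r\<^sup>2 - B * r\<^sup>2) / (r * r\<^sup>2)" for A B
      using r0 by (simp add: field_simps)
    then have "(X + 3 / t ^ 4) / r - rt\<^sup>2 / r = ((X + 3 * a ^ 4) * r\<^sup>2 - (t * X - a ^ 3)\<^sup>2) / (r * r\<^sup>2)"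
      unfolding pw q[symmetric] .
    also have "(X + 3 * a ^ 4) * r\<^sup>2 - (t * X - a ^ 3)\<^sup>2 = 6 * a\<^sup>2 * X + 2 * a ^ 6"
    proof -
      have "(X + 3 * a ^ 4) * r\<^sup>2 - (t * X - a ^ 3)\<^sup>2
          = a\<^sup>2 * X + 3 * (t * a)\<^sup>2 * a\<^sup>2 * X + 3 * a ^ 6 + 2 * (t * a) * a\<^sup>2 * X - a ^ 6"
        unfolding r2 by (simp add: algebra_simps power2_eq_square numeral_eq_Suc)
      then show ?thesis unfolding a(2) by simp
    qed
    finally show ?thesis .
  qed
  show "0 \<le> (X + 3 / t ^ 4) / r - rt\<^sup>2 / r" unfolding rtt using X r0 by simp
  show "(X + 3 / t ^ 4) / r - rt\<^sup>2 / r \<le> 6 / t ^ 3"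
  proof -
    have "6 * a\<^sup>2 * X + 2 * a ^ 6 \<le> 6 * a ^ 4 * r\<^sup>2"
    proof -
      have "6 * a ^ 4 * r\<^sup>2 = 6 * (t * a)\<^sup>2 * a\<^sup>2 * X + 6 * a ^ 6"
        unfolding r2 by (simp add: algebra_simps power2_eq_square numeral_eq_Suc)
      then show ?thesis unfolding a(2) using a by simp
    qed
    also have "\<dots> \<le> 6 * a ^ 3 * r * r\<^sup>2"
    proof -
      have "6 * a ^ 3 * a \<le> 6 * a ^ 3 * r" using ra a by (intro mult_left_mono) auto
      from mult_right_mono[OF this, of "r\<^sup>2"] show ?thesis by (simp add: numeral_eq_Suc mult_ac)
    qed
    finally show ?thesis unfolding rtt unfolding pw using r0 by (simp add: divide_le_eq mult_ac)
  qed
  show "\<bar>t / r - rt * rX / r\<bar> \<le> t\<^sup>2 + t ^ 4 / 2 * \<bar>rt\<bar>"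
  proof -
    have "\<bar>t / r - rt * rX / r\<bar> \<le> t * (1 / r) + \<bar>rt\<bar> * rX * (1 / r)"
      using abs_triangle_ineq4[of "t / r" "rt * rX / r"] t0 r0 rX0 by (simp add: abs_mult)
    also have "\<dots> \<le> t * t + \<bar>rt\<bar> * (t ^ 3 / 2) * t"
      using ir t0 r0 rX0 rX3 by (intro add_mono mult_mono) auto
    finally show ?thesis by (simp add: power2_eq_square numeral_eq_Suc mult_ac)
  qed
  show "rt\<^sup>2 \<ge> X / 6" if "X \<ge> 2 / t ^ 4"
  proof -
    have X2: "X \<ge> 2 * a ^ 4" using that unfolding pw .
    have "t * X \<ge> t * (2 * a ^ 4)" using X2 t0 by simp
    also have "t * (2 * a ^ 4) = 2 * (t * a) * a ^ 3" by (simp add: numeral_eq_Suc)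
    finally have "t * X \<ge> 2 * a ^ 3" using a(2) by simp
    then have "t * X - a ^ 3 \<ge> t * X / 2" by linarith
    then have n: "(t * X - a ^ 3)\<^sup>2 \<ge> (t * X / 2)\<^sup>2" using t0 X by (intro power_mono) auto
    have "t\<^sup>2 * X \<ge> t\<^sup>2 * (2 * a ^ 4)" using X2 t0 by simp
    also have "t\<^sup>2 * (2 * a ^ 4) = 2 * (t * a)\<^sup>2 * a\<^sup>2" by (simp add: numeral_eq_Suc power2_eq_square)
    finally have "t\<^sup>2 * X \<ge> 2 * a\<^sup>2" using a(2) by simp
    then have d: "r\<^sup>2 \<le> 3 / 2 * (t\<^sup>2 * X)" unfolding r2 by linarith
    have "X / 6 * r\<^sup>2 \<le> X / 6 * (3 / 2 * (t\<^sup>2 * X))" using d X by (intro mult_left_mono) auto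
    also have "\<dots> = (t * X / 2)\<^sup>2" by (simp add: power2_eq_square)
    also have "\<dots> \<le> (t * X - a ^ 3)\<^sup>2" by (rule n)
    finally have "X / 6 \<le> (t * X - a ^ 3)\<^sup>2 / r\<^sup>2" using r0 by (simp add: le_divide_eq)
    then show ?thesis unfolding rt_def pw by (simp add: power_divide)
  qed
qed

text \<open>The barrier is exp (- \<kappa> r) + 6 \<kappa> / t - 1 / 4 - \<mu> t with the smoothed
  r. The exponential has convexity of order \<kappa>^2 X in t, 6 \<kappa> / t pays for the smoothing
  of r, - 1 / 4 makes the sum nonpositive on X = R0^2, and the linear term ends the region at t = 2
  / \<mu> without affecting second derivatives. The constants come before \<mu>, which is chosen
  later according to the window.\<close>

lemma exponential_barrier:
  fixes K N R :: real
  assumes "K \<ge> 0" "N \<ge> 0" "R > 0"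
  obtains \<kappa> R0 T where "\<kappa> > 0" "0 < R0" "R0 \<le> R" "T \<ge> 1"
    "\<And>\<mu>. 0 \<le> \<mu> \<Longrightarrow> \<mu> \<le> 1 / 2 \<Longrightarrow> \<exists>g gt gX gtt gtX gXX.
      (\<forall>t X. t > 0 \<longrightarrow> X \<ge> 0 \<longrightarrow> has_partials g (gt t X) (gX t X) t X \<and>
        has_partials gt (gtt t X) (gtX t X) t X \<and> has_partials gX (gtX t X) (gXX t X) t X) \<and>
      (\<forall>t X. T \<le> t \<longrightarrow> 0 \<le> X \<longrightarrow> X \<le> R0\<^sup>2 \<longrightarrow>
        (g t X > 0 \<longrightarrow> reduced_op K N t X (g t X) (gt t X) (gtt t X) (gX t X) (gtX t X) (gXX t X) > 0) \<and>
        (X = R0\<^sup>2 \<longrightarrow> g t X \<le> 0) \<and> (\<mu> * t \<ge> 2 \<longrightarrow> g t X \<le> 0) \<and> g t X \<le> 2 \<and>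
        (16 * \<kappa>\<^sup>2 * t\<^sup>2 * X \<le> 1 \<longrightarrow> \<mu> * t \<le> 1 / 8 \<longrightarrow> g t X \<ge> 1 / 8))"
proof -
  \<comment> \<open>Half of \<open>gtt\<close> contributes \<kappa>^2 X / 96, which has to exceed
    the loss 3 K X; 288 = 3 * 96.\<close>
  define \<kappa> where "\<kappa> = sqrt (288 * K + 1)"
  have \<kappa>: "\<kappa> \<ge> 1" "\<kappa>\<^sup>2 = 288 * K + 1" using assms(1) by (auto simp: \<kappa>_def)
  \<comment> \<open>The bound 1 / (4 \<kappa>) serves to keep |gt| at most 1, the bound 1 / (2 (K +
    1)) to let half of \<open>gtt\<close> absorb the error proportional to \<open>gtt\<close>
    itself.\<close>
  define R0 where "R0 = min R (min (1 / (4 * \<kappa>)) (min 1 (1 / (2 * (K + 1)))))"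
  have "0 < 1 / (4 * \<kappa>)" "0 < 1 / (2 * (K + 1))" using assms \<kappa> by auto
  then have R0: "0 < R0" "R0 \<le> R" "R0 \<le> 1 / (4 * \<kappa>)" "R0 \<le> 1" "R0 \<le> 1 / (2 * (K + 1))"
    unfolding R0_def using assms(3) by linarith+
  have R0': "\<kappa> * R0 \<le> 1 / 4" "K * R0\<^sup>2 \<le> 1 / 4"
  proof -
    show "\<kappa> * R0 \<le> 1 / 4" using R0(3) \<kappa>(1) by (simp add: le_divide_eq mult.commute)
    have "R0\<^sup>2 \<le> (1 / (2 * (K + 1)))\<^sup>2" using R0 by (intro power_mono) auto
    then have "K * R0\<^sup>2 \<le> K * (1 / (2 * (K + 1)))\<^sup>2" using assms(1) by (intro mult_left_mono)
    also have "\<dots> \<le> 1 / 4"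
      using assms(1) by (simp add: power2_eq_square divide_simps) (simp add: algebra_simps)
    finally show "K * R0\<^sup>2 \<le> 1 / 4" .
  qed
  have lim: "\<forall>\<^sub>F t in at_top. K * exp (- t) \<le> 1 / 4"
    "\<forall>\<^sub>F t in at_top. exp (- (\<kappa> * R0 * t)) \<le> 1 / 8"
    "\<forall>\<^sub>F t in at_top. exp (- t) * (3 * K + 2 * K * (\<kappa>\<^sup>2 * t ^ 3 + \<kappa> * (t\<^sup>2 + t ^ 4) + \<kappa> * (t ^ 3 / 2))
        + N * \<kappa> * t ^ 3) * t ^ 3 < 3 / 2 * \<kappa>"
  proof -
    have "((\<lambda>t::real. K * exp (- t)) \<longlongrightarrow> 0) at_top" by real_asymp
    from order_tendstoD(2)[OF this, of "1 / 4"] have "\<forall>\<^sub>F t in at_top. K * exp (- t) < 1 / 4" by simp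
    then show "\<forall>\<^sub>F t in at_top. K * exp (- t) \<le> 1 / 4" by eventually_elim simp
    define a where "a = \<kappa> * R0"
    have "a > 0" using \<kappa> R0 by (simp add: a_def)
    then have "((\<lambda>t::real. exp (- (a * t))) \<longlongrightarrow> 0) at_top" by real_asymp
    then have "((\<lambda>t::real. exp (- (\<kappa> * R0 * t))) \<longlongrightarrow> 0) at_top" by (simp add: a_def)
    from order_tendstoD(2)[OF this, of "1 / 8"] have "\<forall>\<^sub>F t in at_top. exp (- (\<kappa> * R0 * t)) < 1 / 8" by simp
    then show "\<forall>\<^sub>F t in at_top. exp (- (\<kappa> * R0 * t)) \<le> 1 / 8" by eventually_elim simp
    \<comment> \<open>All remaining errors carry exp (- t). They are compared with 3 / 2 \<kappa> /
      t ^ 3, which is half of the part of \<open>gtt\<close> that does not depend on X.\<close>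
    have "((\<lambda>t::real. exp (- t) * (3 * K + 2 * K * (\<kappa>\<^sup>2 * t ^ 3 + \<kappa> * (t\<^sup>2 + t ^ 4) + \<kappa> * (t ^ 3 / 2))
        + N * \<kappa> * t ^ 3) * t ^ 3) \<longlongrightarrow> 0) at_top" by real_asymp
    then show "\<forall>\<^sub>F t in at_top. exp (- t) * (3 * K + 2 * K * (\<kappa>\<^sup>2 * t ^ 3 + \<kappa> * (t\<^sup>2 + t ^ 4) + \<kappa> * (t ^ 3 / 2))
        + N * \<kappa> * t ^ 3) * t ^ 3 < 3 / 2 * \<kappa>"
      using order_tendstoD(2)[of _ 0 at_top "3 / 2 * \<kappa>"] \<kappa> by auto
  qed
  obtain T0 where T0: "\<And>t. t \<ge> T0 \<Longrightarrow> K * exp (- t) \<le> 1 / 4" "\<And>t. t \<ge> T0 \<Longrightarrow> exp (- (\<kappa> * R0 * t)) \<le> 1 / 8"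
    "\<And>t. t \<ge> T0 \<Longrightarrow> exp (- t) * (3 * K + 2 * K * (\<kappa>\<^sup>2 * t ^ 3 + \<kappa> * (t\<^sup>2 + t ^ 4) + \<kappa> * (t ^ 3 / 2))
        + N * \<kappa> * t ^ 3) * t ^ 3 < 3 / 2 * \<kappa>"
    using eventually_conj[OF lim(1) eventually_conj[OF lim(2,3)]] unfolding eventually_at_top_linorder by blast
  \<comment> \<open>From 48 \<kappa> on, 6 \<kappa> / t is at most 1 / 8: together with the
    exponential, also at most 1 / 8 on X = R0^2, it is offset by the constant 1 / 4.\<close>
  define T where "T = max T0 (48 * \<kappa>)"
  show ?thesis
  proof (rule that[of \<kappa> R0 T])
    show "\<kappa> > 0" "0 < R0" "R0 \<le> R" "T \<ge> 1" using \<kappa> R0 by (auto simp: T_def)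
    fix \<mu> :: real assume \<mu>: "0 \<le> \<mu>" "\<mu> \<le> 1 / 2"
    define r where "r t X = sqrt (t\<^sup>2 * X + 1 / t\<^sup>2)" for t X :: real
    define rt where "rt t X = (t * X - 1 / t ^ 3) / r t X" for t X
    define rX where "rX t X = t\<^sup>2 / (2 * r t X)" for t X
    define rtt where "rtt t X = (X + 3 / t ^ 4) / r t X - (rt t X)\<^sup>2 / r t X" for t X
    define rtX where "rtX t X = t / r t X - rt t X * rX t X / r t X" for t X
    define ee where "ee t X = exp (- \<kappa> * r t X)" for t X
    define g where "g t X = ee t X + 6 * \<kappa> * (1 / t) - 1 / 4 - \<mu> * t" for t X
    define gt where "gt t X = - \<kappa> * (rt t X * ee t X) - 6 * \<kappa> * (1 / t\<^sup>2) - \<mu>" for t X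
    define gX where "gX t X = - \<kappa> * (rX t X * ee t X)" for t X
    define gtt where "gtt t X = ee t X * (\<kappa>\<^sup>2 * (rt t X)\<^sup>2 - \<kappa> * rtt t X) + 12 * \<kappa> / t ^ 3" for t X
    define gtX where "gtX t X = ee t X * (\<kappa>\<^sup>2 * (rt t X * rX t X) - \<kappa> * rtX t X)" for t X
    define gXX where "gXX t X = ee t X * (\<kappa>\<^sup>2 * (rX t X)\<^sup>2 + \<kappa> * ((rX t X)\<^sup>2 / r t X))" for t X
    have P: "has_partials g (gt t X) (gX t X) t X" "has_partials gt (gtt t X) (gtX t X) t X"
      "has_partials gX (gtX t X) (gXX t X) t X" if tX: "t > 0" "X \<ge> 0" for t X
    proof -
      note h = has_partials_sqrt_barrier[OF tX, folded r_def, folded rt_def rX_def, folded rtt_def rtX_def]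
      have pe: "has_partials ee (- \<kappa> * rt t X * ee t X) (- \<kappa> * rX t X * ee t X) t X"
      proof -
        have "((\<lambda>s. exp (- \<kappa> * s)) has_real_derivative ee t X * - \<kappa>) (at (r t X))"
          unfolding ee_def by (auto intro!: derivative_eq_intros)
        from has_partials_compose[OF h(1)[unfolded r_def[symmetric]] this]
        show ?thesis unfolding ee_def[symmetric] by (elim has_partials_cong) auto
      qed
      have d: "has_partials (\<lambda>t X. 1 / t) (- (1 / t\<^sup>2)) 0 t X" "has_partials (\<lambda>t X. 1 / t\<^sup>2) (- (2 / t ^ 3)) 0 t X"
      proof -
        have "((\<lambda>t. 1 / t) has_real_derivative - (1 / t\<^sup>2)) (at t)" "((\<lambda>t. 1 / t\<^sup>2) has_real_derivative - (2 / t ^ 3)) (at t)"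
          using tX(1) by (auto intro!: derivative_eq_intros simp: field_simps power2_eq_square power3_eq_cube)
        from this[THEN has_partials_compose[OF has_partials_fst]]
        show "has_partials (\<lambda>t X. 1 / t) (- (1 / t\<^sup>2)) 0 t X" "has_partials (\<lambda>t X. 1 / t\<^sup>2) (- (2 / t ^ 3)) 0 t X" by simp_all
      qed
      show "has_partials g (gt t X) (gX t X) t X"
        unfolding g_def
        by (rule has_partials_cong[OF has_partials_diff[OF has_partials_diff[OF has_partials_add[OF pe
            has_partials_mult[OF has_partials_const d(1)]] has_partials_const] has_partials_mult[OF has_partials_const has_partials_fst]]])
          (auto simp: gt_def gX_def)
      show "has_partials gt (gtt t X) (gtX t X) t X"
        unfolding gt_def
        by (rule has_partials_cong[OF has_partials_diff[OF has_partials_diff[OF has_partials_mult[OF has_partials_const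
            has_partials_mult[OF h(2) pe]] has_partials_mult[OF has_partials_const d(2)]] has_partials_const]])
          (auto simp: gtt_def gtX_def algebra_simps power2_eq_square)
      show "has_partials gX (gtX t X) (gXX t X) t X"
        unfolding gX_def
        by (rule has_partials_cong[OF has_partials_mult[OF has_partials_const has_partials_mult[OF h(3) pe]]])
          (auto simp: gXX_def gtX_def algebra_simps power2_eq_square)
    qed
    have Q: "(g t X > 0 \<longrightarrow> reduced_op K N t X (g t X) (gt t X) (gtt t X) (gX t X) (gtX t X) (gXX t X) > 0) \<and>
        (X = R0\<^sup>2 \<longrightarrow> g t X \<le> 0) \<and> (\<mu> * t \<ge> 2 \<longrightarrow> g t X \<le> 0) \<and> g t X \<le> 2 \<and>
        (16 * \<kappa>\<^sup>2 * t\<^sup>2 * X \<le> 1 \<longrightarrow> \<mu> * t \<le> 1 / 8 \<longrightarrow> g t X \<ge> 1 / 8)"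
      if t: "T \<le> t" and X: "0 \<le> X" "X \<le> R0\<^sup>2" for t X
    proof -
      have t48: "t \<ge> 48 * \<kappa>" "t \<ge> T0" "t \<ge> 1" using t \<kappa> by (auto simp: T_def)
      note b = sqrt_barrier_bounds[OF t48(3) X(1), folded r_def, folded rt_def rX_def, folded rtt_def rtX_def]
      have sX: "sqrt X \<le> R0" using X R0 by (simp add: real_le_lsqrt)
      have t0: "t > 0" using t48 by simp
      have kt: "6 * \<kappa> * (1 / t) \<le> 1 / 8" "6 * \<kappa> * (1 / t) \<ge> 0" using t48(1) t0 \<kappa> by (auto simp: divide_le_eq)
      have ee: "0 < ee t X" "ee t X \<le> 1" using b(1) \<kappa> by (auto simp: ee_def)
      have \<mu>t: "\<mu> * t \<ge> 0" using \<mu> t0 by simp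
      have c2: "g t X \<le> 2" using ee kt \<mu>t by (simp add: g_def)
      have cR: "g t X \<le> 0" if "X = R0\<^sup>2"
      proof -
        have "R0 * t \<le> r t X" using b(2) that R0 by (simp add: mult.commute)
        then have "\<kappa> * R0 * t \<le> \<kappa> * r t X" using \<kappa> by (simp add: mult.assoc)
        then have "ee t X \<le> exp (- (\<kappa> * R0 * t))" by (simp add: ee_def)
        then show ?thesis using T0(2)[OF t48(2)] kt \<mu>t by (simp add: g_def)
      qed
      have c\<mu>: "g t X \<le> 0" if "\<mu> * t \<ge> 2" using that ee kt by (simp add: g_def)
      have low: "g t X \<ge> 1 / 8" if "16 * \<kappa>\<^sup>2 * t\<^sup>2 * X \<le> 1" "\<mu> * t \<le> 1 / 8"
      proof -
        have "(4 * \<kappa> * (t * sqrt X))\<^sup>2 \<le> 1" using that(1) X(1) by (simp add: power_mult_distrib mult_ac)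
        then have "4 * \<kappa> * (t * sqrt X) \<le> 1" by (simp add: power2_le_imp_le[of _ 1, simplified])
        moreover have "\<kappa> * r t X \<le> \<kappa> * (t * sqrt X) + \<kappa> * (1 / t)"
          using mult_left_mono[OF b(3), of \<kappa>] \<kappa> by (simp add: distrib_left)
        moreover have "\<kappa> * (1 / t) \<le> 1 / 4" using kt by simp
        ultimately have "\<kappa> * r t X \<le> 1 / 2" by linarith
        moreover have "ee t X \<ge> 1 + (- \<kappa> * r t X)" unfolding ee_def by (rule exp_ge_add_one_self)
        ultimately have "ee t X \<ge> 1 / 2" by simp
        then show ?thesis using kt that(2) by (simp add: g_def)
      qed
      have op: "reduced_op K N t X (g t X) (gt t X) (gtt t X) (gX t X) (gtX t X) (gXX t X) > 0" if gpos: "g t X > 0"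
      proof -
        define \<eta> where "\<eta> = X + exp (- t)"
        have \<eta>: "0 \<le> \<eta>" "\<eta> \<le> 2" "K * \<eta> \<le> 1 / 2"
        proof -
          show "0 \<le> \<eta>" using X by (simp add: \<eta>_def)
          have "R0\<^sup>2 \<le> 1" using R0 by (simp add: power_le_one)
          moreover have "exp (- t) \<le> 1" using t0 by simp
          ultimately show "\<eta> \<le> 2" unfolding \<eta>_def using X by linarith
          have "K * X \<le> K * R0\<^sup>2" using X assms(1) by (intro mult_left_mono)
          then show "K * \<eta> \<le> 1 / 2" using R0'(2) T0(1)[OF t48(2)] by (simp add: \<eta>_def distrib_left)
        qed
        \<comment> \<open>Positivity of g forces the exponential to be at least 1 / 8, so its
          convexity is bounded below where it is needed.\<close>
        have e8: "ee t X \<ge> 1 / 8" using gpos kt \<mu>t by (simp add: g_def)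
        have k0: "\<kappa> > 0" using \<kappa> by simp
        have t3: "1 / t ^ 3 > 0" using t0 by simp
        \<comment> \<open>The second derivative of 6 \<kappa> / t is 12 \<kappa> / t ^ 3; half of it
          covers the loss \<kappa> \<open>rtt\<close> caused by the convexity of r.\<close>
        have gtt0: "gtt t X \<ge> \<kappa>\<^sup>2 * (rt t X)\<^sup>2 / 8 + 6 * \<kappa> / t ^ 3"
        proof -
          have "ee t X * (\<kappa>\<^sup>2 * (rt t X)\<^sup>2) \<ge> 1 / 8 * (\<kappa>\<^sup>2 * (rt t X)\<^sup>2)" using e8 by (intro mult_right_mono) auto
          moreover have "ee t X * (\<kappa> * rtt t X) \<le> 1 * (\<kappa> * (6 / t ^ 3))"
            using ee b(7,8) k0 t0 by (intro mult_mono) auto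
          ultimately show ?thesis by (simp add: gtt_def right_diff_distrib)
        qed
        \<comment> \<open>For X \<ge> 2 / t ^ 4 the gain comes from rt. For smaller X the required
          \<kappa>^2 X / 48 is itself only a fraction of \<kappa> / t ^ 3.\<close>
        have gttX: "gtt t X \<ge> \<kappa>\<^sup>2 * X / 48 + 3 * \<kappa> / t ^ 3"
        proof (cases "X \<ge> 2 / t ^ 4")
          case True
          have "\<kappa>\<^sup>2 * (X / 6) \<le> \<kappa>\<^sup>2 * (rt t X)\<^sup>2" using b(10)[OF True] by (intro mult_left_mono) auto
          moreover have "3 * \<kappa> / t ^ 3 \<le> 6 * \<kappa> / t ^ 3" using k0 t0 by (intro divide_right_mono) auto
          ultimately show ?thesis using gtt0 by linarith
        next
          case False
          have "\<kappa>\<^sup>2 * X \<le> \<kappa>\<^sup>2 * (2 / t ^ 4)" using False by (intro mult_left_mono) auto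
          also have "\<dots> = 2 * \<kappa> * (\<kappa> * (1 / t)) * (1 / t ^ 3)"
            by (simp add: power2_eq_square numeral_eq_Suc)
          also have "\<dots> \<le> 2 * \<kappa> * 1 * (1 / t ^ 3)"
            using kt k0 t0 by (intro mult_right_mono mult_left_mono) auto
          finally have "\<kappa>\<^sup>2 * X \<le> 2 * (\<kappa> / t ^ 3)" by simp
          moreover have "\<kappa> / t ^ 3 \<ge> 0" using k0 t0 by simp
          moreover have "\<kappa>\<^sup>2 * (rt t X)\<^sup>2 \<ge> 0" by simp
          moreover have "3 * \<kappa> / t ^ 3 = 3 * (\<kappa> / t ^ 3)" "6 * \<kappa> / t ^ 3 = 6 * (\<kappa> / t ^ 3)" by simp_all
          ultimately show ?thesis using gtt0 by linarith
        qed
        have it: "1 / t \<le> 1" "1 / t\<^sup>2 \<le> 1 / t" using t48(3) by (auto simp: divide_simps power2_eq_square)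
        have rt1: "\<bar>rt t X\<bar> \<le> R0 + 1 / t" "\<bar>rt t X\<bar> \<le> 2" using b(4) sX it R0 by linarith+
        have gt1: "\<bar>gt t X\<bar> \<le> 1"
        proof -
          have "\<bar>gt t X\<bar> \<le> \<kappa> * (\<bar>rt t X\<bar> * ee t X) + 6 * \<kappa> * (1 / t\<^sup>2) + \<mu>"
            unfolding gt_def using k0 ee \<mu>
            by (intro order.trans[OF abs_triangle_ineq4] add_mono) (auto simp: abs_mult)
          moreover have "\<kappa> * (\<bar>rt t X\<bar> * ee t X) \<le> \<kappa> * ((R0 + 1 / t) * 1)"
            using k0 ee rt1 R0 t0 by (intro mult_left_mono mult_mono) auto
          moreover have "6 * \<kappa> * (1 / t\<^sup>2) \<le> 6 * \<kappa> * (1 / t)" using it k0 by (intro mult_left_mono) auto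
          moreover have "\<kappa> * ((R0 + 1 / t) * 1) = \<kappa> * R0 + \<kappa> * (1 / t)" by (simp add: distrib_left)
          ultimately show ?thesis using R0'(1) kt \<mu> by linarith
        qed
        have gX1: "\<bar>gX t X\<bar> \<le> \<kappa> * (t ^ 3 / 2)"
        proof -
          have "\<bar>gX t X\<bar> = \<kappa> * (rX t X * ee t X)" using k0 ee b(5) by (simp add: gX_def abs_mult)
          also have "\<dots> \<le> \<kappa> * (t ^ 3 / 2 * 1)" using k0 ee b(5,6) t0 by (intro mult_left_mono mult_mono) auto
          finally show ?thesis by simp
        qed
        have gtX1: "\<bar>gtX t X\<bar> \<le> \<kappa>\<^sup>2 * t ^ 3 + \<kappa> * (t\<^sup>2 + t ^ 4)"
        proof -
          have "\<bar>rt t X * rX t X\<bar> \<le> 2 * (t ^ 3 / 2)"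
            unfolding abs_mult using rt1 b(5,6) by (intro mult_mono) auto
          then have 1: "\<kappa>\<^sup>2 * \<bar>rt t X * rX t X\<bar> \<le> \<kappa>\<^sup>2 * t ^ 3" by (intro mult_left_mono) auto
          have "t ^ 4 / 2 * \<bar>rt t X\<bar> \<le> t ^ 4 / 2 * 2" using rt1 t0 by (intro mult_left_mono) auto
          then have "\<bar>rtX t X\<bar> \<le> t\<^sup>2 + t ^ 4" using b(9) by simp
          then have 2: "\<kappa> * \<bar>rtX t X\<bar> \<le> \<kappa> * (t\<^sup>2 + t ^ 4)" using k0 by (intro mult_left_mono) auto
          have "\<bar>gtX t X\<bar> \<le> 1 * (\<kappa>\<^sup>2 * \<bar>rt t X * rX t X\<bar> + \<kappa> * \<bar>rtX t X\<bar>)"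
            unfolding gtX_def abs_mult[of "ee t X"] using ee k0
              abs_triangle_ineq4[of "\<kappa>\<^sup>2 * (rt t X * rX t X)" "\<kappa> * rtX t X"]
            by (intro mult_mono) (auto simp: abs_mult)
          then show ?thesis using 1 2 by simp
        qed
        have gXX0: "4 * X * gXX t X \<ge> 0" using X ee k0 b(1) by (simp add: gXX_def)
        have diff: "(exp (- t))\<^sup>2 * (4 * X * gXX t X + 2 * N * gX t X) \<ge> - (exp (- t) * (N * \<kappa> * t ^ 3))"
        proof -
          have "2 * N * gX t X \<ge> - (2 * N * (\<kappa> * (t ^ 3 / 2)))"
            using mult_left_mono[OF gX1, of "2 * N"] assms(2) by (simp add: abs_le_iff) (smt (verit) abs_ge_minus_self mult_left_mono mult_minus_right)
          then have "4 * X * gXX t X + 2 * N * gX t X \<ge> - (N * \<kappa> * t ^ 3)" using gXX0 by simp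
          then have "(exp (- t))\<^sup>2 * (4 * X * gXX t X + 2 * N * gX t X) \<ge> (exp (- t))\<^sup>2 * - (N * \<kappa> * t ^ 3)"
            by (intro mult_left_mono) auto
          moreover have "(exp (- t))\<^sup>2 * (N * \<kappa> * t ^ 3) \<le> exp (- t) * (N * \<kappa> * t ^ 3)"
            using assms(2) k0 t0 by (intro mult_right_mono) (auto simp: power2_eq_square mult_left_le)
          ultimately show ?thesis by simp
        qed
        have m1: "K * \<eta> * (\<bar>gtt t X\<bar> + \<bar>gt t X\<bar> + \<bar>g t X\<bar>) \<le> gtt t X / 2 + 3 * (K * \<eta>)"
        proof -
          have gp: "gtt t X \<ge> 0" using gttX X k0 t0 by (smt (verit) divide_nonneg_nonneg mult_nonneg_nonneg zero_le_power2 zero_less_power)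
          have "K * \<eta> * \<bar>gtt t X\<bar> \<le> 1 / 2 * gtt t X" using \<eta>(3) gp by (intro mult_mono) auto
          moreover have "K * \<eta> * (\<bar>gt t X\<bar> + \<bar>g t X\<bar>) \<le> K * \<eta> * 3"
            using gt1 c2 gpos assms(1) \<eta>(1) by (intro mult_left_mono) auto
          ultimately show ?thesis by (simp add: distrib_left add.assoc)
        qed
        have m2: "K * (exp (- t) * \<eta>) * (\<bar>gtX t X\<bar> + \<bar>gX t X\<bar>)
            \<le> exp (- t) * (2 * K * (\<kappa>\<^sup>2 * t ^ 3 + \<kappa> * (t\<^sup>2 + t ^ 4) + \<kappa> * (t ^ 3 / 2)))"
        proof -
          have "K * (exp (- t) * \<eta>) * (\<bar>gtX t X\<bar> + \<bar>gX t X\<bar>)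
              \<le> K * (exp (- t) * 2) * (\<kappa>\<^sup>2 * t ^ 3 + \<kappa> * (t\<^sup>2 + t ^ 4) + \<kappa> * (t ^ 3 / 2))"
            using gX1 gtX1 \<eta> assms(1) by (intro mult_mono mult_left_mono) auto
          then show ?thesis by (simp only: mult_ac)
        qed
        have m3: "exp (- t) * (3 * K) + exp (- t) * (2 * K * (\<kappa>\<^sup>2 * t ^ 3 + \<kappa> * (t\<^sup>2 + t ^ 4) + \<kappa> * (t ^ 3 / 2)))
            + exp (- t) * (N * \<kappa> * t ^ 3) < 3 / 2 * \<kappa> / t ^ 3"
          using T0(3)[OF t48(2)] t0 by (simp add: less_divide_eq distrib_left)
        have m4: "3 * (K * \<eta>) = 3 * K * X + exp (- t) * (3 * K)" by (simp add: \<eta>_def algebra_simps)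
        have m5: "3 * K * X \<le> \<kappa>\<^sup>2 * X / 96" using X assms(1) by (simp add: \<kappa>(2) algebra_simps)
        show ?thesis unfolding reduced_op_def \<eta>_def[symmetric]
          using m1 m2 m3 m4 m5 diff gttX by linarith
      qed
      show ?thesis using op cR c\<mu> c2 low by blast
    qed
    show "\<exists>g gt gX gtt gtX gXX.
      (\<forall>t X. t > 0 \<longrightarrow> X \<ge> 0 \<longrightarrow> has_partials g (gt t X) (gX t X) t X \<and>
        has_partials gt (gtt t X) (gtX t X) t X \<and> has_partials gX (gtX t X) (gXX t X) t X) \<and>
      (\<forall>t X. T \<le> t \<longrightarrow> 0 \<le> X \<longrightarrow> X \<le> R0\<^sup>2 \<longrightarrow>
        (g t X > 0 \<longrightarrow> reduced_op K N t X (g t X) (gt t X) (gtt t X) (gX t X) (gtX t X) (gXX t X) > 0) \<and>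
        (X = R0\<^sup>2 \<longrightarrow> g t X \<le> 0) \<and> (\<mu> * t \<ge> 2 \<longrightarrow> g t X \<le> 0) \<and> g t X \<le> 2 \<and>
        (16 * \<kappa>\<^sup>2 * t\<^sup>2 * X \<le> 1 \<longrightarrow> \<mu> * t \<le> 1 / 8 \<longrightarrow> g t X \<ge> 1 / 8))"
      by (rule exI[of _ g], rule exI[of _ gt], rule exI[of _ gX], rule exI[of _ gtt], rule exI[of _ gtX], rule exI[of _ gXX])
        (intro conjI[OF _ allI[OF allI[OF impI[OF impI[OF impI[OF Q]]]]]] allI impI conjI P)
  qed
qed

text \<open>Both factors are squared because near its zeros the bump must pay for errors that are
  not proportional to it. Where the sine vanishes, its square still has a positive second
  derivative, and where D = 1 - X / R^2 is small, \<open>gXX\<close> supplies a positive term; where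
  \<open>gtt\<close> is negative, c g compensates. The condition exp (- \<tau>) \<le> R^2 makes X +
  exp (- t) of order R^2.\<close>

lemma sine_bump:
  fixes K N c :: real
  assumes "K \<ge> 0" "N \<ge> 0" "c > 0"
  obtains \<omega> R1 where "0 < \<omega>" "0 < R1"
    "\<And>R \<tau>. 0 < R \<Longrightarrow> R \<le> R1 \<Longrightarrow> exp (- \<tau>) \<le> R\<^sup>2 \<Longrightarrow> \<exists>g gt gX gtt gtX gXX.
      (\<forall>t X. has_partials g (gt t X) (gX t X) t X \<and>
        has_partials gt (gtt t X) (gtX t X) t X \<and> has_partials gX (gtX t X) (gXX t X) t X) \<and>
      (\<forall>t X. g t X = (sin (\<omega> * (t - \<tau>)))\<^sup>2 * (1 - X / R\<^sup>2)\<^sup>2) \<and>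
      (\<forall>t X. \<tau> \<le> t \<longrightarrow> 0 \<le> X \<longrightarrow> X < R\<^sup>2 \<longrightarrow>
        reduced_op K N t X (g t X) (gt t X) (gtt t X) (gX t X) (gtX t X) (gXX t X) + c * g t X > 0)"
proof -
  \<comment> \<open>\<open>gtt + c * g\<close> equals 2 \<omega>^2 D^2 + (c - 4 \<omega>^2) g, so
    the bracket must be nonnegative for the first summand to be available against the
    errors.\<close>
  define \<omega> where "\<omega> = min 1 (sqrt (c / 8))"
  have \<omega>: "0 < \<omega>" "\<omega> \<le> 1" using assms by (auto simp: \<omega>_def)
  have "\<omega>\<^sup>2 \<le> (sqrt (c / 8))\<^sup>2" using \<omega> by (intro power_mono) (auto simp: \<omega>_def)
  then have \<omega>c: "8 * \<omega>\<^sup>2 \<le> c" using assms by simp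
  \<comment> \<open>Makes K R, R and (2 + N) R small multiples of \<omega>, as unpacked in
    \<open>b1\<close>, \<open>b2\<close> and \<open>b3\<close>.\<close>
  define R1 where "R1 = \<omega> / (20 * (K + 1) + 2 * (2 + N))"
  have dpos: "20 * (K + 1) + 2 * (2 + N) > 0" using assms by simp
  have R1: "0 < R1" using \<omega> dpos by (simp add: R1_def)
  show ?thesis
  proof (rule that[OF \<omega>(1) R1])
    fix R \<tau> :: real assume R: "0 < R" "R \<le> R1" and \<tau>: "exp (- \<tau>) \<le> R\<^sup>2"
    have Rd: "R * (20 * (K + 1) + 2 * (2 + N)) \<le> \<omega>"
      using R(2) dpos by (simp add: R1_def le_divide_eq)
    have R20: "20 * (K * R) + 20 * R + 2 * (2 + N) * R \<le> \<omega>" using Rd by (simp add: algebra_simps)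
    have nn: "K * R \<ge> 0" "(2 + N) * R \<ge> 0" "R \<ge> 0" using assms R by auto
    have b1: "20 * (K * R) \<le> \<omega>" "2 * ((2 + N) * R) \<le> \<omega>" "R \<le> \<omega>" "R \<le> 1" using R20 nn \<omega> by linarith+
    have b2: "20 * (K * R\<^sup>2) \<le> \<omega>\<^sup>2" using mult_mono[OF b1(1,3)] nn \<omega> by (simp add: power2_eq_square mult_ac)
    have b3: "4 * ((2 + N)\<^sup>2 * R\<^sup>2) \<le> \<omega>\<^sup>2"
      using power_mono[OF b1(2), of 2] nn by (simp add: power_mult_distrib)
    define S where "S t = sin (\<omega> * (t - \<tau>))" for t
    define Co where "Co t = cos (\<omega> * (t - \<tau>))" for t
    define d where "d X = 1 - X / R\<^sup>2" for X :: real
    define g where "g t X = (S t)\<^sup>2 * (d X)\<^sup>2" for t X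
    define gt where "gt t X = 2 * \<omega> * (S t * Co t) * (d X)\<^sup>2" for t X
    define gX where "gX t X = - 2 / R\<^sup>2 * ((S t)\<^sup>2 * d X)" for t X
    define gtt where "gtt t X = 2 * \<omega>\<^sup>2 * ((Co t)\<^sup>2 - (S t)\<^sup>2) * (d X)\<^sup>2" for t X
    define gtX where "gtX t X = - 4 * \<omega> / R\<^sup>2 * (S t * Co t) * d X" for t X
    define gXX where "gXX t X = 2 / R\<^sup>2 * ((S t)\<^sup>2 / R\<^sup>2)" for t X :: real
    have pS: "has_partials (\<lambda>t X. S t) (\<omega> * Co t) 0 t X" and pC: "has_partials (\<lambda>t X. Co t) (- \<omega> * S t) 0 t X" for t X
    proof -
      have "(S has_real_derivative \<omega> * Co t) (at t)" "(Co has_real_derivative - \<omega> * S t) (at t)"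
        unfolding S_def[abs_def] Co_def[abs_def] by (auto intro!: derivative_eq_intros)
      from this[THEN has_partials_compose[OF has_partials_fst]]
      show "has_partials (\<lambda>t X. S t) (\<omega> * Co t) 0 t X" "has_partials (\<lambda>t X. Co t) (- \<omega> * S t) 0 t X" by auto
    qed
    have pd: "has_partials (\<lambda>t X. d X) 0 (- (1 / R\<^sup>2)) t X" for t X
    proof -
      have "(d has_real_derivative - (1 / R\<^sup>2)) (at X)"
        unfolding d_def[abs_def] using R by (auto intro!: derivative_eq_intros simp: field_simps power2_eq_square)
      from has_partials_compose[OF has_partials_snd this] show ?thesis by simp
    qed
    have P: "has_partials g (gt t X) (gX t X) t X" "has_partials gt (gtt t X) (gtX t X) t X"
      "has_partials gX (gtX t X) (gXX t X) t X" for t X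
    proof -
      show "has_partials g (gt t X) (gX t X) t X"
        unfolding g_def power2_eq_square
        by (rule has_partials_cong[OF has_partials_mult[OF has_partials_mult[OF pS pS] has_partials_mult[OF pd pd]]])
          (auto simp: gt_def gX_def power2_eq_square)
      show "has_partials gt (gtt t X) (gtX t X) t X"
        unfolding gt_def power2_eq_square[of "d _"]
        by (rule has_partials_cong[OF has_partials_mult[OF has_partials_mult[OF has_partials_const has_partials_mult[OF pS pC]]
            has_partials_mult[OF pd pd]]])
          (auto simp: gtt_def gtX_def power2_eq_square algebra_simps)
      show "has_partials gX (gtX t X) (gXX t X) t X"
        unfolding gX_def power2_eq_square[of "S _"]
        by (rule has_partials_cong[OF has_partials_mult[OF has_partials_const has_partials_mult[OF has_partials_mult[OF pS pS] pd]]])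
          (auto simp: gtX_def gXX_def power2_eq_square)
    qed
    have Q: "reduced_op K N t X (g t X) (gt t X) (gtt t X) (gX t X) (gtX t X) (gXX t X) + c * g t X > 0"
      if t: "\<tau> \<le> t" and X: "0 \<le> X" "X < R\<^sup>2" for t X
    proof -
      define D where "D = d X"
      define s where "s = \<bar>S t\<bar>"
      \<comment> \<open>E^2 measures the terms with \<open>gXX\<close> and \<open>gX\<close> after
        their factor exp (- 2 t). From exp (- t) \<le> R^2 it follows that E \<le> R.\<close>
      define E where "E = exp (- t) * s / R"
      have D: "0 < D" "D \<le> 1" "X = R\<^sup>2 * (1 - D)" using X R by (auto simp: D_def d_def divide_less_eq)
      have sc: "0 \<le> s" "s \<le> 1" "\<bar>Co t\<bar> \<le> 1" "(Co t)\<^sup>2 = 1 - s\<^sup>2" "(S t)\<^sup>2 = s\<^sup>2"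
        using sin_cos_squared_add[of "\<omega> * (t - \<tau>)"] by (auto simp: s_def S_def Co_def algebra_simps)
      have s1: "s\<^sup>2 \<le> 1" "s * \<bar>Co t\<bar> \<le> s" "s\<^sup>2 \<le> s" using power_le_one[OF sc(1,2), of 2] mult_left_le[OF sc(3,1)] mult_left_le[OF sc(2,1)] by (auto simp: power2_eq_square)
      define \<eta> where "\<eta> = X + exp (- t)"
      have et: "exp (- t) \<le> R\<^sup>2" using t \<tau> by (smt (verit) exp_le_cancel_iff)
      have \<eta>: "0 \<le> \<eta>" "\<eta> \<le> 2 * R\<^sup>2" using et X by (auto simp: \<eta>_def)
      have w1: "\<omega>\<^sup>2 \<le> 1" using \<omega> by (simp add: power_le_one)
      have E: "0 \<le> E" "E \<le> R"
      proof -
        show "0 \<le> E" using sc R by (simp add: E_def)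
        have "exp (- t) * s \<le> R\<^sup>2 * 1" using et sc by (intro mult_mono) auto
        then show "E \<le> R" using R by (simp add: E_def divide_le_eq power2_eq_square)
      qed
      have m1: "K * \<eta> * (\<bar>gtt t X\<bar> + \<bar>gt t X\<bar> + \<bar>g t X\<bar>) \<le> \<omega>\<^sup>2 / 2 * D\<^sup>2"
      proof -
        have "\<bar>gtt t X\<bar> = 2 * \<omega>\<^sup>2 * \<bar>1 - 2 * s\<^sup>2\<bar> * D\<^sup>2" by (simp add: gtt_def abs_mult sc D_def)
        also have "\<dots> \<le> 2 * 1 * 1 * D\<^sup>2" using w1 s1 by (intro mult_mono mult_right_mono) (auto simp: abs_le_iff)
        finally have 1: "\<bar>gtt t X\<bar> \<le> 2 * D\<^sup>2" by simp
        have "\<bar>gt t X\<bar> = 2 * \<omega> * (s * \<bar>Co t\<bar>) * D\<^sup>2" using \<omega> by (simp add: gt_def abs_mult s_def D_def)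
        also have "\<dots> \<le> 2 * 1 * 1 * D\<^sup>2" using \<omega> s1 sc by (intro mult_mono mult_right_mono) auto
        finally have 2: "\<bar>gt t X\<bar> \<le> 2 * D\<^sup>2" by simp
        have "\<bar>g t X\<bar> = s\<^sup>2 * D\<^sup>2" by (simp add: g_def abs_mult sc D_def)
        also have "\<dots> \<le> 1 * D\<^sup>2" using s1 by (intro mult_right_mono) auto
        finally have 3: "\<bar>g t X\<bar> \<le> D\<^sup>2" by simp
        have "K * \<eta> * (\<bar>gtt t X\<bar> + \<bar>gt t X\<bar> + \<bar>g t X\<bar>) \<le> K * (2 * R\<^sup>2) * (5 * D\<^sup>2)"
          using 1 2 3 \<eta> assms(1) by (intro mult_mono mult_left_mono) auto
        also have "\<dots> = 20 * (K * R\<^sup>2) / 2 * D\<^sup>2" by simp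
        also have "\<dots> \<le> \<omega>\<^sup>2 / 2 * D\<^sup>2" using b2 by (intro mult_right_mono divide_right_mono) auto
        finally show ?thesis .
      qed
      have m2: "K * (exp (- t) * \<eta>) * (\<bar>gtX t X\<bar> + \<bar>gX t X\<bar>) \<le> \<omega> * D * E"
      proof -
        have "\<bar>gtX t X\<bar> = 4 * \<omega> / R\<^sup>2 * (s * \<bar>Co t\<bar>) * D" using \<omega> R D(1) by (simp add: gtX_def abs_mult s_def D_def)
        also have "\<dots> \<le> 4 * 1 / R\<^sup>2 * s * D"
          using \<omega> s1 sc R D by (intro mult_mono mult_right_mono divide_right_mono) auto
        finally have 1: "\<bar>gtX t X\<bar> \<le> 4 / R\<^sup>2 * s * D" by simp
        have "\<bar>gX t X\<bar> = 2 / R\<^sup>2 * s\<^sup>2 * D" using R D(1) by (simp add: gX_def abs_mult sc D_def)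
        also have "\<dots> \<le> 2 / R\<^sup>2 * s * D" using s1 R D by (intro mult_right_mono mult_left_mono) auto
        finally have 2: "\<bar>gX t X\<bar> \<le> 2 / R\<^sup>2 * s * D" .
        have "K * (exp (- t) * \<eta>) * (\<bar>gtX t X\<bar> + \<bar>gX t X\<bar>) \<le> K * (exp (- t) * (2 * R\<^sup>2)) * (6 / R\<^sup>2 * s * D)"
        proof -
          have "6 / R\<^sup>2 * s * D = 4 / R\<^sup>2 * s * D + 2 / R\<^sup>2 * s * D" by simp
          then have "\<bar>gtX t X\<bar> + \<bar>gX t X\<bar> \<le> 6 / R\<^sup>2 * s * D" using 1 2 by linarith
          then show ?thesis using \<eta> assms(1) by (intro mult_mono mult_left_mono) auto
        qed
        also have "\<dots> = 12 * (K * R) * (E * D)" using R by (simp add: E_def field_simps power2_eq_square)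
        also have "\<dots> \<le> \<omega> * (E * D)" using b1(1) nn E D by (intro mult_right_mono) auto
        finally show ?thesis by (simp add: mult_ac)
      qed
      have m3: "(exp (- t))\<^sup>2 * (4 * X * gXX t X + 2 * N * gX t X) = E\<^sup>2 * (8 - (8 + 4 * N) * D)"
      proof -
        define q where "q = s\<^sup>2 / R\<^sup>2"
        have "4 * (a * (1 - D)) * (2 / a * b) = 8 * (1 - D) * b" if "a \<noteq> 0" for a b :: real using that by simp
        from this[of "R\<^sup>2" q] have 1: "4 * X * gXX t X = 8 * (1 - D) * q"
          using R unfolding gXX_def sc D(3)[symmetric] q_def by simp
        have 2: "2 * N * gX t X = - (4 * N * D * q)" by (simp add: gX_def sc D_def[symmetric] q_def)
        have 3: "E\<^sup>2 = (exp (- t))\<^sup>2 * q" by (simp add: E_def power_divide power_mult_distrib q_def)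
        show ?thesis unfolding 1 2 3 by (simp add: algebra_simps)
      qed
      \<comment> \<open>Completing the square in (2 + N) D trades the negative part of this term for
        \<omega>^2 D^2 / 4 and leaves 4 E^2 to control the error from \<open>gtX\<close> and
        \<open>gX\<close>.\<close>
      have m4: "E\<^sup>2 * (8 - (8 + 4 * N) * D) \<ge> 4 * E\<^sup>2 - \<omega>\<^sup>2 / 4 * D\<^sup>2"
      proof -
        have "4 * ((2 + N) * D) \<le> 4 + (2 + N)\<^sup>2 * D\<^sup>2"
          using zero_le_power2[of "(2 + N) * D - 2"] by (simp add: power2_diff power_mult_distrib)
        then have "E\<^sup>2 * (4 - (2 + N)\<^sup>2 * D\<^sup>2) \<le> E\<^sup>2 * (8 - (8 + 4 * N) * D)"
          by (intro mult_left_mono) (auto simp: algebra_simps)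
        moreover have "E\<^sup>2 * ((2 + N)\<^sup>2 * D\<^sup>2) \<le> \<omega>\<^sup>2 / 4 * D\<^sup>2"
        proof -
          have "(2 + N)\<^sup>2 * E\<^sup>2 \<le> (2 + N)\<^sup>2 * R\<^sup>2" using E by (intro mult_left_mono power_mono) auto
          then have "(2 + N)\<^sup>2 * E\<^sup>2 \<le> \<omega>\<^sup>2 / 4" using b3 by simp
          from mult_right_mono[OF this, of "D\<^sup>2"] show ?thesis by (simp add: mult_ac)
        qed
        ultimately show ?thesis by (simp add: right_diff_distrib)
      qed
      have m5: "gtt t X + c * g t X \<ge> 2 * \<omega>\<^sup>2 * D\<^sup>2"
      proof -
        have "gtt t X + c * g t X = 2 * \<omega>\<^sup>2 * D\<^sup>2 + (c - 4 * \<omega>\<^sup>2) * (s\<^sup>2 * D\<^sup>2)"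
          by (simp add: gtt_def g_def sc D_def[symmetric] algebra_simps)
        moreover have "c - 4 * \<omega>\<^sup>2 \<ge> 0" using \<omega>c zero_le_power2[of \<omega>] by linarith
        then have "(c - 4 * \<omega>\<^sup>2) * (s\<^sup>2 * D\<^sup>2) \<ge> 0" by (intro mult_nonneg_nonneg) auto
        ultimately show ?thesis by simp
      qed
      \<comment> \<open>The error \<omega> D E of \<open>m2\<close> is absorbed by the positive
        terms in \<omega>^2 D^2 and E^2.\<close>
      have "(\<omega> * D - E)\<^sup>2 \<ge> 0" "\<omega>\<^sup>2 * D\<^sup>2 > 0" "E\<^sup>2 \<ge> 0" using \<omega> D by auto
      moreover have "(\<omega> * D - E)\<^sup>2 = \<omega>\<^sup>2 * D\<^sup>2 - 2 * (\<omega> * D * E) + E\<^sup>2" by (simp add: power2_diff power_mult_distrib)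
      moreover have "\<omega> * D * E \<ge> 0" using \<omega> D E by simp
      ultimately show ?thesis unfolding reduced_op_def \<eta>_def[symmetric] m3
        using m1 m2 m4 m5 by linarith
    qed
    have G: "\<forall>t X. g t X = (sin (\<omega> * (t - \<tau>)))\<^sup>2 * (1 - X / R\<^sup>2)\<^sup>2"
      by (simp add: g_def S_def d_def)
    show "\<exists>g gt gX gtt gtX gXX.
      (\<forall>t X. has_partials g (gt t X) (gX t X) t X \<and>
        has_partials gt (gtt t X) (gtX t X) t X \<and> has_partials gX (gtX t X) (gXX t X) t X) \<and>
      (\<forall>t X. g t X = (sin (\<omega> * (t - \<tau>)))\<^sup>2 * (1 - X / R\<^sup>2)\<^sup>2) \<and>
      (\<forall>t X. \<tau> \<le> t \<longrightarrow> 0 \<le> X \<longrightarrow> X < R\<^sup>2 \<longrightarrow>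
        reduced_op K N t X (g t X) (gt t X) (gtt t X) (gX t X) (gtX t X) (gXX t X) + c * g t X > 0)"
      by (rule exI[of _ g], rule exI[of _ gt], rule exI[of _ gX], rule exI[of _ gtt], rule exI[of _ gtX], rule exI[of _ gXX])
        (intro conjI[OF _ conjI[OF G allI[OF allI[OF impI[OF impI[OF impI[OF Q]]]]]]] allI conjI P)
  qed
qed

section \<open>Nonexistence\<close>

text \<open>The barriers are built for a larger constant than the Laplacian computation requires;
  the room a (X + exp (- t)) g so gained covers the loss in the potential.\<close>

lemma reduced_op_mono:
  assumes "a \<ge> 0" "X \<ge> 0" "g \<ge> 0"
  shows "reduced_op (K + a) N t X g gt gtt gX gtX gXX \<le> reduced_op K N t X g gt gtt gX gtX gXX - a * (X + exp (- t)) * g"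
proof -
  have "a * (X + exp (- t)) * (\<bar>gtt\<bar> + \<bar>gt\<bar> + \<bar>g\<bar>) \<ge> a * (X + exp (- t)) * g"
    using assms by (intro mult_left_mono) auto
  moreover have "a * (exp (- t) * (X + exp (- t))) * (\<bar>gtX\<bar> + \<bar>gX\<bar>) \<ge> 0" using assms by simp
  ultimately show ?thesis unfolding reduced_op_def by (simp add: algebra_simps)
qed

context weak_supersolution
begin

text \<open>Near each point V varies by less than \<theta>, and a Lebesgue number of this cover
  gives one radius for the compact set. Averaging with that radius costs at most \<theta> in the
  potential.\<close>

lemma uniform_radius:
  assumes "compact D" "D \<subseteq> W" "\<theta> > 0"
  obtains \<epsilon> where "\<epsilon> > 0" "\<And>x. x \<in> D \<Longrightarrow> cball x \<epsilon> \<subseteq> W"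
    "\<And>x y. x \<in> D \<Longrightarrow> y \<in> cball x \<epsilon> \<Longrightarrow> V x - \<theta> \<le> V y"
proof -
  define G where "G = {A. open A \<and> A \<subseteq> W \<and> (\<forall>y\<in>A. \<forall>z\<in>A. V y - \<theta> \<le> V z)}"
  have "D \<subseteq> \<Union>G"
  proof
    fix x assume "x \<in> D"
    then have x: "x \<in> W" using assms by auto
    define A where "A = W \<inter> V -` ball (V x) (\<theta> / 2)"
    have "open A" unfolding A_def by (rule continuous_open_preimage[OF V_cont open_W]) simp
    moreover have "V y - \<theta> \<le> V z" if "y \<in> A" "z \<in> A" for y z
    proof -
      have "\<bar>V x - V y\<bar> < \<theta> / 2" "\<bar>V x - V z\<bar> < \<theta> / 2" using that by (auto simp: A_def dist_real_def)
      then show ?thesis by linarith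
    qed
    ultimately have "A \<in> G" unfolding G_def A_def by auto
    moreover have "x \<in> A" using x assms(3) by (simp add: A_def)
    ultimately show "x \<in> \<Union>G" by blast
  qed
  then obtain e where e: "e > 0" "\<And>x. x \<in> D \<Longrightarrow> \<exists>A\<in>G. ball x e \<subseteq> A"
    using Heine_Borel_lemma[OF assms(1), of G] unfolding G_def by blast
  show ?thesis
  proof (rule that[of "e / 2"])
    show "e / 2 > 0" using e by simp
    fix x assume x: "x \<in> D"
    have sub: "cball x (e / 2) \<subseteq> ball x e" using e(1) by auto
    obtain A where A: "A \<in> G" "ball x e \<subseteq> A" using e(2)[OF x] by blast
    show "cball x (e / 2) \<subseteq> W" using sub A unfolding G_def by blast
    show "V x - \<theta> \<le> V y" if "y \<in> cball x (e / 2)" for y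
      using sub A that e(1) unfolding G_def by (metis (mono_tags, lifting) centre_in_ball mem_Collect_eq subsetD)
  qed
qed

text \<open>Geometry enters only through Y with its derivative bounds and through \<open>VY\<close>,
  whose quadratic loss in |x - \<sigma>| reflects that \<sigma> maximises q on \<Gamma>. Positivity
  is a separate assumption because it rests on connectedness. The direction e guarantees points of
  small Y close to \<sigma>, so that the final shell is not empty.\<close>

theorem hardy_supersolution_impossible:
  fixes Y :: "real^'n \<Rightarrow> real"
  assumes pos: "\<And>x s. s > 0 \<Longrightarrow> cball x s \<subseteq> W \<Longrightarrow> mean s x > 0"
    and r: "0 < r" and C: "C \<ge> 0" and \<alpha>: "\<alpha> > 0" "\<alpha> * (p - 1) \<ge> 2"
    and Yc: "continuous_on (cball \<sigma> r) Y" and Y0: "\<And>x. Y x \<ge> 0" "Y \<sigma> = 0"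
    and Y1: "\<And>x i. x \<in> cball \<sigma> r \<Longrightarrow> ((\<lambda>s. Y (x + s *\<^sub>R axis i 1)) has_real_derivative Y1 i x) (at 0)"
    and Y2: "\<And>x i. x \<in> cball \<sigma> r \<Longrightarrow> ((\<lambda>s. Y1 i (x + s *\<^sub>R axis i 1)) has_real_derivative Y2 i x) (at 0)"
    and E1: "\<And>x. x \<in> cball \<sigma> r \<Longrightarrow> \<bar>(\<Sum>i\<in>UNIV. (Y1 i x)\<^sup>2) - 4 * Y x\<bar> \<le> C * (((norm (x - \<sigma>))\<^sup>2 + sqrt (Y x)) * Y x)"
    and E2: "\<And>x. x \<in> cball \<sigma> r \<Longrightarrow> \<bar>(\<Sum>i\<in>UNIV. Y2 i x) - 2 * (2 * \<alpha> + 2)\<bar> \<le> C * ((norm (x - \<sigma>))\<^sup>2 + sqrt (Y x))"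
    and E3: "\<And>x. x \<in> cball \<sigma> r \<Longrightarrow> \<bar>\<Sum>i\<in>UNIV. Y1 i x * ((x - \<sigma>) $ i)\<bar>
      \<le> C * (sqrt (Y x) * ((norm (x - \<sigma>))\<^sup>2 + sqrt (Y x)))"
    and inW: "\<And>x. x \<in> cball \<sigma> r \<Longrightarrow> Y x > 0 \<Longrightarrow> x \<in> W"
    and VY: "\<And>x. x \<in> cball \<sigma> r \<Longrightarrow> Y x > 0 \<Longrightarrow> V x * Y x \<ge> \<alpha>\<^sup>2 * (1 - C * ((norm (x - \<sigma>))\<^sup>2 + sqrt (Y x)))"
    and e: "norm e = 1" "\<And>t. 0 \<le> t \<Longrightarrow> t \<le> r \<Longrightarrow> Y (\<sigma> + t *\<^sub>R e) \<ge> t\<^sup>2 / 4"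
  shows False
proof -

  \<comment> \<open>Logarithmic coordinates and compact shells\<close>
  define N where "N = real CARD('n)"
  define t where "t x = - ln (Y x) / 2" for x
  define X where "X x = (norm (x - \<sigma>))\<^sup>2" for x
  have X0: "X x \<ge> 0" for x by (simp add: X_def)
  have tY: "sqrt (Y x) = exp (- t x)" "Y x = exp (- 2 * t x)" if "Y x > 0" for x
  proof -
    show Y: "Y x = exp (- 2 * t x)" using that by (simp add: t_def)
    have "exp (- 2 * t x) = (exp (- t x))\<^sup>2" by (simp add: power2_eq_square exp_add[symmetric])
    then show "sqrt (Y x) = exp (- t x)" unfolding Y by simp
  qed
  \<comment> \<open>The lower bound on Y places these sets inside W by \<open>inW\<close>; being
    compact, each of them admits averages with one fixed radius.\<close>
  define shell where "shell R a b = {x \<in> cball \<sigma> R. exp (- 2 * b) \<le> Y x \<and> Y x \<le> exp (- 2 * a)}" for R a b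
  have shell_pos: "Y x > 0" "a \<le> t x" "t x \<le> b" "X x \<le> R\<^sup>2" if "x \<in> shell R a b" for x R a b
  proof -
    show Y: "Y x > 0" using that unfolding shell_def by (smt (verit) exp_gt_zero mem_Collect_eq)
    show "a \<le> t x" "t x \<le> b" using that tY(2)[OF Y] by (auto simp: shell_def)
    show "X x \<le> R\<^sup>2"
      using that by (auto simp: shell_def X_def dist_norm norm_minus_commute intro!: power_mono)
  qed
  have shell_compact: "compact (shell R a b)" if "R \<le> r" for R a b
  proof -
    have "closed (cball \<sigma> r \<inter> Y -` {exp (- 2 * b)..exp (- 2 * a)})"
      by (rule continuous_on_closed_vimage[THEN iffD1, rule_format, OF closed_cball Yc, unfolded Int_commute[of "_ -` _"]]) simp
    moreover have "shell R a b = cball \<sigma> R \<inter> (cball \<sigma> r \<inter> Y -` {exp (- 2 * b)..exp (- 2 * a)})"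
      using that by (auto simp: shell_def)
    ultimately show ?thesis by (metis compact_Int_closed compact_cball)
  qed
  have shell_W: "shell R a b \<subseteq> W" if "R \<le> r" for R a b
  proof
    fix x assume x: "x \<in> shell R a b"
    then have "x \<in> cball \<sigma> r" using that by (simp add: shell_def)
    then show "x \<in> W" using inW shell_pos(1)[OF x] by simp
  qed
  have shell_inner: "\<exists>d>0. ball x d \<subseteq> shell R a b"
    if "R \<le> r" "0 < R" "x \<in> shell R a b" "X x < R\<^sup>2" "a < t x" "t x < b" for x R a b
  proof -
    have "open (ball \<sigma> R \<inter> Y -` {exp (- 2 * b)<..<exp (- 2 * a)})"
      by (rule continuous_open_preimage[OF continuous_on_subset[OF Yc]]) (use that in auto)
    moreover have "x \<in> ball \<sigma> R \<inter> Y -` {exp (- 2 * b)<..<exp (- 2 * a)}"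
    proof -
      have "norm (x - \<sigma>) < R" using that(2,4) by (simp add: X_def power_less_imp_less_base)
      then show ?thesis using that(5,6) tY(2)[OF shell_pos(1)[OF that(3)]]
        by (simp add: dist_norm norm_minus_commute)
    qed
    ultimately obtain d where "d > 0" "ball x d \<subseteq> ball \<sigma> R \<inter> Y -` {exp (- 2 * b)<..<exp (- 2 * a)}"
      using open_contains_ball by blast
    then show ?thesis by (intro exI[of _ d]) (auto simp: shell_def subset_iff intro: less_imp_le)
  qed

  \<comment> \<open>The barrier and the pointwise inequality\<close>
  define K where "K = 2 * C * (1 + \<alpha>)\<^sup>2 + \<alpha>\<^sup>2 * (C + 1)"
  have K: "K \<ge> 0" using C by (simp add: K_def)
  obtain \<kappa> R0 T where \<kappa>: "\<kappa> > 0" and R0: "0 < R0" "R0 \<le> r" and T: "T \<ge> 1" and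
    barrier: "\<And>\<mu>. 0 \<le> \<mu> \<Longrightarrow> \<mu> \<le> 1 / 2 \<Longrightarrow> \<exists>g gt gX gtt gtX gXX.
      (\<forall>t X. t > 0 \<longrightarrow> X \<ge> 0 \<longrightarrow> has_partials g (gt t X) (gX t X) t X \<and>
        has_partials gt (gtt t X) (gtX t X) t X \<and> has_partials gX (gtX t X) (gXX t X) t X) \<and>
      (\<forall>t X. T \<le> t \<longrightarrow> 0 \<le> X \<longrightarrow> X \<le> R0\<^sup>2 \<longrightarrow>
        (g t X > 0 \<longrightarrow> reduced_op K N t X (g t X) (gt t X) (gtt t X) (gX t X) (gtX t X) (gXX t X) > 0) \<and>
        (X = R0\<^sup>2 \<longrightarrow> g t X \<le> 0) \<and> (\<mu> * t \<ge> 2 \<longrightarrow> g t X \<le> 0) \<and> g t X \<le> 2 \<and>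
        (16 * \<kappa>\<^sup>2 * t\<^sup>2 * X \<le> 1 \<longrightarrow> \<mu> * t \<le> 1 / 8 \<longrightarrow> g t X \<ge> 1 / 8))"
    by (rule exponential_barrier[OF K _ r, of N]) (simp_all add: N_def that)

  obtain cp where cp: "cp > 0"
    "\<And>s x a. s > 0 \<Longrightarrow> cball x s \<subseteq> W \<Longrightarrow> (\<And>y. y \<in> cball x s \<Longrightarrow> a \<le> V y) \<Longrightarrow>
      (\<Sum>i\<in>UNIV. (\<integral>y. w y * moll2 1 s i x y \<partial>lebesgue) / s ^ CARD('n)) \<le> - a * mean s x - cp * mean s x powr p"
    using mean_supersolution by blast

  text \<open>Both comparisons use the same pointwise inequality; \<open>B\<close> is the part of the potential
    gained from the nonlinear term.\<close>
  have step: "\<exists>L M.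
      (\<forall>i. has_second_difference (mean \<epsilon>) x i (L i)) \<and>
      (\<forall>i. has_second_difference v x i (M i)) \<and>
      (\<Sum>i\<in>UNIV. L i) * v x < (\<Sum>i\<in>UNIV. M i) * mean \<epsilon> x"
    if D: "D = shell R a b" "1 \<le> a" "R \<le> r" and x: "ball x d \<subseteq> D" "d > 0"
      and \<epsilon>: "\<epsilon> > 0" "cball x \<epsilon> \<subseteq> W" "\<And>y. y \<in> cball x \<epsilon> \<Longrightarrow> V x - \<alpha>\<^sup>2 \<le> V y"
      and g: "\<And>t X. t > 0 \<Longrightarrow> X \<ge> 0 \<Longrightarrow> has_partials g (gt t X) (gX t X) t X"
        "\<And>t X. t > 0 \<Longrightarrow> X \<ge> 0 \<Longrightarrow> has_partials gt (gtt t X) (gtX t X) t X"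
        "\<And>t X. t > 0 \<Longrightarrow> X \<ge> 0 \<Longrightarrow> has_partials gX (gtX t X) (gXX t X) t X"
      and v: "\<And>z. v z = c * (exp (\<alpha> * t z) * g (t z) (X z))" "c > 0"
      and gpos: "g (t x) (X x) > 0"
      and op: "reduced_op K N (t x) (X x) (g (t x) (X x)) (gt (t x) (X x)) (gtt (t x) (X x)) (gX (t x) (X x))
        (gtX (t x) (X x)) (gXX (t x) (X x)) + B * g (t x) (X x) > 0"
      and B: "B \<le> cp * mean \<epsilon> x powr (p - 1) * Y x"
    for D R a b x d \<epsilon> g gt gX gtt gtX gXX v c B
  proof -
    have sub: "cball x (d / 2) \<subseteq> D" using x by (auto simp: subset_iff)
    have sr: "D \<subseteq> cball \<sigma> r" using D by (auto simp: shell_def)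
    have xD: "x \<in> D" using x by auto
    note xs = shell_pos[OF xD[unfolded D(1)]]
    have xr: "x \<in> cball \<sigma> r" using xD sr by auto
    have tz: "t z > 0" "Y z > 0" if "z \<in> cball x (d / 2)" for z
      using shell_pos[of z R a b] sub that D by (auto simp: subset_iff)
    obtain M where M: "\<And>i. has_second_difference v x i (M i)"
      "(\<Sum>i\<in>UNIV. M i) * Y x \<ge> c * (exp (\<alpha> * t x) *
        (reduced_op (2 * C * (1 + \<alpha>)\<^sup>2) N (t x) (X x) (g (t x) (X x)) (gt (t x) (X x)) (gtt (t x) (X x)) (gX (t x) (X x))
          (gtX (t x) (X x)) (gXX (t x) (X x)) - \<alpha>\<^sup>2 * g (t x) (X x)))"
    proof -
      have "\<exists>M. (\<forall>i. has_second_difference v x i (M i)) \<and>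
        (\<Sum>i\<in>UNIV. M i) * Y x \<ge> c * (exp (\<alpha> * t x) *
          (reduced_op (2 * C * (1 + \<alpha>)\<^sup>2) (real CARD('n)) (t x) (X x) (g (t x) (X x)) (gt (t x) (X x)) (gtt (t x) (X x)) (gX (t x) (X x))
            (gtX (t x) (X x)) (gXX (t x) (X x)) - \<alpha>\<^sup>2 * g (t x) (X x)))"
      proof (rule barrier_laplacian[where B = "cball \<sigma> r" and e = "d / 2" and \<sigma> = \<sigma> and ?Y1.0 = Y1 and ?Y2.0 = Y2])
        show "cball x (d / 2) \<subseteq> cball \<sigma> r" "0 < d / 2" using sub sr x(2) by auto
        show "Y z > 0" if "z \<in> cball x (d / 2)" for z using tz that by simp
        show "t x = - ln (Y x) / 2" "X x = (norm (x - \<sigma>))\<^sup>2" by (simp_all add: t_def X_def)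
        show "\<bar>(\<Sum>i\<in>UNIV. (Y1 i x)\<^sup>2) - 4 * Y x\<bar> \<le> C * ((X x + sqrt (Y x)) * Y x)"
          "\<bar>(\<Sum>i\<in>UNIV. Y2 i x) - 2 * (2 * \<alpha> + 2)\<bar> \<le> C * (X x + sqrt (Y x))"
          "\<bar>\<Sum>i\<in>UNIV. Y1 i x * ((x - \<sigma>) $ i)\<bar> \<le> C * (sqrt (Y x) * (X x + sqrt (Y x)))"
          using E1[OF xr] E2[OF xr] E3[OF xr] by (simp_all add: X_def)
        show "has_partials g (gt (- ln (Y z) / 2) ((norm (z - \<sigma>))\<^sup>2)) (gX (- ln (Y z) / 2) ((norm (z - \<sigma>))\<^sup>2))
          (- ln (Y z) / 2) ((norm (z - \<sigma>))\<^sup>2)" if "z \<in> cball x (d / 2)" for z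
          using g(1)[OF tz(1)[OF that] X0[of z]] by (simp add: t_def X_def)
        show "has_partials gt (gtt (t x) (X x)) (gtX (t x) (X x)) (t x) (X x)"
          "has_partials gX (gtX (t x) (X x)) (gXX (t x) (X x)) (t x) (X x)"
          using g(2,3) tz(1)[of x] X0[of x] x(2) by auto
        show "v z = c * (exp (\<alpha> * (- ln (Y z) / 2)) * g (- ln (Y z) / 2) ((norm (z - \<sigma>))\<^sup>2))" for z
          using v(1)[of z] by (simp add: t_def X_def)
      qed (use Y1 Y2 C \<alpha> v in auto)
      then show ?thesis using that unfolding N_def by blast
    qed
    define L where "L i = (\<integral>y. w y * moll2 1 \<epsilon> i x y \<partial>lebesgue) / \<epsilon> ^ CARD('n)" for i
    have L: "has_second_difference (mean \<epsilon>) x i (L i)" for i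
      unfolding L_def by (rule mean_second_difference[OF \<epsilon>(1,2)])
    define m where "m = mean \<epsilon> x"
    define G where "G = g (t x) (X x)"
    define \<eta> where "\<eta> = X x + exp (- t x)"
    have m: "m > 0" unfolding m_def by (rule pos[OF \<epsilon>(1,2)])
    have LS: "(\<Sum>i\<in>UNIV. L i) \<le> - (V x - \<alpha>\<^sup>2) * m - cp * m powr (p - 1) * m"
    proof -
      have "m powr p = m powr (p - 1) * m" using m by (simp add: powr_diff)
      then show ?thesis using cp(2)[OF \<epsilon>(1,2), of "V x - \<alpha>\<^sup>2"] \<epsilon>(3) unfolding L_def m_def by simp
    qed
    have Yx: "Y x > 0" by (rule xs(1))
    have et: "exp (- t x) \<le> 1" using tz(1)[of x] x(2) by simp
    \<comment> \<open>The averaging loss \<alpha>^2 gets multiplied by Y, which is at most \<eta>,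
      and joins the loss C \<eta> coming from q. This is the summand \<alpha>^2 (C + 1) in
      \<open>K\<close>.\<close>
    have VYx: "(V x - \<alpha>\<^sup>2) * Y x \<ge> \<alpha>\<^sup>2 - \<alpha>\<^sup>2 * (C + 1) * \<eta>"
    proof -
      have "V x * Y x \<ge> \<alpha>\<^sup>2 * (1 - C * \<eta>)" using VY[OF xr Yx] by (simp add: \<eta>_def X_def tY(1)[OF Yx])
      moreover have "Y x \<le> \<eta>"
      proof -
        have "Y x = exp (- t x) * exp (- t x)" using tY(2)[OF Yx] by (simp add: exp_add[symmetric])
        also have "\<dots> \<le> exp (- t x)" using et by (simp add: mult_left_le)
        finally show ?thesis using X0[of x] by (simp add: \<eta>_def)
      qed
      then have "\<alpha>\<^sup>2 * Y x \<le> \<alpha>\<^sup>2 * \<eta>" by (intro mult_left_mono) auto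
      ultimately show ?thesis by (simp add: algebra_simps)
    qed
    define red where "red k = reduced_op k N (t x) (X x) (g (t x) (X x)) (gt (t x) (X x)) (gtt (t x) (X x)) (gX (t x) (X x))
        (gtX (t x) (X x)) (gXX (t x) (X x))" for k
    have rm: "red K \<le> red (2 * C * (1 + \<alpha>)\<^sup>2) - \<alpha>\<^sup>2 * (C + 1) * \<eta> * G"
      unfolding red_def K_def \<eta>_def G_def using C X0 gpos by (intro reduced_op_mono) auto
    define P where "P = c * exp (\<alpha> * t x)"
    have P: "P > 0" using v(2) by (simp add: P_def)
    have vx: "v x = P * G" by (simp add: v(1) P_def G_def)
    have G: "G > 0" using gpos by (simp add: G_def)
    have "(\<Sum>i\<in>UNIV. M i) * Y x + ((V x - \<alpha>\<^sup>2) * Y x + B) * (P * G) > 0"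
    proof -
      have "((V x - \<alpha>\<^sup>2) * Y x + B) * (P * G) \<ge> (\<alpha>\<^sup>2 - \<alpha>\<^sup>2 * (C + 1) * \<eta> + B) * (P * G)"
        using VYx P G by (intro mult_right_mono) auto
      moreover have "(\<Sum>i\<in>UNIV. M i) * Y x \<ge> P * (red (2 * C * (1 + \<alpha>)\<^sup>2) - \<alpha>\<^sup>2 * G)"
        using M(2) by (simp add: P_def red_def G_def mult.assoc)
      moreover have "P * (red K + B * G) > 0" using op P by (simp add: red_def G_def)
      moreover have "P * red K \<le> P * (red (2 * C * (1 + \<alpha>)\<^sup>2) - \<alpha>\<^sup>2 * (C + 1) * \<eta> * G)"
        using rm P by (intro mult_left_mono) auto
      ultimately show ?thesis by (simp add: algebra_simps)
    qed
    then have 1: "- (((V x - \<alpha>\<^sup>2) * Y x + B) * (P * G)) < (\<Sum>i\<in>UNIV. M i) * Y x" by simp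
    have "(\<Sum>i\<in>UNIV. L i) * (Y x * (P * G)) \<le> (- (V x - \<alpha>\<^sup>2) * m - cp * m powr (p - 1) * m) * (Y x * (P * G))"
      using LS Yx P G by (intro mult_right_mono) auto
    also have "\<dots> = - (((V x - \<alpha>\<^sup>2) * Y x + cp * m powr (p - 1) * Y x) * (P * G)) * m" by (simp add: algebra_simps)
    also have "\<dots> \<le> - (((V x - \<alpha>\<^sup>2) * Y x + B) * (P * G)) * m"
      using B m P G unfolding m_def[symmetric] by (intro mult_right_mono le_imp_neg_le) auto
    also have "\<dots> < (\<Sum>i\<in>UNIV. M i) * Y x * m" using 1 m by (rule mult_strict_right_mono)
    finally have "((\<Sum>i\<in>UNIV. L i) * v x) * Y x < ((\<Sum>i\<in>UNIV. M i) * m) * Y x" by (simp add: vx mult_ac)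
    then have "(\<Sum>i\<in>UNIV. L i) * v x < (\<Sum>i\<in>UNIV. M i) * m" using Yx by simp
    then show ?thesis using L M(1) unfolding m_def by blast
  qed

  \<comment> \<open>Choice of the constants\<close>
  define D0 where "D0 = shell R0 T T"
  \<comment> \<open>Only on the face t = T must U be bounded below in advance. By
    \<open>mean_antimono\<close> the bound holds for every radius up to \<delta>0, and
    \<open>D0\<close> involves neither the window nor \<mu>.\<close>
  obtain \<delta>0 c0 where \<delta>0: "\<delta>0 > 0" and c0: "c0 > 0" "\<And>x \<epsilon>. x \<in> D0 \<Longrightarrow> 0 < \<epsilon> \<Longrightarrow> \<epsilon> \<le> \<delta>0 \<Longrightarrow> mean \<epsilon> x \<ge> c0"
  proof -
    have D0: "compact D0" "D0 \<subseteq> W" using shell_compact shell_W R0 by (auto simp: D0_def)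
    obtain \<epsilon> where \<epsilon>: "\<epsilon> > 0" "\<And>x. x \<in> D0 \<Longrightarrow> cball x \<epsilon> \<subseteq> W"
      by (rule uniform_radius[OF D0 zero_less_one]) (rule that)
    show ?thesis
    proof (cases "D0 = {}")
      case True
      then show ?thesis using that[of \<epsilon> 1] \<epsilon> by simp
    next
      case False
      have "continuous_on D0 (mean \<epsilon>)"
        using mean_isCont[OF \<epsilon>(1)] \<epsilon>(2) by (intro continuous_at_imp_continuous_on) auto
      from continuous_attains_inf[OF D0(1) False this]
      obtain z where z: "z \<in> D0" "\<And>x. x \<in> D0 \<Longrightarrow> mean \<epsilon> z \<le> mean \<epsilon> x" by blast
      show ?thesis
      proof (rule that[of \<epsilon> "mean \<epsilon> z"])
        show "mean \<epsilon> z > 0" using pos \<epsilon> z by simp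
        show "mean \<epsilon> z \<le> mean s x" if "x \<in> D0" "0 < s" "s \<le> \<epsilon>" for x s
          using z(2)[OF that(1)] mean_antimono[OF that(2,3) \<epsilon>(2)[OF that(1)]] by simp
      qed fact
    qed
  qed
  text \<open>The lower bound \<open>c1\<close> must not depend on \<open>\<tau>\<close>: the length \<open>Q\<close> of the window in which
    the contradiction is found is determined by it, and only then \<open>\<tau>\<close> is taken large.\<close>
  define c where "c = c0 / (2 * exp (\<alpha> * T))"
  have c: "c > 0" using c0 by (simp add: c_def)
  \<comment> \<open>The barrier is at least 1 / 8 in the tube where the lower bound is
    wanted.\<close>
  define c1 where "c1 = c / 8"
  have c1: "c1 > 0" using c by (simp add: c1_def)
  define c2 where "c2 = cp * c1 powr (p - 1)"
  have c2: "c2 > 0" using cp c1 by (simp add: c2_def)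
  obtain \<omega> R1 where \<omega>: "0 < \<omega>" and R1: "0 < R1" and
    bump2: "\<And>R \<tau>. 0 < R \<Longrightarrow> R \<le> R1 \<Longrightarrow> exp (- \<tau>) \<le> R\<^sup>2 \<Longrightarrow> \<exists>g gt gX gtt gtX gXX.
      (\<forall>t X. has_partials g (gt t X) (gX t X) t X \<and>
        has_partials gt (gtt t X) (gtX t X) t X \<and> has_partials gX (gtX t X) (gXX t X) t X) \<and>
      (\<forall>t X. g t X = (sin (\<omega> * (t - \<tau>)))\<^sup>2 * (1 - X / R\<^sup>2)\<^sup>2) \<and>
      (\<forall>t X. \<tau> \<le> t \<longrightarrow> 0 \<le> X \<longrightarrow> X < R\<^sup>2 \<longrightarrow>
        reduced_op K N t X (g t X) (gt t X) (gtt t X) (gX t X) (gtX t X) (gXX t X) + c2 * g t X > 0)"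
    by (rule sine_bump[OF K _ c2, of N]) (simp_all add: N_def that)
  \<comment> \<open>The distance between consecutive zeros of the sine; the window for t reaches
    from \<tau> to \<tau> + Q.\<close>
  define Q where "Q = pi / \<omega>"
  have Q: "Q > 0" using \<omega> by (simp add: Q_def)
  \<comment> \<open>The width 1 / (4 \<kappa> (\<tau> + Q)) decays only like 1 / \<tau>, so for
    large \<tau> its square dominates exp (- \<tau>), as \<open>sine_bump\<close> requires.\<close>
  obtain \<tau> where \<tau>: "\<tau> > T" "exp (- \<tau>) \<le> (1 / (4 * \<kappa> * (\<tau> + Q)))\<^sup>2" "1 / (4 * \<kappa> * (\<tau> + Q)) \<le> min R1 (min R0 (1 / 4))"
  proof -
    define m0 where "m0 = min R1 (min R0 (1 / 4))"
    have m0: "m0 > 0" using R1 R0 by (simp add: m0_def)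
    have "\<forall>\<^sub>F \<tau> in at_top. \<tau> > T" by (rule eventually_gt_at_top)
    moreover have "\<forall>\<^sub>F \<tau> in at_top. exp (- \<tau>) \<le> (1 / (4 * \<kappa> * (\<tau> + Q)))\<^sup>2" using \<kappa> by real_asymp
    moreover have "\<forall>\<^sub>F \<tau> in at_top. 1 / (4 * \<kappa> * (\<tau> + Q)) \<le> m0" using \<kappa> m0 by real_asymp
    ultimately have "\<forall>\<^sub>F \<tau> in at_top. \<tau> > T \<and> exp (- \<tau>) \<le> (1 / (4 * \<kappa> * (\<tau> + Q)))\<^sup>2 \<and> 1 / (4 * \<kappa> * (\<tau> + Q)) \<le> m0"
      by eventually_elim simp
    then have "\<exists>\<tau>. \<tau> > T \<and> exp (- \<tau>) \<le> (1 / (4 * \<kappa> * (\<tau> + Q)))\<^sup>2 \<and> 1 / (4 * \<kappa> * (\<tau> + Q)) \<le> m0"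
      by (rule eventually_happens'[OF trivial_limit_at_top_linorder])
    then show ?thesis using that by (auto simp: m0_def)
  qed
  define l where "l = \<tau> + Q"
  \<comment> \<open>The largest width for which 16 \<kappa>^2 t^2 X \<le> 1 holds up to the end l of
    the window.\<close>
  define R where "R = 1 / (4 * \<kappa> * l)"
  have l: "l > 1" "T < l" "\<tau> < l" using \<tau>(1) T Q by (auto simp: l_def)
  have R: "0 < R" "R \<le> R1" "R \<le> R0" "R \<le> 1 / 4" "exp (- \<tau>) \<le> R\<^sup>2" "4 * \<kappa> * l * R = 1"
    using \<tau> \<kappa> l unfolding R_def l_def by auto
  \<comment> \<open>Then \<mu> t \<le> 1 / 8 up to t = l, while the barrier is nonpositive at t = 16
    l, the upper face of \<open>D1\<close>.\<close>
  define \<mu> where "\<mu> = 1 / (8 * l)"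
  have \<mu>: "0 < \<mu>" "\<mu> \<le> 1 / 2" "\<mu> * (16 * l) = 2" "\<mu> * l = 1 / 8" using l by (auto simp: \<mu>_def field_simps)
  define D1 where "D1 = shell R0 T (16 * l)"
  have D1: "compact D1" "D1 \<subseteq> W" using shell_compact shell_W R0 by (auto simp: D1_def)
  obtain \<epsilon>1 where \<epsilon>1: "\<epsilon>1 > 0" "\<And>x. x \<in> D1 \<Longrightarrow> cball x \<epsilon>1 \<subseteq> W"
    "\<And>x y. x \<in> D1 \<Longrightarrow> y \<in> cball x \<epsilon>1 \<Longrightarrow> V x - \<alpha>\<^sup>2 \<le> V y"
    using uniform_radius[OF D1, of "\<alpha>\<^sup>2"] \<alpha> by (metis zero_less_power)
  \<comment> \<open>The radius comes last: it depends on \<open>D1\<close> and so on \<tau>, whereas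
    c0 and c1 do not depend on it.\<close>
  define \<epsilon> where "\<epsilon> = min \<epsilon>1 \<delta>0"
  have \<epsilon>: "\<epsilon> > 0" "\<epsilon> \<le> \<delta>0" "\<And>x. x \<in> D1 \<Longrightarrow> cball x \<epsilon> \<subseteq> W"
    "\<And>x y. x \<in> D1 \<Longrightarrow> y \<in> cball x \<epsilon> \<Longrightarrow> V x - \<alpha>\<^sup>2 \<le> V y"
    using \<epsilon>1 \<delta>0 unfolding \<epsilon>_def by (auto simp: subset_iff)
  have Ucont: "continuous_on D1 (mean \<epsilon>)"
    using mean_isCont[OF \<epsilon>(1)] \<epsilon>(3) by (intro continuous_at_imp_continuous_on) auto
  have Upos: "mean \<epsilon> x > 0" if "x \<in> D1" for x using pos \<epsilon> that by simp
  have tc: "continuous_on D1 t" "continuous_on D1 X"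
  proof -
    have "continuous_on D1 Y" by (rule continuous_on_subset[OF Yc]) (use R0 in \<open>auto simp: D1_def shell_def\<close>)
    then show "continuous_on D1 t"
      unfolding t_def
    proof (intro continuous_intros)
      show "\<forall>x\<in>D1. Y x \<noteq> 0" using shell_pos(1) unfolding D1_def by fastforce
    qed simp_all
    show "continuous_on D1 X" unfolding X_def by (intro continuous_intros)
  qed
  have g_cont: "continuous_on D1 (\<lambda>x. k * (exp (\<alpha> * t x) * g (t x) (X x)))"
    if "\<And>t X. t > 0 \<Longrightarrow> X \<ge> 0 \<Longrightarrow> has_partials g (gt t X) (gX t X) t X" for g gt gX k
  proof -
    have "continuous_on ({0<..} \<times> {0..}) (\<lambda>p. g (fst p) (snd p))"
    proof (rule continuous_at_imp_continuous_on, rule ballI)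
      fix q :: "real \<times> real" assume "q \<in> {0<..} \<times> {0..}"
      then show "isCont (\<lambda>p. g (fst p) (snd p)) q"
        using that[of "fst q" "snd q"] has_derivative_continuous unfolding has_partials_def by fastforce
    qed
    from continuous_on_compose2[OF this continuous_on_Pair[OF tc]]
    have "continuous_on D1 (\<lambda>x. g (t x) (X x))"
      using shell_pos(2) T X0 by (force simp: D1_def)
    then show ?thesis by (intro continuous_intros tc)
  qed

  \<comment> \<open>The lower bound in the tube\<close>
  have lower: "mean \<epsilon> x \<ge> c1 * exp (\<alpha> * t x)" if x: "x \<in> D1" "t x \<le> l" "X x \<le> R\<^sup>2" for x
  proof -
    obtain g gt gX gtt gtX gXX where
      g': "\<forall>t X. t > 0 \<longrightarrow> X \<ge> 0 \<longrightarrow> has_partials g (gt t X) (gX t X) t X \<and>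
        has_partials gt (gtt t X) (gtX t X) t X \<and> has_partials gX (gtX t X) (gXX t X) t X"
      and h': "\<forall>t X. T \<le> t \<longrightarrow> 0 \<le> X \<longrightarrow> X \<le> R0\<^sup>2 \<longrightarrow>
        (g t X > 0 \<longrightarrow> reduced_op K N t X (g t X) (gt t X) (gtt t X) (gX t X) (gtX t X) (gXX t X) > 0) \<and>
        (X = R0\<^sup>2 \<longrightarrow> g t X \<le> 0) \<and> (\<mu> * t \<ge> 2 \<longrightarrow> g t X \<le> 0) \<and> g t X \<le> 2 \<and>
        (16 * \<kappa>\<^sup>2 * t\<^sup>2 * X \<le> 1 \<longrightarrow> \<mu> * t \<le> 1 / 8 \<longrightarrow> g t X \<ge> 1 / 8)"
      using barrier[OF less_imp_le[OF \<mu>(1)] \<mu>(2)] by (elim exE conjE) (rule that)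
    have g: "has_partials g (gt t X) (gX t X) t X" "has_partials gt (gtt t X) (gtX t X) t X"
      "has_partials gX (gtX t X) (gXX t X) t X" if "t > 0" "X \<ge> 0" for t X
      using g' that by simp_all
    have h: "g t X > 0 \<Longrightarrow> reduced_op K N t X (g t X) (gt t X) (gtt t X) (gX t X) (gtX t X) (gXX t X) > 0"
      "\<mu> * t \<ge> 2 \<Longrightarrow> g t X \<le> 0" "g t X \<le> 2"
      "16 * \<kappa>\<^sup>2 * t\<^sup>2 * X \<le> 1 \<Longrightarrow> \<mu> * t \<le> 1 / 8 \<Longrightarrow> g t X \<ge> 1 / 8" "X = R0\<^sup>2 \<Longrightarrow> g t X \<le> 0"
      if "T \<le> t" "0 \<le> X" "X \<le> R0\<^sup>2" for t X
      using h'[rule_format, OF that] by blast+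
    define v where "v z = c * (exp (\<alpha> * t z) * g (t z) (X z))" for z
    \<comment> \<open>On the face t = T one has v \<le> 2 c exp (\<alpha> T) = c0 \<le> U, and on
      the other faces v is nonpositive. The gain B from the nonlinear term is taken to be 0
      here.\<close>
    have vU: "v x \<le> 1 * mean \<epsilon> x"
    proof (rule touching_comparison[OF D1(1) Ucont _ Upos])
      show "continuous_on D1 v" unfolding v_def by (rule g_cont[OF g(1)])
      have inn: "\<exists>d>0. ball z d \<subseteq> D1" "g (t z) (X z) > 0" if z: "z \<in> D1" "v z > 1 * mean \<epsilon> z" for z
      proof -
        note zs = shell_pos[OF z(1)[unfolded D1_def]]
        have "v z > 0" using Upos[OF z(1)] z(2) by simp
        then show gz: "g (t z) (X z) > 0" using c by (simp add: v_def zero_less_mult_iff)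
        have "X z \<noteq> R0\<^sup>2" using h(5)[OF zs(2) X0 zs(4)] gz by auto
        moreover have "t z \<noteq> 16 * l" using h(2)[OF zs(2) X0 zs(4)] gz \<mu>(3) by auto
        moreover have "t z \<noteq> T"
        proof
          assume tz: "t z = T"
          then have "z \<in> D0" using z(1) tY(2)[OF zs(1)] by (simp add: D0_def D1_def shell_def)
          then have "mean \<epsilon> z \<ge> c0" using c0(2) \<epsilon> by simp
          moreover have "v z \<le> c * (exp (\<alpha> * T) * 2)"
            unfolding v_def tz using h(3)[of T "X z"] zs(4) X0 c by (intro mult_left_mono) auto
          moreover have "c * (exp (\<alpha> * T) * 2) = c0" by (simp add: c_def)
          ultimately show False using z(2) by simp
        qed
        ultimately show "\<exists>d>0. ball z d \<subseteq> D1"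
          unfolding D1_def using zs R0 z(1) by (intro shell_inner) (auto simp: D1_def)
      qed
      show "\<exists>d>0. ball z d \<subseteq> D1" if "z \<in> D1" "v z > 1 * mean \<epsilon> z" for z using inn(1)[OF that] .
      show "\<exists>L M.
        (\<forall>i. has_second_difference (mean \<epsilon>) z i (L i)) \<and>
        (\<forall>i. has_second_difference v z i (M i)) \<and>
        (\<Sum>i\<in>UNIV. L i) * v z < (\<Sum>i\<in>UNIV. M i) * mean \<epsilon> z"
        if z: "z \<in> D1" "v z > 1 * mean \<epsilon> z" for z
      proof -
        note zs = shell_pos[OF z(1)[unfolded D1_def]]
        obtain d where d: "d > 0" "ball z d \<subseteq> D1" using inn(1)[OF z] by blast
        have op0: "reduced_op K N (t z) (X z) (g (t z) (X z)) (gt (t z) (X z)) (gtt (t z) (X z)) (gX (t z) (X z))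
          (gtX (t z) (X z)) (gXX (t z) (X z)) + 0 * g (t z) (X z) > 0"
          using h(1)[OF zs(2) X0 zs(4) inn(2)[OF z]] by simp
        show ?thesis
          by (rule step[OF D1_def T R0(2) d(2,1) \<epsilon>(1) \<epsilon>(3)[OF z(1)] \<epsilon>(4)[OF z(1)] g v_def c inn(2)[OF z] op0])
            (use zs(1) cp in auto)
      qed
    qed (use x in auto)
    note xs = shell_pos[OF x(1)[unfolded D1_def]]
    have "16 * \<kappa>\<^sup>2 * (t x)\<^sup>2 * X x \<le> 16 * \<kappa>\<^sup>2 * l\<^sup>2 * R\<^sup>2"
      using x xs T X0 by (intro mult_mono mult_left_mono power_mono) auto
    also have "\<dots> = (4 * \<kappa> * l * R)\<^sup>2" by (simp add: power_mult_distrib)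
    finally have "16 * \<kappa>\<^sup>2 * (t x)\<^sup>2 * X x \<le> 1" using R(6) by simp
    moreover have "\<mu> * t x \<le> 1 / 8" using mult_left_mono[OF x(2), of \<mu>] \<mu> by simp
    ultimately have "g (t x) (X x) \<ge> 1 / 8" using h(4)[OF xs(2) X0 xs(4)] by simp
    then have "c * (exp (\<alpha> * t x) * (1 / 8)) \<le> v x" unfolding v_def using c by (intro mult_left_mono) auto
    then show ?thesis using vU by (simp add: c1_def)
  qed

  \<comment> \<open>The bump in the window\<close>
  define D2 where "D2 = shell R \<tau> l"
  have D2: "compact D2" "D2 \<subseteq> D1"
  proof -
    show "compact D2" using shell_compact R(3) R0(2) by (simp add: D2_def)
    have "exp (- 2 * (16 * l)) \<le> exp (- 2 * l)" "exp (- 2 * \<tau>) \<le> exp (- 2 * T)" using l \<tau>(1) by auto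
    then show "D2 \<subseteq> D1" unfolding D1_def D2_def shell_def mem_cball
      using R(3) by (blast intro: order.trans)
  qed
  obtain g gt gX gtt gtX gXX where g': "\<forall>t X. has_partials g (gt t X) (gX t X) t X \<and>
        has_partials gt (gtt t X) (gtX t X) t X \<and> has_partials gX (gtX t X) (gXX t X) t X"
    and gd': "\<forall>t X. g t X = (sin (\<omega> * (t - \<tau>)))\<^sup>2 * (1 - X / R\<^sup>2)\<^sup>2"
    and go': "\<forall>t X. \<tau> \<le> t \<longrightarrow> 0 \<le> X \<longrightarrow> X < R\<^sup>2 \<longrightarrow>
        reduced_op K N t X (g t X) (gt t X) (gtt t X) (gX t X) (gtX t X) (gXX t X) + c2 * g t X > 0"
    using bump2[OF R(1,2,5)] by (elim exE conjE) (rule that)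
  have g: "has_partials g (gt t X) (gX t X) t X" "has_partials gt (gtt t X) (gtX t X) t X"
    "has_partials gX (gtX t X) (gXX t X) t X" for t X using g' by simp_all
  note gd = gd'[rule_format] and go = go'[rule_format]
  define v where "v z = 1 * (exp (\<alpha> * t z) * g (t z) (X z))" for z
  \<comment> \<open>Comparison with \<theta> = 0 asserts that the bump is nonpositive, which is the
    contradiction sought. It vanishes on all faces of the shell, so points where it is positive are
    interior.\<close>
  have le0: "v x \<le> 0 * mean \<epsilon> x" if x: "x \<in> D2" for x
  proof (rule touching_comparison[OF D2(1) continuous_on_subset[OF Ucont D2(2)]])
    show "continuous_on D2 v" unfolding v_def by (rule continuous_on_subset[OF g_cont[OF g(1)] D2(2)])
    show "mean \<epsilon> z > 0" if "z \<in> D2" for z using Upos D2(2) that by auto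
    have inn: "\<exists>d>0. ball z d \<subseteq> D2" "g (t z) (X z) > 0" "X z < R\<^sup>2" if z: "z \<in> D2" "v z > 0 * mean \<epsilon> z" for z
    proof -
      note zs = shell_pos[OF z(1)[unfolded D2_def]]
      show gz: "g (t z) (X z) > 0" using z(2) by (simp add: v_def zero_less_mult_iff)
      have "X z \<noteq> R\<^sup>2" using gz R(1) by (auto simp: gd)
      then show XR: "X z < R\<^sup>2" using zs(4) by simp
      have "t z \<noteq> \<tau>" using gz by (auto simp: gd)
      moreover have "t z \<noteq> l" using gz \<omega> by (auto simp: gd l_def Q_def)
      ultimately show "\<exists>d>0. ball z d \<subseteq> D2"
        unfolding D2_def using zs R R0 z(1) XR by (intro shell_inner) (auto simp: D2_def)
    qed
    show "\<exists>d>0. ball z d \<subseteq> D2" if "z \<in> D2" "v z > 0 * mean \<epsilon> z" for z using inn(1)[OF that] .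
    show "\<exists>L M.
      (\<forall>i. has_second_difference (mean \<epsilon>) z i (L i)) \<and>
      (\<forall>i. has_second_difference v z i (M i)) \<and>
      (\<Sum>i\<in>UNIV. L i) * v z < (\<Sum>i\<in>UNIV. M i) * mean \<epsilon> z"
      if z: "z \<in> D2" "v z > 0 * mean \<epsilon> z" for z
    proof -
      note zs = shell_pos[OF z(1)[unfolded D2_def]]
      have zD1: "z \<in> D1" using z D2 by auto
      obtain d where d: "d > 0" "ball z d \<subseteq> D2" using inn(1)[OF z] by blast
      have \<tau>1: "1 \<le> \<tau>" and Rr: "R \<le> r" using \<tau>(1) T R(3) R0(2) by auto
      \<comment> \<open>The lower bound gives U powr (p - 1) \<ge> c1 powr (p - 1) * exp (\<alpha>
        (p - 1) t), and \<alpha> (p - 1) \<ge> 2 with exp (2 t) * Y = 1 turns this into a gain at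
        least c2, independent of t.\<close>
      have gain: "c2 \<le> cp * mean \<epsilon> z powr (p - 1) * Y z"
      proof -
        have "c1 powr (p - 1) * exp (2 * t z) \<le> c1 powr (p - 1) * exp (\<alpha> * t z * (p - 1))"
          using mult_right_mono[OF \<alpha>(2), of "t z"] zs(2) \<tau>1 by (intro mult_left_mono) (auto simp: mult_ac)
        also have "\<dots> = (c1 * exp (\<alpha> * t z)) powr (p - 1)"
          using c1 by (simp add: powr_mult exp_powr_real)
        also have "\<dots> \<le> mean \<epsilon> z powr (p - 1)"
          using lower[OF zD1 zs(3,4)] c1 p by (intro powr_mono2) auto
        finally have "c1 powr (p - 1) * exp (2 * t z) * Y z \<le> mean \<epsilon> z powr (p - 1) * Y z"
          using zs(1) by (intro mult_right_mono) auto
        moreover have "exp (2 * t z) * Y z = 1" using tY(2)[OF zs(1)] by (simp add: exp_add[symmetric])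
        ultimately have "c1 powr (p - 1) \<le> mean \<epsilon> z powr (p - 1) * Y z" by (simp add: mult.assoc)
        then show ?thesis using cp(1) by (simp add: c2_def mult.assoc)
      qed
      show ?thesis
        by (rule step[OF D2_def \<tau>1 Rr d(2,1) \<epsilon>(1) \<epsilon>(3)[OF zD1] \<epsilon>(4)[OF zD1] g v_def zero_less_one
            inn(2)[OF z] go[OF zs(2) X0 inn(3)[OF z]] gain])
    qed
  qed (use x in auto)

  \<comment> \<open>A point of the shell where the bump is positive\<close>
  define s where "s = \<tau> + Q / 2"
  have es: "exp (- 2 * s) \<le> R\<^sup>2 * R\<^sup>2"
  proof -
    have "exp (- 2 * s) \<le> exp (- \<tau>) * exp (- \<tau>)" using Q by (simp add: s_def exp_add[symmetric])
    also have "\<dots> \<le> R\<^sup>2 * R\<^sup>2" using R(5) by (intro mult_mono) auto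
    finally show ?thesis .
  qed
  have R4: "4 * R\<^sup>2 < 1" using power_mono[OF R(4), of 2] R(1) by (simp add: power2_eq_square)
  have R4': "R\<^sup>2 * R\<^sup>2 * 4 < R\<^sup>2" using mult_strict_left_mono[OF R4, of "R\<^sup>2"] R(1) by (simp add: mult_ac)
  \<comment> \<open>From \<sigma> along e, Y rises from 0 to at least R^2 / 4, which exceeds R^4
    \<ge> exp (- 2 s) because 4 R^2 < 1. So within distance R it takes the value belonging to the
    middle of the window.\<close>
  have "\<exists>a\<ge>0. a \<le> R \<and> Y (\<sigma> + a *\<^sub>R e) = exp (- 2 * s)"
  proof (rule IVT')
    show "Y (\<sigma> + 0 *\<^sub>R e) \<le> exp (- 2 * s)" using Y0 by simp
    have "R\<^sup>2 / 4 \<le> Y (\<sigma> + R *\<^sub>R e)" using e(2) R R0 by simp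
    then show "exp (- 2 * s) \<le> Y (\<sigma> + R *\<^sub>R e)" using es R4' by simp
    show "continuous_on {0..R} (\<lambda>a. Y (\<sigma> + a *\<^sub>R e))"
      by (rule continuous_on_compose2[OF Yc]) (use e(1) R R0 in \<open>auto intro!: continuous_intros simp: dist_norm\<close>)
  qed (use R in simp)
  then obtain a where a: "0 \<le> a" "a \<le> R" "Y (\<sigma> + a *\<^sub>R e) = exp (- 2 * s)" by blast
  define x where "x = \<sigma> + a *\<^sub>R e"
  have Xx: "X x < R\<^sup>2"
  proof -
    have "X x = a\<^sup>2" using e(1) by (simp add: X_def x_def)
    moreover have "a\<^sup>2 / 4 \<le> exp (- 2 * s)" using e(2)[of a] a R R0 by simp
    ultimately show ?thesis using es R4' by simp
  qed
  have ts: "t x = s" using a(3) by (simp add: t_def x_def)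
  have "x \<in> D2"
    using a e(1) Q unfolding D2_def shell_def x_def by (auto simp: dist_norm s_def l_def)
  from le0[OF this] have "v x \<le> 0" by simp
  moreover have "v x > 0"
  proof -
    have "\<omega> * (s - \<tau>) = pi / 2" using \<omega> by (simp add: s_def Q_def)
    then have "g (t x) (X x) = (1 - X x / R\<^sup>2)\<^sup>2" unfolding gd ts by (simp only: sin_pi_half) simp
    moreover have "X x / R\<^sup>2 < 1" using Xx R(1) by simp
    then have "0 < (1 - X x / R\<^sup>2)\<^sup>2" by (intro zero_less_power) simp
    ultimately show ?thesis unfolding v_def by simp
  qed
  ultimately show False by simp
qed

end

lemma laplacian_eq_0_outside_support:
  fixes \<phi> :: "real^'n::finite \<Rightarrow> real"
  assumes "x \<notin> closure {x. \<phi> x \<noteq> 0}"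
  shows "laplacian \<phi> x = 0"
proof -
  let ?O = "- closure {x. \<phi> x \<noteq> 0}"
  have O: "open ?O" "x \<in> ?O" using assms by auto
  have z: "partial i f y = 0" if "y \<in> ?O" "\<And>y. y \<in> ?O \<Longrightarrow> f y = 0" for f :: "real^'n \<Rightarrow> real" and i y
    using partial_cong[OF O(1) that(1), of f "\<lambda>x. 0" i] that(2) by (simp add: partial_def)
  have \<phi>: "\<phi> y = 0" if "y \<in> ?O" for y using that closure_subset[of "{x. \<phi> x \<noteq> 0}"] by auto
  have "partial i (partial i \<phi>) x = 0" for i
    by (rule z[OF O(2)]) (rule z[OF _ \<phi>])
  then show ?thesis by (simp add: laplacian_def)
qed

lemma continuous_on_laplacian:
  fixes \<phi> :: "real^'n::finite \<Rightarrow> real"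
  assumes "smooth_on UNIV \<phi>"
  shows "continuous_on UNIV (laplacian \<phi>)"
proof -
  have "Ck_on 2 UNIV \<phi>" using assms by (simp add: smooth_on_def)
  then have "continuous_on UNIV (partial i (partial i \<phi>))" for i by (simp add: numeral_2_eq_2)
  then show ?thesis unfolding laplacian_def[abs_def] by (intro continuous_on_sum)
qed

lemma borel_measurable_mult_supported:
  fixes u h :: "real^'n::finite \<Rightarrow> real"
  assumes "open W" "(\<lambda>x. indicator W x * u x) \<in> borel_measurable lebesgue"
    "continuous_on W h" "\<And>x. x \<notin> W \<Longrightarrow> h x = 0"
  shows "(\<lambda>x. u x * h x) \<in> borel_measurable lebesgue"
proof -
  have "(\<lambda>x. indicator W x *\<^sub>R h x) \<in> borel_measurable borel"
    by (rule borel_measurable_continuous_on_indicator) (use assms in auto)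
  then have "(\<lambda>x. indicator W x * h x) \<in> borel_measurable lebesgue" by (simp add: measurable_completion)
  from borel_measurable_times[OF assms(2) this]
  have "(\<lambda>x. indicator W x * u x * (indicator W x * h x)) \<in> borel_measurable lebesgue" .
  moreover have "indicator W x * u x * (indicator W x * h x) = u x * h x" for x
    using assms(4)[of x] by (simp add: indicator_def)
  ultimately show ?thesis by simp
qed

theorem theorem4p1:
  fixes \<Gamma> \<Omega> :: "(real^'n::finite) set" and k :: nat and q :: "real^'n \<Rightarrow> real" and p :: real
  assumes "CARD('n) \<ge> 3"
    and "1 \<le> k" and "k < CARD('n) - 2"
    and "closed_smooth_submanifold \<Gamma> k"
    and "smooth_domain \<Omega>" and "\<Gamma> \<subseteq> \<Omega>"
    and "Ck_on 2 \<Omega> q" and "\<forall>x\<in>\<Omega>. q x \<ge> 0"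
    and "\<exists>\<sigma>\<in>\<Gamma>. q \<sigma> = 1" and "\<forall>\<sigma>\<in>\<Gamma>. q \<sigma> \<le> 1"
    and "p \<ge> (real CARD('n) - real k + 2) / (real CARD('n) - real k - 2)"
  shows "\<not> (\<exists>u :: real^'n \<Rightarrow> real.
            Lp_loc p (\<Omega> - \<Gamma>) u \<and>
            (AE x in lebesgue. x \<in> \<Omega> - \<Gamma> \<longrightarrow> u x \<ge> 0) \<and>
            \<not> (AE x in lebesgue. x \<in> \<Omega> - \<Gamma> \<longrightarrow> u x = 0) \<and>
            (\<forall>\<phi>. test_fun (\<Omega> - \<Gamma>) \<phi> \<and> (\<forall>x. \<phi> x \<ge> 0) \<longrightarrow>
               (\<integral>x. u x * (- laplacian \<phi> x
                    - (real CARD('n) - real k - 2)^2 / 4 * q x / (infdist x \<Gamma>)^2 * \<phi> x) \<partial>lebesgue)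
               \<ge> (\<integral>x. u x powr p * \<phi> x \<partial>lebesgue)))"
proof
  assume "\<exists>u :: real^'n \<Rightarrow> real.
            Lp_loc p (\<Omega> - \<Gamma>) u \<and>
            (AE x in lebesgue. x \<in> \<Omega> - \<Gamma> \<longrightarrow> u x \<ge> 0) \<and>
            \<not> (AE x in lebesgue. x \<in> \<Omega> - \<Gamma> \<longrightarrow> u x = 0) \<and>
            (\<forall>\<phi>. test_fun (\<Omega> - \<Gamma>) \<phi> \<and> (\<forall>x. \<phi> x \<ge> 0) \<longrightarrow>
               (\<integral>x. u x * (- laplacian \<phi> x
                    - (real CARD('n) - real k - 2)^2 / 4 * q x / (infdist x \<Gamma>)^2 * \<phi> x) \<partial>lebesgue)
               \<ge> (\<integral>x. u x powr p * \<phi> x \<partial>lebesgue))"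
  then obtain u :: "real^'n \<Rightarrow> real" where Lp: "Lp_loc p (\<Omega> - \<Gamma>) u"
    and nn: "AE x in lebesgue. x \<in> \<Omega> - \<Gamma> \<longrightarrow> u x \<ge> 0"
    and nz: "\<not> (AE x in lebesgue. x \<in> \<Omega> - \<Gamma> \<longrightarrow> u x = 0)"
    and ineq: "\<And>\<phi>. test_fun (\<Omega> - \<Gamma>) \<phi> \<Longrightarrow> (\<And>x. \<phi> x \<ge> 0) \<Longrightarrow>
       (\<integral>x. u x * (- laplacian \<phi> x
            - (real CARD('n) - real k - 2)^2 / 4 * q x / (infdist x \<Gamma>)^2 * \<phi> x) \<partial>lebesgue)
       \<ge> (\<integral>x. u x powr p * \<phi> x \<partial>lebesgue)" by blast
  obtain \<sigma> where \<sigma>: "\<sigma> \<in> \<Gamma>" "q \<sigma> = 1" using assms(9) by blast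
  have \<Gamma>: "compact \<Gamma>" "closed \<Gamma>" "smooth_submanifold \<Gamma> k" "\<Gamma> \<noteq> {}"
    using assms(4) \<sigma> by (auto simp: closed_smooth_submanifold_def compact_imp_closed)
  have \<Omega>: "open \<Omega>" "connected \<Omega>" using assms(5) by (auto simp: smooth_domain_def)
  define \<alpha> where "\<alpha> = (real CARD('n) - real k - 2) / 2"
  have \<alpha>: "\<alpha> > 0" using assms(3) by (simp add: \<alpha>_def)
  have k: "k + 2 \<le> CARD('n)" "k < CARD('n)" using assms(3) by auto
  have "p * (real CARD('n) - real k - 2) \<ge> real CARD('n) - real k + 2"
    using assms(11) \<alpha> by (simp add: \<alpha>_def divide_le_eq)
  \<comment> \<open>The hypothesis on p in the form in which it acts.\<close>
  then have \<alpha>p: "\<alpha> * (p - 1) \<ge> 2" by (simp add: \<alpha>_def field_simps)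
  have p: "p > 1"
  proof (rule ccontr)
    assume "\<not> p > 1"
    then have "\<alpha> * (p - 1) \<le> 0" using \<alpha> by (intro mult_nonneg_nonpos) auto
    then show False using \<alpha>p by simp
  qed
  define W where "W = \<Omega> - \<Gamma>"
  define V where "V x = (real CARD('n) - real k - 2)^2 / 4 * q x / (infdist x \<Gamma>)^2" for x
  \<comment> \<open>The absolute value, cut off outside W: it agrees with u almost everywhere on W
    and is nonnegative everywhere, as the locale demands.\<close>
  define w where "w x = (if x \<in> W then \<bar>u x\<bar> else 0)" for x
  have W: "open W" unfolding W_def using \<Omega> \<Gamma> by (intro open_Diff)
  have inf0: "infdist x \<Gamma> > 0" if "x \<notin> \<Gamma>" for x
    using infdist_pos_not_in_closed[OF \<Gamma>(2,4) that] .
  have Vc: "continuous_on W V"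
    unfolding V_def
  proof (intro continuous_intros)
    show "continuous_on W q"
      by (rule continuous_on_subset[OF Ck_on_imp_continuous_on[OF assms(7)]]) (auto simp: W_def)
    show "\<forall>x\<in>W. (infdist x \<Gamma>)\<^sup>2 \<noteq> 0" using inf0 by (force simp: W_def)
  qed
  have um: "(\<lambda>x. indicator W x * u x) \<in> borel_measurable lebesgue"
    using Lp unfolding Lp_loc_def set_borel_measurable_def W_def by simp
  have wm: "w \<in> borel_measurable lebesgue"
  proof -
    have "w = (\<lambda>x. \<bar>indicator W x * u x\<bar>)" by (auto simp: w_def fun_eq_iff)
    then show ?thesis using um by simp
  qed
  have eqAE: "AE x in lebesgue. x \<in> W \<longrightarrow> u x = w x"
    using nn by eventually_elim (auto simp: w_def W_def)
  have iwp: "integrable lebesgue (\<lambda>y. indicator C y * w y powr p)" if "compact C" "C \<subseteq> W" for C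
  proof -
    have "integrable lebesgue (\<lambda>y. indicator C y * \<bar>u y\<bar> powr p)"
      using Lp that unfolding Lp_loc_def set_integrable_def W_def by simp
    moreover have "indicator C y * \<bar>u y\<bar> powr p = indicator C y * w y powr p" for y
      using that(2) by (auto simp: w_def indicator_def)
    ultimately show ?thesis by simp
  qed
  \<comment> \<open>Local integrability is given for the p-th power; w \<le> 1 + w powr p passes it
    on to w itself.\<close>
  have iw: "integrable lebesgue (\<lambda>y. indicator C y * w y)" if C: "compact C" "C \<subseteq> W" for C
  proof (rule Bochner_Integration.integrable_bound)
    have "integrable lebesgue (indicator C :: real^'n \<Rightarrow> real)"
      using lmeasurable_compact[OF C(1)] fmeasurableD2[of C lebesgue]
      by (auto simp: less_top[symmetric] intro!: integrable_real_indicator)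
    then show "integrable lebesgue (\<lambda>y. indicator C y + indicator C y * w y powr p)"
      using iwp[OF C] by (intro Bochner_Integration.integrable_add)
    show "(\<lambda>y. indicator C y * w y) \<in> borel_measurable lebesgue"
      using lmeasurable_compact[OF C(1)] wm by (intro borel_measurable_times borel_measurable_indicator) auto
    show "AE y in lebesgue. norm (indicator C y * w y) \<le> norm (indicator C y + indicator C y * w y powr p)"
    proof (rule AE_I2)
      fix y
      have "w y \<ge> 0" by (simp add: w_def)
      then have "w y \<le> 1 + w y powr p"
      proof (cases "w y \<le> 1")
        case False
        then have "w y powr 1 \<le> w y powr p" using p by (intro powr_mono) auto
        then show ?thesis using False by simp
      qed (smt (verit) powr_ge_zero)
      then show "norm (indicator C y * w y) \<le> norm (indicator C y + indicator C y * w y powr p)"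
        using \<open>w y \<ge> 0\<close> by (auto simp: indicator_def)
    qed
  qed
  interpret weak_supersolution W w V p
  proof
    show "open W" by fact
    show "w y \<ge> 0" for y by (simp add: w_def)
    show "integrable lebesgue (\<lambda>y. indicator C y * w y)" "integrable lebesgue (\<lambda>y. indicator C y * w y powr p)"
      if "compact C" "C \<subseteq> W" for C using iw iwp that by auto
    show "V y \<ge> 0" if "y \<in> W" for y using that assms(8) by (auto simp: V_def W_def)
    show "continuous_on W V" "p > 1" by fact+
    fix \<phi> :: "real^'n \<Rightarrow> real" assume \<phi>: "test_fun W \<phi>" "\<And>y. \<phi> y \<ge> 0"
    define h where "h x = - laplacian \<phi> x - V x * \<phi> x" for x
    have sm: "smooth_on UNIV \<phi>" and cl: "closure {x. \<phi> x \<noteq> 0} \<subseteq> W" using \<phi> by (auto simp: test_fun_def)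
    have \<phi>0: "\<phi> x = 0" if "x \<notin> W" for x
      using that cl closure_subset[of "{x. \<phi> x \<noteq> 0}"] by auto
    have h0: "h x = 0" if "x \<notin> W" for x
    proof -
      have "x \<notin> closure {x. \<phi> x \<noteq> 0}" using that cl by blast
      then show ?thesis using \<phi>0[OF that] by (simp add: h_def laplacian_eq_0_outside_support)
    qed
    have \<phi>c: "continuous_on W \<phi>" using smooth_on_imp_continuous_on[OF sm] continuous_on_subset by blast
    have hc: "continuous_on W h"
      unfolding h_def using continuous_on_subset[OF continuous_on_laplacian[OF sm]] Vc \<phi>c by (intro continuous_intros) auto
    have wi: "(\<lambda>x. indicator W x * w x) \<in> borel_measurable lebesgue"
      using wm W by (intro borel_measurable_times borel_measurable_indicator) auto
    have upm: "(\<lambda>x. indicator W x * u x powr p) \<in> borel_measurable lebesgue"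
    proof -
      have "(\<lambda>x. indicator W x * u x powr p) = (\<lambda>x. (indicator W x * u x) powr p)"
        by (auto simp: indicator_def fun_eq_iff)
      then show ?thesis using um by simp
    qed
    have wpm: "(\<lambda>x. indicator W x * w x powr p) \<in> borel_measurable lebesgue"
    proof -
      have "(\<lambda>x. indicator W x * w x powr p) = (\<lambda>x. (indicator W x * w x) powr p)"
        by (auto simp: indicator_def fun_eq_iff)
      then show ?thesis using wi by simp
    qed
    \<comment> \<open>Replacing u by w under the integral requires measurability of the products. It
      is known for u only on W, and the test function vanishes elsewhere.\<close>
    have "(\<integral>y. w y powr p * \<phi> y \<partial>lebesgue) = (\<integral>y. u y powr p * \<phi> y \<partial>lebesgue)"
    proof (rule integral_cong_AE)
      show "(\<lambda>y. w y powr p * \<phi> y) \<in> borel_measurable lebesgue" "(\<lambda>y. u y powr p * \<phi> y) \<in> borel_measurable lebesgue"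
        by (rule borel_measurable_mult_supported[OF W wpm \<phi>c \<phi>0] borel_measurable_mult_supported[OF W upm \<phi>c \<phi>0]; assumption)+
      show "AE y in lebesgue. w y powr p * \<phi> y = u y powr p * \<phi> y"
        using eqAE by eventually_elim (use \<phi>0 in force)
    qed
    also have "\<dots> \<le> (\<integral>x. u x * h x \<partial>lebesgue)"
      using ineq[OF \<phi>[unfolded W_def]] unfolding h_def V_def .
    also have "\<dots> = (\<integral>x. w x * h x \<partial>lebesgue)"
    proof (rule integral_cong_AE)
      show "(\<lambda>y. u y * h y) \<in> borel_measurable lebesgue" "(\<lambda>y. w y * h y) \<in> borel_measurable lebesgue"
        by (rule borel_measurable_mult_supported[OF W um hc h0] borel_measurable_mult_supported[OF W wi hc h0]; assumption)+
      show "AE y in lebesgue. u y * h y = w y * h y"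
        using eqAE by eventually_elim (use h0 in force)
    qed
    finally show "(\<integral>y. w y powr p * \<phi> y \<partial>lebesgue) \<le> (\<integral>y. w y * (- laplacian \<phi> y - V y * \<phi> y) \<partial>lebesgue)"
      unfolding h_def .
  qed
  have "connected W" unfolding W_def by (rule connected_Diff_submanifold[OF \<Omega> \<Gamma>(2,3) k(1)])
  moreover have "\<not> (AE y in lebesgue. y \<in> W \<longrightarrow> w y = 0)"
  proof
    assume "AE y in lebesgue. y \<in> W \<longrightarrow> w y = 0"
    then have "AE x in lebesgue. x \<in> \<Omega> - \<Gamma> \<longrightarrow> u x = 0" by eventually_elim (auto simp: w_def W_def)
    then show False using nz by simp
  qed
  ultimately have pos: "mean s x > 0" if "s > 0" "cball x s \<subseteq> W" for s x using mean_pos that by blast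
  obtain r C Y Y1 Y2 e where r: "0 < r" "cball \<sigma> r \<subseteq> \<Omega>" "C \<ge> 0"
    and Y: "continuous_on (cball \<sigma> r) Y" "\<And>x. Y x \<ge> 0"
    "\<And>x. x \<in> cball \<sigma> r \<Longrightarrow> x \<in> \<Gamma> \<Longrightarrow> Y x = 0"
    "\<And>x i. x \<in> cball \<sigma> r \<Longrightarrow> ((\<lambda>s. Y (x + s *\<^sub>R axis i 1)) has_real_derivative Y1 i x) (at 0)"
    "\<And>x i. x \<in> cball \<sigma> r \<Longrightarrow> ((\<lambda>s. Y1 i (x + s *\<^sub>R axis i 1)) has_real_derivative Y2 i x) (at 0)"
    "\<And>x. x \<in> cball \<sigma> r \<Longrightarrow> \<bar>(\<Sum>i\<in>UNIV. (Y1 i x)\<^sup>2) - 4 * Y x\<bar> \<le> C * (((norm (x - \<sigma>))\<^sup>2 + sqrt (Y x)) * Y x)"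
    "\<And>x. x \<in> cball \<sigma> r \<Longrightarrow> \<bar>(\<Sum>i\<in>UNIV. Y2 i x) - 2 * (real CARD('n) - real k)\<bar> \<le> C * ((norm (x - \<sigma>))\<^sup>2 + sqrt (Y x))"
    "\<And>x. x \<in> cball \<sigma> r \<Longrightarrow> \<bar>\<Sum>i\<in>UNIV. Y1 i x * ((x - \<sigma>) $ i)\<bar>
      \<le> C * (sqrt (Y x) * ((norm (x - \<sigma>))\<^sup>2 + sqrt (Y x)))"
    and d: "\<And>x. x \<in> cball \<sigma> r \<Longrightarrow> (infdist x \<Gamma>)\<^sup>2 \<le> Y x"
    and qY: "\<And>x. x \<in> cball \<sigma> r \<Longrightarrow> q x \<ge> 1 - C * ((norm (x - \<sigma>))\<^sup>2 + sqrt (Y x))"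
    and e: "norm e = 1" "\<And>t. 0 \<le> t \<Longrightarrow> t \<le> r \<Longrightarrow> Y (\<sigma> + t *\<^sub>R e) \<ge> t\<^sup>2 / 4"
    by (rule local_distance_substitute[OF \<Gamma>(3) \<sigma>(1) k(2) \<Omega>(1) assms(6,7,10) \<sigma>(2)]) (rule that)
  have inW: "x \<in> W" if "x \<in> cball \<sigma> r" "Y x > 0" for x
    using that r(2) Y(3)[OF that(1)] by (auto simp: W_def)
  show False
  proof (rule hardy_supersolution_impossible[OF pos r(1,3) \<alpha> \<alpha>p Y(1,2) _ Y(4,5,6) _ Y(8) inW _ e])
    show "Y \<sigma> = 0" using Y(3)[OF _ \<sigma>(1)] r by simp
    show "\<bar>(\<Sum>i\<in>UNIV. Y2 i x) - 2 * (2 * \<alpha> + 2)\<bar> \<le> C * ((norm (x - \<sigma>))\<^sup>2 + sqrt (Y x))" if "x \<in> cball \<sigma> r" for x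
    proof -
      have "2 * \<alpha> + 2 = real CARD('n) - real k" by (simp add: \<alpha>_def field_simps)
      then show ?thesis using Y(7)[OF that] by simp
    qed
    show "V x * Y x \<ge> \<alpha>\<^sup>2 * (1 - C * ((norm (x - \<sigma>))\<^sup>2 + sqrt (Y x)))" if x: "x \<in> cball \<sigma> r" "Y x > 0" for x
    proof -
      have "x \<in> \<Omega> - \<Gamma>" using inW[OF x] by (simp add: W_def)
      then have i: "(infdist x \<Gamma>)\<^sup>2 > 0" "q x \<ge> 0" using inf0[of x] assms(8) by auto
      \<comment> \<open>As q is nonnegative, exchanging the squared distance for the larger Y can
        only lower the potential.\<close>
      have "q x * 1 \<le> q x * (Y x / (infdist x \<Gamma>)\<^sup>2)"
        using d[OF x(1)] i by (intro mult_left_mono) auto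
      then have "1 - C * ((norm (x - \<sigma>))\<^sup>2 + sqrt (Y x)) \<le> q x * (Y x / (infdist x \<Gamma>)\<^sup>2)"
        using qY[OF x(1)] by simp
      then have "\<alpha>\<^sup>2 * (1 - C * ((norm (x - \<sigma>))\<^sup>2 + sqrt (Y x))) \<le> \<alpha>\<^sup>2 * (q x * (Y x / (infdist x \<Gamma>)\<^sup>2))"
        by (intro mult_left_mono) auto
      also have "\<dots> = V x * Y x" by (simp add: V_def \<alpha>_def power_divide)
      finally show ?thesis .
    qed
  qed
qed

end
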